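(* Let $\mathcal{F}_0 := D_0 \cap \operatorname{Ker} P_D$ and $m_0 := \dim \mathcal{F}_0$. Denote by $n_-$, $n_0$ and $n_+$ the number of negative, zero and positive eigenvalues (counted with multiplicity) of the sesquilinear form $q[G,F] := \langle G, P_R \Lambda P_R F\rangle$ restricted to $\mathcal{F}_0$. Then the spectrum $\{\lambda_n(\epsilon)\}_{n\in\mathbb{N}}$ of $H_\epsilon$ consists of: (1) infinitely many ("normal" or "fast") eigenvalues which tend to $+\infty$ at the rate $1/\epsilon^2$: for every $n > m_0$ there is a constant $\mu_n>0$ such that $$\lambda_n(\epsilon) = \mu_n \epsilon^{-2} + O(\epsilon^{-1}), \qquad \epsilon \to 0^+;$$ (2) and the $m_0$ lowest ("slow") eigenvalues $\lambda_n(\epsilon)$, $n \le m_0$, which are further broken into three types: (a) $n_-$ ("slow negative") eigenvalues tending to $-\infty$ at the rate $1/\epsilon$; (b) $n_0$ ("exotic") eigenvalues tending to a finite non-positive limit; (c) $n_+$ ("slow positive") eigenvalues tending to $+\infty$ at the rate $1/\epsilon$, as $\epsilon\to 0^+$.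
   Context: Let $\mathcal{E}$ be a finite nonempty set (of edges), and let $\ell_e>0$, $e\in\mathcal{E}$, be fixed. Each edge $e$ has two endpoints, denoted $e^-$ and $e^+$. Let $E \simeq \mathbb{C}^{2|\mathcal{E}|}$ be the space of boundary values and $E' \simeq \mathbb{C}^{2|\mathcal{E}|}$ the space of boundary derivative values, both with coordinates indexed by the endpoints $e^\pm$, $e\in\mathcal{E}$ (in the same order), with the standard Hermitian inner product $\langle\cdot,\cdot\rangle$; $E$ and $E'$ are identified in the natural way. For $\epsilon>0$ and $f=(f_e)_{e\in\mathcal{E}} \in \bigoplus_{e\in\mathcal{E}} H^2(0,\epsilon\ell_e)$ set $$f_{e^-} = f_e(0),\quad f_{e^+} = f_e(\epsilon\ell_e),\quad \partial f_{e^-} = f_e'(0),\quad \partial f_{e^+} = -f_e'(\epsilon\ell_e),$$ and $F := (f_{e^\pm})_{e\in\mathcal{E}} \in E$, $F' := (\partial f_{e^\pm})_{e\in\mathcal{E}} \in E'$. Let $P_D, P_N, P_R$ be orthogonal projectors on $\mathbb{C}^{2|\mathcal{E}|}$ with $P_D+P_N+P_R=I$ (so they are mutually orthogonal), and let $\Lambda$ be an invertible self-adjoint operator on the space $P_R E$. All of these are fixed, independent of $\epsilon$. The operator $H_\epsilon$ is the self-adjoint operator in $\bigoplus_{e\in\mathcal{E}} L_2(0,\epsilon\ell_e)$ (complex-valued functions) acting as $-d^2/dx^2$ on each edge, whose domain is the set of $f\in\bigoplus_{e\in\mathcal{E}} H^2(0,\epsilon\ell_e)$ satisfying $$P_D F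 = 0,\qquad P_N F' = 0,\qquad P_R F' = \Lambda P_R F.$$ Its eigenvalues $\lambda_1(\epsilon)\le\lambda_2(\epsilon)\le\cdots$ are numbered in non-decreasing order with multiplicity. Let $$D_0 := \{F \in E : F_{e^-} = F_{e^+} \text{ for all } e\in\mathcal{E}\}.$$ The eigenvalues of the Hermitian form $q$ restricted to a subspace are those of the self-adjoint operator on that subspace representing the form with respect to $\langle\cdot,\cdot\rangle$. "Tending to $\pm\infty$ at the rate $1/\epsilon$" means that $\epsilon\lambda_n(\epsilon)$ converges, as $\epsilon\to0^+$, to a finite non-zero limit of the corresponding sign. *)

theory Defs
  imports
    "HOL-Analysis.Analysis"
    "HOL-Library.Function_Algebras"
    "HOL-Library.Landau_Symbols"
begin

section \<open>Boundary values\<close>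

text \<open>
  Endpoints of edges are indexed by \<open>'e + 'e\<close>: \<open>Inl e\<close> is the endpoint $e^-$ and \<open>Inr e\<close> is
  the endpoint $e^+$.  The complex linear structure on \<open>complex ^ 'n\<close> is that of the locale
  interpretation \<open>vec\<close> (with scalar multiplication \<open>*s\<close>); the library's inner product on this type
  is the real one, hence the separate Hermitian product, which is antilinear in the first argument.
\<close>

definition hinner :: "complex ^ 'n \<Rightarrow> complex ^ 'n \<Rightarrow> complex" where
  "hinner G F = (\<Sum>i\<in>UNIV. cnj (G $ i) * F $ i)"

definition hermitian_adjoint :: "complex ^ 'n ^ 'n \<Rightarrow> complex ^ 'n ^ 'n" where
  "hermitian_adjoint A = (\<chi> i j. cnj (A $ j $ i))"

definition orthogonal_projector :: "complex ^ 'n ^ 'n \<Rightarrow> bool" where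
  "orthogonal_projector P \<longleftrightarrow> P ** P = P \<and> hermitian_adjoint P = P"

text \<open>
  Operators on a subspace \<open>S\<close> are represented by matrices that map \<open>S\<close> to itself; what the matrix
  does outside \<open>S\<close> is irrelevant.
\<close>

definition invertible_selfadjoint_on :: "(complex ^ 'n) set \<Rightarrow> complex ^ 'n ^ 'n \<Rightarrow> bool" where
  "invertible_selfadjoint_on S A \<longleftrightarrow>
     bij_betw (\<lambda>F. A *v F) S S \<and>
     (\<forall>G\<in>S. \<forall>F\<in>S. hinner G (A *v F) = hinner (A *v G) F)"

definition edgewise_constant :: "(complex ^ ('e::finite + 'e)) set" where
  "edgewise_constant = {F. \<forall>e. F $ Inl e = F $ Inr e}"


section \<open>Eigenvalues of a Hermitian form on a subspace\<close>

definition form_operator ::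
    "(complex ^ 'n) set \<Rightarrow> (complex ^ 'n \<Rightarrow> complex ^ 'n \<Rightarrow> complex) \<Rightarrow> complex ^ 'n \<Rightarrow> complex ^ 'n" where
  "form_operator V q F = (THE w. w \<in> V \<and> (\<forall>G\<in>V. hinner G w = q G F))"

definition form_eigenspace ::
    "(complex ^ 'n) set \<Rightarrow> (complex ^ 'n \<Rightarrow> complex ^ 'n \<Rightarrow> complex) \<Rightarrow> real \<Rightarrow> (complex ^ 'n) set" where
  "form_eigenspace V q x = {F \<in> V. form_operator V q F = complex_of_real x *s F}"

definition form_eigenvalue_count ::
    "(complex ^ 'n) set \<Rightarrow> (complex ^ 'n \<Rightarrow> complex ^ 'n \<Rightarrow> complex) \<Rightarrow> real set \<Rightarrow> nat" where
  "form_eigenvalue_count V q X =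
     (\<Sum>x \<in> {x \<in> X. form_eigenspace V q x \<noteq> {0}}. vec.dim (form_eigenspace V q x))"


section \<open>Functions on the edges\<close>

text \<open>
  A function on the metric graph is a family \<open>f e\<close> of functions on the real line.  An element of
  $H^2(0,L)$ is represented by its continuous representative on \<open>{0..L}\<close>, extended by zero, so
  that equality almost everywhere becomes equality and dimensions of spaces of such functions are
  the usual ones.
\<close>

definition edge_scale ::
    "complex \<Rightarrow> ('e \<Rightarrow> real \<Rightarrow> complex) \<Rightarrow> ('e \<Rightarrow> real \<Rightarrow> complex)" where
  "edge_scale c f = (\<lambda>e x. c * f e x)"

interpretation edge_fun: vector_space "edge_scale :: complex \<Rightarrow> ('e \<Rightarrow> real \<Rightarrow> complex) \<Rightarrow> _"
  by unfold_locales (auto simp: edge_scale_def fun_eq_iff algebra_simps)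

definition square_integrable :: "real \<Rightarrow> (real \<Rightarrow> complex) \<Rightarrow> bool" where
  "square_integrable L h \<longleftrightarrow>
     h \<in> borel_measurable (lebesgue_on {0<..<L}) \<and>
     integrable (lebesgue_on {0<..<L}) (\<lambda>x. (cmod (h x))\<^sup>2)"

text \<open>Derivative on the closed interval, one-sided at the endpoints.\<close>

definition edge_deriv :: "real \<Rightarrow> (real \<Rightarrow> complex) \<Rightarrow> real \<Rightarrow> complex" where
  "edge_deriv L f x = vector_derivative f (at x within {0..L})"

text \<open>
  \<open>f\<close> lies in $H^2(0,L)$ and has second derivative \<open>h\<close> (an element of $L_2(0,L)$, determined
  almost everywhere): \<open>f\<close> is differentiable and its derivative is absolutely continuous, namely
  the indefinite Lebesgue integral of \<open>h\<close>.
\<close>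

definition has_H2_second_deriv :: "real \<Rightarrow> (real \<Rightarrow> complex) \<Rightarrow> (real \<Rightarrow> complex) \<Rightarrow> bool" where
  "has_H2_second_deriv L f h \<longleftrightarrow>
     (\<forall>x. x \<notin> {0..L} \<longrightarrow> f x = 0) \<and>
     (\<forall>x\<in>{0..L}. f differentiable (at x within {0..L})) \<and>
     square_integrable L h \<and>
     (\<forall>x\<in>{0..L}. edge_deriv L f x = edge_deriv L f 0 + (LINT t:{0..x}|lebesgue. h t))"

definition boundary_values ::
    "('e::finite \<Rightarrow> real) \<Rightarrow> ('e \<Rightarrow> real \<Rightarrow> complex) \<Rightarrow> complex ^ ('e + 'e)" where
  "boundary_values L f = (\<chi> v. case v of Inl e \<Rightarrow> f e 0 | Inr e \<Rightarrow> f e (L e))"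

definition boundary_derivs ::
    "('e::finite \<Rightarrow> real) \<Rightarrow> ('e \<Rightarrow> real \<Rightarrow> complex) \<Rightarrow> complex ^ ('e + 'e)" where
  "boundary_derivs L f =
     (\<chi> v. case v of Inl e \<Rightarrow> edge_deriv (L e) (f e) 0 | Inr e \<Rightarrow> - edge_deriv (L e) (f e) (L e))"


section \<open>The graph Laplacian and its eigenvalues\<close>

text \<open>
  The unbounded operator on a graph with edge lengths \<open>L e\<close>, given as the set of pairs \<open>(f, g)\<close>
  with \<open>f\<close> in the domain and $g = -f''$ almost everywhere on each edge.
\<close>

definition graph_laplacian ::
    "('e::finite \<Rightarrow> real) \<Rightarrow> complex ^ ('e + 'e) ^ ('e + 'e) \<Rightarrow> complex ^ ('e + 'e) ^ ('e + 'e) \<Rightarrow>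
     complex ^ ('e + 'e) ^ ('e + 'e) \<Rightarrow> complex ^ ('e + 'e) ^ ('e + 'e) \<Rightarrow>
     (('e \<Rightarrow> real \<Rightarrow> complex) \<times> ('e \<Rightarrow> real \<Rightarrow> complex)) set" where
  "graph_laplacian L P\<^sub>D P\<^sub>N P\<^sub>R \<Lambda> =
     {(f, g). (\<forall>e. has_H2_second_deriv (L e) (f e) (\<lambda>x. - g e x)) \<and>
              P\<^sub>D *v boundary_values L f = 0 \<and>
              P\<^sub>N *v boundary_derivs L f = 0 \<and>
              P\<^sub>R *v boundary_derivs L f = \<Lambda> *v (P\<^sub>R *v boundary_values L f)}"

definition eigenspace ::
    "(('e \<Rightarrow> real \<Rightarrow> complex) \<times> ('e \<Rightarrow> real \<Rightarrow> complex)) set \<Rightarrow> complex \<Rightarrow> ('e \<Rightarrow> real \<Rightarrow> complex) set" where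
  "eigenspace H z = {f. (f, edge_scale z f) \<in> H}"

text \<open>
  \<open>l 1 \<le> l 2 \<le> \<dots>\<close> is the list of all eigenvalues of \<open>H\<close>, each repeated according to its
  multiplicity (the value \<open>l 0\<close> is not used).  Such a list is unique if it exists.  For a graph
  Laplacian all eigenspaces are finite-dimensional, so the convention that \<open>dim\<close> is \<open>0\<close> in
  infinite dimension plays no role.
\<close>

definition enumerates_eigenvalues ::
    "(('e \<Rightarrow> real \<Rightarrow> complex) \<times> ('e \<Rightarrow> real \<Rightarrow> complex)) set \<Rightarrow> (nat \<Rightarrow> real) \<Rightarrow> bool" where
  "enumerates_eigenvalues H l \<longleftrightarrow>
     mono_on {1..} l \<and>
     (\<forall>z. finite {n \<in> {1..}. complex_of_real (l n) = z} \<and>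
          card {n \<in> {1..}. complex_of_real (l n) = z} = edge_fun.dim (eigenspace H z))"

end

theory Submission
  imports Defs
begin

text \<open>
  Why the theorem holds.  Rescaling an edge by \<open>\<epsilon>\<close> turns the eigenvalue equation into
  \<open>- g'' = \<tau> g\<close> on the fixed interval of length \<open>len e\<close>, with \<open>\<tau> = \<epsilon>\<^sup>2 \<lambda>\<close>, and the vertex
  conditions into those of the quadratic form \<open>(\<integral> \<bar>g'\<bar>\<^sup>2) + \<epsilon> q[G]\<close> on functions with
  \<open>P\<^sub>D G = 0\<close>.  All claims are statements about this form.

  Reduction to finite dimension.  Cut every edge into \<open>N\<close> equal pieces.  As long as
  \<open>\<tau> < (\<pi> N / len e)\<^sup>2\<close> for all \<open>e\<close>, the form \<open>\<integral> \<bar>g'\<bar>\<^sup>2 - \<tau> \<bar>g\<bar>\<^sup>2\<close> is positive on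
  functions that vanish at the nodes; minimising it over all functions with given nodal values \<open>y\<close>
  leaves an explicit Hermitian form in \<open>y\<close>, the form \<open>stiff\<close> below.  Together with \<open>\<epsilon> q\<close> it
  makes up \<open>nform\<close>, whose kernel is the eigenspace of \<open>H\<^sub>\<epsilon>\<close> at \<open>\<tau> / \<epsilon>\<^sup>2\<close>
  (\<open>eigenspace_dim\<close>): testing at an interior node forces the three-term recurrence of a solution
  of the equation, and testing at the end points forces the vertex conditions.

  Counting.  The nodal form decreases strictly with \<open>\<tau>\<close>.  Hence its index (the maximal dimension
  of a subspace on which it is negative) is a left-continuous step function of \<open>\<tau>\<close> that jumps by
  the nullity (\<open>index_jumps_on\<close>); it is \<open>0\<close> near \<open>-\<infinity>\<close> and exceeds every bound when \<open>N\<close> grows.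
  So the index at \<open>\<tau>\<close> is the number of eigenvalues below \<open>\<tau> / \<epsilon>\<^sup>2\<close>, whatever \<open>N\<close> is used, and the
  points where it passes \<open>1, 2, \<dots>\<close> enumerate the spectrum (\<open>lam_enumerates\<close>, \<open>lam_less_iff\<close>).

  Fast eigenvalues.  The form \<open>q\<close> is bounded, while \<open>stiff\<close> decreases at a positive rate.  A shift
  of \<open>\<tau>\<close> by a multiple of \<open>\<epsilon>\<close> therefore outweighs the perturbation, and
  \<open>\<epsilon>\<^sup>2 \<lambda>\<^sub>n(\<epsilon>) = \<mu>\<^sub>n + O(\<epsilon>)\<close> with \<open>\<mu>\<^sub>n\<close> the unperturbed eigenvalue (\<open>fast_eigenvalues\<close>).
  At \<open>\<tau> = \<epsilon> = 0\<close> the kernel consists of the edgewise constant functions, which are \<open>\<F>\<^sub>0\<close>; so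
  \<open>\<mu>\<^sub>n > 0\<close> for \<open>n > m\<^sub>0\<close>.

  Slow eigenvalues.  Take \<open>\<tau> = c \<epsilon>\<close>, or \<open>\<tau> = c \<epsilon>\<^sup>2\<close> for the exotic ones.  The index does not change
  when basis vectors are rescaled.  If those in \<open>\<F>\<^sub>0\<close> are multiplied by \<open>\<epsilon>\<close> to the power \<open>-1/2\<close>,
  respectively those in the kernel of \<open>q\<close> on \<open>\<F>\<^sub>0\<close> by \<open>1/\<epsilon>\<close>, the form converges to a limit
  form (\<open>slow_limit\<close>, \<open>exotic_limit\<close>) that again decreases with \<open>c\<close>.  The index is lower
  semicontinuous, with defect at most the nullity of the limit (\<open>index_semicontinuous_weighted\<close>), so the
  points where the index passes \<open>n\<close> converge (\<open>level_tendsto\<close>).  Their signs are read off from the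
  limit forms: at \<open>c = 0\<close> the form \<open>slow_limit\<close> has the index and the nullity of \<open>q\<close> on \<open>\<F>\<^sub>0\<close>,
  and for every \<open>c > 0\<close> the form \<open>exotic_limit\<close> is negative on a space of dimension \<open>n\<^sub>- + n\<^sub>0\<close>, so the
  limits of the exotic eigenvalues cannot be positive.
\<close>

section \<open>Hermitian forms on finite-dimensional spaces\<close>

lemma bounded_perturbation:
  assumes "finite B" "\<And>b c. b \<in> B \<Longrightarrow> c \<in> B \<Longrightarrow> cmod (E b c) \<le> \<eta>"
  shows "cmod (\<Sum>b\<in>B. \<Sum>c\<in>B. cnj (u b) * u c * E b c) \<le> \<eta> * card B * (\<Sum>b\<in>B. (cmod (u b))\<^sup>2)"
proof (cases "B = {}")
  case False
  then have "\<eta> \<ge> 0" using assms(2) norm_ge_zero order_trans by (metis ex_in_conv)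
  have "cmod (\<Sum>b\<in>B. \<Sum>c\<in>B. cnj (u b) * u c * E b c) \<le> (\<Sum>b\<in>B. \<Sum>c\<in>B. cmod (u b) * cmod (u c) * \<eta>)"
    using assms by (intro sum_norm_le) (auto simp: norm_mult intro!: mult_left_mono)
  also have "\<dots> = \<eta> * ((\<Sum>b\<in>B. cmod (u b)) * (\<Sum>c\<in>B. cmod (u c)))"
    by (simp add: sum_product sum_distrib_left sum_distrib_right mult_ac)
  also have "\<dots> \<le> \<eta> * (card B * (\<Sum>b\<in>B. (cmod (u b))\<^sup>2))"
    using sum_squared_le_sum_of_squares[of "\<lambda>b. cmod (u b)" B] \<open>\<eta> \<ge> 0\<close>
    by (intro mult_left_mono) (simp_all add: power2_eq_square mult_ac)
  finally show ?thesis by (simp add: mult_ac)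
qed auto

locale complex_space = vector_space scale
  for scale :: "complex \<Rightarrow> 'v::ab_group_add \<Rightarrow> 'v" (infixr "*c" 75)
begin

definition fin_dim :: "'v set \<Rightarrow> bool" where
  "fin_dim V \<longleftrightarrow> subspace V \<and> (\<exists>B. finite B \<and> V \<subseteq> span B)"

definition functional_on :: "'v set \<Rightarrow> ('v \<Rightarrow> complex) \<Rightarrow> bool" where
  "functional_on V \<phi> \<longleftrightarrow>
     (\<forall>x\<in>V. \<forall>y\<in>V. \<phi> (x + y) = \<phi> x + \<phi> y) \<and> (\<forall>x\<in>V. \<forall>c. \<phi> (c *c x) = c * \<phi> x)"

definition hermitian_on :: "'v set \<Rightarrow> ('v \<Rightarrow> 'v \<Rightarrow> complex) \<Rightarrow> bool" where
  "hermitian_on V Q \<longleftrightarrow>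
     (\<forall>x\<in>V. functional_on V (Q x)) \<and> (\<forall>x\<in>V. \<forall>y\<in>V. Q y x = cnj (Q x y))"

definition negative_family :: "'v set \<Rightarrow> ('v \<Rightarrow> 'v \<Rightarrow> complex) \<Rightarrow> 'v set \<Rightarrow> bool" where
  "negative_family V Q B \<longleftrightarrow> finite B \<and> B \<subseteq> V \<and> independent B \<and>
     (\<forall>x\<in>span B. x \<noteq> 0 \<longrightarrow> Re (Q x x) < 0)"

definition index :: "'v set \<Rightarrow> ('v \<Rightarrow> 'v \<Rightarrow> complex) \<Rightarrow> nat" where
  "index V Q = Max (card ` {B. negative_family V Q B})"

definition radical :: "'v set \<Rightarrow> ('v \<Rightarrow> 'v \<Rightarrow> complex) \<Rightarrow> 'v set" where
  "radical V Q = {x \<in> V. \<forall>y\<in>V. Q y x = 0}"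

definition nullity :: "'v set \<Rightarrow> ('v \<Rightarrow> 'v \<Rightarrow> complex) \<Rightarrow> nat" where
  "nullity V Q = dim (radical V Q)"

definition sylvester_basis :: "'v set \<Rightarrow> ('v \<Rightarrow> 'v \<Rightarrow> complex) \<Rightarrow> 'v set \<Rightarrow> bool" where
  "sylvester_basis V Q B \<longleftrightarrow> finite B \<and> independent B \<and> span B = V \<and>
     (\<forall>x\<in>B. \<forall>y\<in>B. x \<noteq> y \<longrightarrow> Q x y = 0) \<and> (\<forall>x\<in>B. Q x x \<in> {-1, 0, 1})"

lemma fin_dim_subspace: "fin_dim V \<Longrightarrow> subspace V"
  by (simp add: fin_dim_def)

lemma fin_dim_independent:
  assumes "fin_dim V" "B \<subseteq> V" "independent B"
  shows "finite B" "card B \<le> dim V"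
proof -
  obtain D where D: "finite D" "V \<subseteq> span D"
    using assms(1) by (auto simp: fin_dim_def)
  obtain C where C: "C \<subseteq> V" "independent C" "V \<subseteq> span C" "card C = dim V"
    using basis_exists by blast
  have "finite C"
    using independent_span_bound[of D C] C D by blast
  then show "finite B" "card B \<le> dim V"
    using independent_span_bound[of C B] C assms by auto
qed

lemma fin_dim_span: "finite B \<Longrightarrow> fin_dim (span B)"
  by (auto simp: fin_dim_def)

lemma fin_dim_subset: "fin_dim V \<Longrightarrow> subspace W \<Longrightarrow> W \<subseteq> V \<Longrightarrow> fin_dim W"
  by (auto simp: fin_dim_def)

lemma fin_dim_basis:
  assumes "fin_dim V"
  obtains B where "finite B" "independent B" "span B = V" "card B = dim V"
proof -
  obtain C where C: "C \<subseteq> V" "independent C" "V \<subseteq> span C" "card C = dim V"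
    using basis_exists by blast
  moreover have "span C = V"
    using C assms span_subspace by (auto simp: fin_dim_def)
  ultimately show ?thesis
    using that fin_dim_independent[OF assms] by blast
qed

lemma functional_on_subset: "functional_on V \<phi> \<Longrightarrow> W \<subseteq> V \<Longrightarrow> functional_on W \<phi>"
  unfolding functional_on_def by blast

lemma functional_on_add: "functional_on V \<phi> \<Longrightarrow> x \<in> V \<Longrightarrow> y \<in> V \<Longrightarrow> \<phi> (x + y) = \<phi> x + \<phi> y"
  by (simp add: functional_on_def)

lemma functional_on_scale: "functional_on V \<phi> \<Longrightarrow> x \<in> V \<Longrightarrow> \<phi> (c *c x) = c * \<phi> x"
  by (simp add: functional_on_def)

lemma functional_on_sum:
  assumes "functional_on V \<phi>" "subspace V" "finite A" "\<And>i. i \<in> A \<Longrightarrow> f i \<in> V"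
  shows "\<phi> (\<Sum>i\<in>A. u i *c f i) = (\<Sum>i\<in>A. u i * \<phi> (f i))"
  using assms(3,4)
proof (induction A)
  case empty
  have "\<phi> (0 *c 0) = 0 * \<phi> 0"
    using assms(1) subspace_0[OF assms(2)] unfolding functional_on_def by blast
  then show ?case by simp
next
  case (insert a A)
  have "u a *c f a \<in> V" "(\<Sum>i\<in>A. u i *c f i) \<in> V"
    using insert assms(2) by (auto intro!: subspace_sum subspace_scale)
  then show ?case
    using insert assms(1) by (simp add: functional_on_def)
qed

text \<open>
  Each functional lowers the dimension by at most one.  This is how a subspace that is cut out by
  few functionals is shown to meet a subspace of large dimension.
\<close>

lemma functionals_common_zero:
  assumes "finite J" "fin_dim W" "card J < dim W" "\<And>j. j \<in> J \<Longrightarrow> functional_on W (\<phi> j)"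
  shows "\<exists>x\<in>W. x \<noteq> 0 \<and> (\<forall>j\<in>J. \<phi> j x = 0)"
  using assms
proof (induction J arbitrary: W)
  case empty
  have "\<not> W \<subseteq> {0}"
    using empty(2) dim_le_card[of W "{}"] by auto
  then show ?case by auto
next
  case (insert j J)
  define W' where "W' = {x \<in> W. \<phi> j x = 0}"
  have fn: "functional_on W (\<phi> j)" and sub: "subspace W"
    using insert by (auto simp: fin_dim_def)
  have "\<phi> j 0 = 0"
    using functional_on_sum[OF fn sub, of "{}"] by simp
  then have "subspace W'"
    using sub fn unfolding W'_def subspace_def functional_on_def by auto
  then have fd: "fin_dim W'"
    using fin_dim_subset[OF insert.prems(1)] by (auto simp: W'_def)
  have "card J < dim W'"
  proof (cases "W' = W")
    case True
    then show ?thesis using insert by simp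
  next
    case False
    then obtain w where w: "w \<in> W" "\<phi> j w \<noteq> 0" by (auto simp: W'_def)
    obtain C where C: "finite C" "independent C" "span C = W'" "card C = dim W'"
      using fin_dim_basis[OF fd] .
    have "x \<in> span (insert w C)" if "x \<in> W" for x
    proof -
      let ?y = "x + (- (\<phi> j x / \<phi> j w)) *c w"
      have "?y \<in> W"
        using sub that w by (intro subspace_add subspace_scale) auto
      moreover have "\<phi> j ?y = 0"
        unfolding functional_on_add[OF fn that subspace_scale[OF sub w(1)]] functional_on_scale[OF fn w(1)]
        using w by simp
      ultimately have "?y \<in> span C"
        using C by (auto simp: W'_def)
      then have "x - (\<phi> j x / \<phi> j w) *c w \<in> span C" by (simp add: scale_minus_left)
      then show ?thesis
        using span_breakdown_eq by blast
    qed
    then have "dim W \<le> card (insert w C)"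
      using C(1) by (intro dim_le_card) auto
    also have "\<dots> \<le> Suc (dim W')"
      using C by (metis card_insert_le_m1 card_insert_if le_SucI order_refl)
    finally show ?thesis using insert by simp
  qed
  moreover have "functional_on W' (\<phi> i)" if "i \<in> J" for i
    using insert.prems(3)[of i] that by (auto intro: functional_on_subset simp: W'_def)
  ultimately obtain x where "x \<in> W'" "x \<noteq> 0" "\<forall>i\<in>J. \<phi> i x = 0"
    using insert.IH[OF fd] by blast
  then show ?case by (auto simp: W'_def)
qed

lemma hermitian_on_subset: "hermitian_on V Q \<Longrightarrow> W \<subseteq> V \<Longrightarrow> hermitian_on W Q"
  unfolding hermitian_on_def by (meson functional_on_subset subsetD)

lemma hermitian_on_functional: "hermitian_on V Q \<Longrightarrow> x \<in> V \<Longrightarrow> functional_on V (Q x)"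
  unfolding hermitian_on_def by blast

lemma hermitian_on_cnj: "hermitian_on V Q \<Longrightarrow> x \<in> V \<Longrightarrow> y \<in> V \<Longrightarrow> Q y x = cnj (Q x y)"
  unfolding hermitian_on_def by blast

lemma hermitian_on_add_right:
  assumes "hermitian_on V Q" "x \<in> V" "y \<in> V" "z \<in> V"
  shows "Q x (y + z) = Q x y + Q x z"
  by (rule functional_on_add[OF hermitian_on_functional]) (fact assms)+

lemma hermitian_on_scale_right:
  assumes "hermitian_on V Q" "x \<in> V" "y \<in> V"
  shows "Q x (c *c y) = c * Q x y"
  by (rule functional_on_scale[OF hermitian_on_functional]) (fact assms)+

lemma hermitian_on_add_left:
  assumes "hermitian_on V Q" "subspace V" "x \<in> V" "y \<in> V" "z \<in> V"
  shows "Q (x + y) z = Q x z + Q y z"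
  unfolding hermitian_on_cnj[OF assms(1,5) subspace_add[OF assms(2-4)]]
    hermitian_on_cnj[OF assms(1,5,3)] hermitian_on_cnj[OF assms(1,5,4)]
    hermitian_on_add_right[OF assms(1,5,3,4)] by simp

lemma hermitian_on_scale_left:
  assumes "hermitian_on V Q" "subspace V" "x \<in> V" "z \<in> V"
  shows "Q (c *c x) z = cnj c * Q x z"
  unfolding hermitian_on_cnj[OF assms(1,4) subspace_scale[OF assms(2-3)]]
    hermitian_on_cnj[OF assms(1,4,3)] hermitian_on_scale_right[OF assms(1,4,3)] by simp

lemma hermitian_on_real: "hermitian_on V Q \<Longrightarrow> x \<in> V \<Longrightarrow> Im (Q x x) = 0"
  using hermitian_on_cnj[of V Q x x] by (simp add: complex_eq_iff)

lemma hermitian_on_sum: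
  assumes "hermitian_on V Q" "subspace V" "finite A" "\<And>i. i \<in> A \<Longrightarrow> f i \<in> V"
    "finite B" "\<And>i. i \<in> B \<Longrightarrow> g i \<in> V"
  shows "Q (\<Sum>i\<in>A. u i *c f i) (\<Sum>j\<in>B. w j *c g j) = (\<Sum>i\<in>A. \<Sum>j\<in>B. cnj (u i) * w j * Q (f i) (g j))"
proof -
  have A: "(\<Sum>i\<in>A. u i *c f i) \<in> V"
    using assms by (auto intro!: subspace_sum subspace_scale)
  have "Q (\<Sum>i\<in>A. u i *c f i) (g j) = (\<Sum>i\<in>A. cnj (u i) * Q (f i) (g j))" if "j \<in> B" for j
  proof -
    have "Q (\<Sum>i\<in>A. u i *c f i) (g j) = cnj (Q (g j) (\<Sum>i\<in>A. u i *c f i))"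
      using assms that A by (intro hermitian_on_cnj) auto
    also have "Q (g j) (\<Sum>i\<in>A. u i *c f i) = (\<Sum>i\<in>A. u i * Q (g j) (f i))"
      using assms that by (intro functional_on_sum[where V = V] hermitian_on_functional) auto
    also have "cnj \<dots> = (\<Sum>i\<in>A. cnj (u i) * Q (f i) (g j))"
      unfolding cnj_sum complex_cnj_mult
    proof (intro sum.cong refl)
      fix i assume "i \<in> A"
      then have "Q (f i) (g j) = cnj (Q (g j) (f i))"
        using assms(4,6) that by (intro hermitian_on_cnj[OF assms(1)]) auto
      then show "cnj (u i) * cnj (Q (g j) (f i)) = cnj (u i) * Q (f i) (g j)" by simp
    qed
    finally show ?thesis .
  qed
  moreover have "Q (\<Sum>i\<in>A. u i *c f i) (\<Sum>j\<in>B. w j *c g j) = (\<Sum>j\<in>B. w j * Q (\<Sum>i\<in>A. u i *c f i) (g j))"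
    using A assms by (intro functional_on_sum[where V = V] hermitian_on_functional) auto
  ultimately have "Q (\<Sum>i\<in>A. u i *c f i) (\<Sum>j\<in>B. w j *c g j) = (\<Sum>j\<in>B. \<Sum>i\<in>A. cnj (u i) * w j * Q (f i) (g j))"
    by (simp add: sum_distrib_left mult_ac)
  then show ?thesis by (subst sum.swap)
qed

lemma span_finite_coordinates:
  assumes "finite B" "x \<in> span B"
  obtains u where "x = (\<Sum>b\<in>B. u b *c b)"
  using assms span_finite by auto

text \<open>
  Sylvester's law of inertia: a vector \<open>x\<close> with \<open>Q x x \<noteq> 0\<close> splits off its \<open>Q\<close>-orthogonal
  complement, on which induction applies; when there is no such vector, \<open>Q\<close> vanishes by polarisation.
\<close>

lemma sylvester_basis_exists:
  assumes "fin_dim V" "hermitian_on V Q"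
  shows "\<exists>B. sylvester_basis V Q B"
  using assms
proof (induction "dim V" arbitrary: V rule: less_induct)
  case less
  note sub = fin_dim_subspace[OF less.prems(1)]
  show ?case
  proof (cases "\<exists>x\<in>V. Q x x \<noteq> 0")
    case False
    have zero: "Q x y = 0" if xy: "x \<in> V" "y \<in> V" for x y
    proof -
      have iy: "\<i> *c y \<in> V" using sub xy by (simp add: subspace_scale)
      (* polarisation: x + y gives the real part of Q x y and x + i y its imaginary part *)
      have "Q (x + y) (x + y) = 0" "Q (x + \<i> *c y) (x + \<i> *c y) = 0" "Q x x = 0" "Q y y = 0"
        using False xy iy sub subspace_add by blast+
      then have "Q x y + Q y x = 0" "\<i> * Q x y - \<i> * Q y x = 0"
        using xy iy sub less.prems(2)
        by (simp_all add: hermitian_on_add_left[where V=V] hermitian_on_add_right[where V=V] subspace_add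
          hermitian_on_scale_left[where V=V] hermitian_on_scale_right[where V=V])
      then show ?thesis by (simp add: complex_eq_iff)
    qed
    obtain B where B: "finite B" "independent B" "span B = V"
      using fin_dim_basis[OF less.prems(1)] .
    then have "sylvester_basis V Q B"
      using zero span_superset[of B] by (auto simp: sylvester_basis_def subset_iff)
    then show ?thesis ..
  next
    case True
    then obtain x0 where x0: "x0 \<in> V" "Q x0 x0 \<noteq> 0" by auto
    define r where "r = Re (Q x0 x0)"
    have r: "Q x0 x0 = of_real r" "r \<noteq> 0"
      using x0 hermitian_on_real[OF less.prems(2)] by (auto simp: r_def complex_eq_iff)
    define x where "x = complex_of_real (1 / sqrt \<bar>r\<bar>) *c x0"
    have x: "x \<in> V" using x0 sub by (simp add: x_def subspace_scale)
    have "Q x x = cnj (complex_of_real (1 / sqrt \<bar>r\<bar>)) * (complex_of_real (1 / sqrt \<bar>r\<bar>) * of_real r)"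
      unfolding x_def hermitian_on_scale_left[OF less.prems(2) sub x0(1) subspace_scale[OF sub x0(1)]]
        hermitian_on_scale_right[OF less.prems(2) x0(1) x0(1)] r ..
    also have "\<dots> = of_real (r / (sqrt \<bar>r\<bar>)\<^sup>2)"
      unfolding complex_cnj_complex_of_real of_real_mult[symmetric] by (simp add: power2_eq_square)
    also have "r / (sqrt \<bar>r\<bar>)\<^sup>2 = sgn r" using r by (simp add: sgn_real_def)
    finally have Qx: "Q x x = of_real (sgn r)" .
    have Qx': "Q x x * Q x x = 1" "Q x x \<noteq> 0" "Q x x \<in> {-1, 0, 1}"
      using r by (auto simp: Qx sgn_real_def)
    define V' where "V' = {y \<in> V. Q x y = 0}"
    have "subspace V'"
      using sub less.prems(2) x hermitian_on_scale_right[OF less.prems(2) x, of 0 0]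
      by (auto simp: V'_def subspace_def hermitian_on_add_right[where V=V] hermitian_on_scale_right[where V=V])
    then have fd: "fin_dim V'"
      using fin_dim_subset[OF less.prems(1)] by (auto simp: V'_def)
    obtain B where B: "finite B" "independent B" "span B = V'" "card B = dim V'"
      using fin_dim_basis[OF fd] .
    have "x \<notin> span B" using B Qx' by (auto simp: V'_def)
    then have "independent (insert x B)" using B independent_insertI by blast
    moreover have "insert x B \<subseteq> V" using x B span_superset[of B] by (auto simp: V'_def)
    ultimately have "card (insert x B) \<le> dim V" using fin_dim_independent[OF less.prems(1)] by blast
    moreover have "x \<notin> B" using \<open>x \<notin> span B\<close> span_base by blast
    ultimately have "dim V' < dim V" using B by simp
    moreover have "hermitian_on V' Q"
      using less.prems(2) by (rule hermitian_on_subset) (auto simp: V'_def)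
    ultimately obtain C where C: "sylvester_basis V' Q C"
      using less.hyps fd by blast
    then have C': "finite C" "independent C" "span C = V'" "\<forall>x\<in>C. \<forall>y\<in>C. x \<noteq> y \<longrightarrow> Q x y = 0"
      "\<forall>x\<in>C. Q x x \<in> {-1, 0, 1}" by (auto simp: sylvester_basis_def)
    have CV: "C \<subseteq> V'" using C' span_superset by blast
    have "x \<notin> span C" using C' Qx' by (auto simp: V'_def)
    then have ind: "independent (insert x C)" using C' independent_insertI by blast
    have "span (insert x C) = V"
    proof
      show "span (insert x C) \<subseteq> V"
        using CV x sub by (intro span_minimal) (auto simp: V'_def)
      show "V \<subseteq> span (insert x C)"
      proof
        fix y assume y: "y \<in> V"
        let ?z = "y + (- (Q x y * Q x x)) *c x"
        have "?z \<in> V" using y x sub by (intro subspace_add subspace_scale)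
        moreover have "Q x ?z = Q x y - Q x y * (Q x x * Q x x)"
          using y x sub less.prems(2) subspace_scale[OF sub x]
          by (simp only: hermitian_on_add_right[where V=V] hermitian_on_scale_right[where V=V]) simp
        ultimately have "?z \<in> span C" using C' Qx' by (simp add: V'_def)
        then have "y - (Q x y * Q x x) *c x \<in> span C" by (simp add: scale_minus_left)
        then show "y \<in> span (insert x C)" using span_breakdown_eq by blast
      qed
    qed
    moreover have "Q x y = 0" "Q y x = 0" if "y \<in> C" for y
    proof -
      show "Q x y = 0" using that CV by (auto simp: V'_def)
      then show "Q y x = 0" using hermitian_on_cnj[OF less.prems(2) x, of y] that CV by (auto simp: V'_def)
    qed
    ultimately have "sylvester_basis V Q (insert x C)"
      using C' ind Qx' by (auto simp: sylvester_basis_def)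
    then show ?thesis ..
  qed
qed

lemma sylvester_basis_form:
  assumes "sylvester_basis V Q B" "hermitian_on V Q" "C \<subseteq> B" "x = (\<Sum>b\<in>C. u b *c b)"
  shows "Re (Q x x) = (\<Sum>b\<in>C. (cmod (u b))\<^sup>2 * Re (Q b b))"
    and "b \<in> C \<Longrightarrow> Q b x = u b * Q b b"
    and "b \<in> B - C \<Longrightarrow> Q b x = 0"
proof -
  have B: "finite B" "independent B" "span B = V" "\<And>x y. x\<in>B \<Longrightarrow> y\<in>B \<Longrightarrow> x \<noteq> y \<Longrightarrow> Q x y = 0"
    using assms(1) by (auto simp: sylvester_basis_def)
  have sub: "subspace V" and BV: "B \<subseteq> V" using B(3) subspace_span span_superset by blast+
  have fin: "finite C" using B(1) assms(3) finite_subset by auto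
  have Qb: "Q b x = (\<Sum>c\<in>C. u c * Q b c)" if "b \<in> B" for b
    unfolding assms(4) using that BV assms sub fin
    by (intro functional_on_sum[where V=V] hermitian_on_functional) auto
  show *: "Q b x = u b * Q b b" if "b \<in> C" for b
  proof -
    have "Q b x = (\<Sum>c\<in>C. u c * Q b c)" using Qb that assms by auto
    also have "\<dots> = (\<Sum>c\<in>C. if c = b then u b * Q b b else 0)"
      using B(4) that assms(3) by (intro sum.cong) auto
    finally show ?thesis using fin that by simp
  qed
  show "Q b x = 0" if "b \<in> B - C"
  proof -
    have "Q b x = (\<Sum>c\<in>C. u c * Q b c)" using Qb that assms by auto
    also have "\<dots> = 0" using B(4) that assms(3) by (intro sum.neutral) auto
    finally show ?thesis .
  qed
  have "Q x x = (\<Sum>b\<in>C. \<Sum>c\<in>C. cnj (u b) * u c * Q b c)"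
    unfolding assms(4) using BV assms fin sub by (intro hermitian_on_sum[where V=V]) auto
  also have "\<dots> = (\<Sum>b\<in>C. \<Sum>c\<in>C. if c = b then cnj (u b) * u b * Q b b else 0)"
    using B(4) assms(3) by (intro sum.cong) auto
  also have "\<dots> = (\<Sum>b\<in>C. of_real ((cmod (u b))\<^sup>2) * Q b b)"
    using fin by (simp add: complex_norm_square mult_ac del: of_real_power)
  finally show "Re (Q x x) = (\<Sum>b\<in>C. (cmod (u b))\<^sup>2 * Re (Q b b))" by simp
qed

definition signature :: "('v \<Rightarrow> 'v \<Rightarrow> complex) \<Rightarrow> 'v set \<Rightarrow> complex \<Rightarrow> 'v set" where
  "signature Q B s = {b \<in> B. Q b b = s}"

text \<open>
  A negative subspace meets a nonnegative one trivially, so its dimension is at most the number of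
  functionals that cut out the latter.  All upper bounds on an index come from this.
\<close>

lemma negative_family_le_functionals:
  assumes "fin_dim V" "negative_family V Q N" "finite J" "\<And>j. j \<in> J \<Longrightarrow> functional_on V (\<phi> j)"
    "\<And>x. x \<in> V \<Longrightarrow> x \<noteq> 0 \<Longrightarrow> (\<And>j. j \<in> J \<Longrightarrow> \<phi> j x = 0) \<Longrightarrow> Re (Q x x) \<ge> 0"
  shows "card N \<le> card J"
proof (rule ccontr)
  assume "\<not> card N \<le> card J"
  have N: "finite N" "N \<subseteq> V" "independent N" "\<And>x. x \<in> span N \<Longrightarrow> x \<noteq> 0 \<Longrightarrow> Re (Q x x) < 0"
    using assms(2) by (auto simp: negative_family_def)
  have NV: "span N \<subseteq> V" using N(2) fin_dim_subspace[OF assms(1)] by (simp add: span_minimal)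
  have "dim (span N) = card N" using N(3) by (rule dim_span_eq_card_independent)
  then have "card J < dim (span N)" using \<open>\<not> card N \<le> card J\<close> by simp
  then obtain x where x: "x \<in> span N" "x \<noteq> 0" "\<forall>j\<in>J. \<phi> j x = 0"
    using functionals_common_zero[OF assms(3) fin_dim_span[OF N(1)], of \<phi>]
      functional_on_subset[OF assms(4) NV] by blast
  have "0 \<le> Re (Q x x)" using x NV by (intro assms(5)) auto
  with N(4)[OF x(1,2)] show False by simp
qed

lemma
  assumes "sylvester_basis V Q B" "hermitian_on V Q"
  shows index_eq_card: "index V Q = card (signature Q B (-1))"
    and index_attained: "negative_family V Q (signature Q B (-1))"
    and radical_eq_span: "radical V Q = span (signature Q B 0)"
    and nullity_eq_card: "nullity V Q = card (signature Q B 0)"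
proof -
  have B: "finite B" "independent B" "span B = V" "\<And>x y. x\<in>B \<Longrightarrow> y\<in>B \<Longrightarrow> x \<noteq> y \<Longrightarrow> Q x y = 0"
    "\<And>x. x \<in> B \<Longrightarrow> Q x x \<in> {-1, 0, 1}"
    using assms(1) by (auto simp: sylvester_basis_def)
  have sub: "subspace V" and BV: "B \<subseteq> V" using B(3) subspace_span span_superset by blast+
  have fd: "fin_dim V" using B fin_dim_span by blast
  let ?N = "signature Q B (-1)" and ?Z = "signature Q B 0"
  have NB: "?N \<subseteq> B" "?Z \<subseteq> B" "finite ?N" "finite ?Z" using B(1) by (auto simp: signature_def)
  show neg: "negative_family V Q ?N"
    unfolding negative_family_def
  proof (intro conjI ballI impI)
    show "independent ?N" by (rule independent_mono[OF B(2) NB(1)])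
    fix x assume x: "x \<in> span ?N" "x \<noteq> 0"
    obtain u where u: "x = (\<Sum>b\<in>?N. u b *c b)" using span_finite_coordinates[OF NB(3) x(1)] .
    have "\<exists>b\<in>?N. u b \<noteq> 0"
    proof (rule ccontr)
      assume "\<not> ?thesis"
      then have "x = 0" unfolding u by (intro sum.neutral) auto
      then show False using x(2) by simp
    qed
    then obtain b where b: "b \<in> ?N" "u b \<noteq> 0" by blast
    have "0 < (\<Sum>b\<in>?N. (cmod (u b))\<^sup>2)"
      by (rule sum_pos2[OF NB(3) b(1)]) (use b in auto)
    moreover have "Re (Q x x) = - (\<Sum>b\<in>?N. (cmod (u b))\<^sup>2)"
      using sylvester_basis_form(1)[OF assms NB(1) u] by (simp add: signature_def sum_negf)
    ultimately show "Re (Q x x) < 0" by simp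
  qed (use NB BV in auto)
  have le: "card N \<le> card ?N" if "negative_family V Q N" for N
  proof (rule negative_family_le_functionals[OF fd that NB(3), of Q])
    show "functional_on V (Q j)" if "j \<in> ?N" for j
      using that NB BV assms(2) hermitian_on_functional by blast
    fix x assume x: "x \<in> V" "\<And>j. j \<in> ?N \<Longrightarrow> Q j x = 0"
    obtain u where u: "x = (\<Sum>b\<in>B. u b *c b)" using span_finite_coordinates[OF B(1), of x] x(1) B(3) by blast
    have "u b = 0" if "b \<in> ?N" for b
      using sylvester_basis_form(2)[OF assms subset_refl u, of b] x(2)[OF that] that by (simp add: signature_def)
    then have "0 \<le> (cmod (u b))\<^sup>2 * Re (Q b b)" if "b \<in> B" for b
      using B(5)[OF that] that by (cases "Q b b = -1") (auto simp: signature_def)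
    then show "Re (Q x x) \<ge> 0" using sylvester_basis_form(1)[OF assms subset_refl u] by (simp add: sum_nonneg)
  qed
  show "index V Q = card ?N" unfolding index_def
  proof (rule Max_eqI)
    have "card ` {B. negative_family V Q B} \<subseteq> {..card ?N}" using le by auto
    then show "finite (card ` {B. negative_family V Q B})" using finite_subset by blast
  qed (use le neg in auto)
  show rad: "radical V Q = span ?Z"
  proof
    show "radical V Q \<subseteq> span ?Z"
    proof
      fix x assume x: "x \<in> radical V Q"
      then obtain u where u: "x = (\<Sum>b\<in>B. u b *c b)" 
        using span_finite_coordinates[OF B(1), of x] B(3) by (auto simp: radical_def)
      have "u b *c b \<in> span ?Z" if "b \<in> B" for b
      proof (cases "b \<in> ?Z")
        case False
        then have "u b = 0"
          using sylvester_basis_form(2)[OF assms subset_refl u that] x that BV by (auto simp: radical_def signature_def)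
        then show ?thesis by (simp add: span_zero)
      qed (simp add: span_base span_scale)
      then show "x \<in> span ?Z" unfolding u by (rule span_sum)
    qed
    show "span ?Z \<subseteq> radical V Q"
    proof
      fix x assume "x \<in> span ?Z"
      then obtain u where u: "x = (\<Sum>b\<in>?Z. u b *c b)" using span_finite_coordinates[OF NB(4)] by auto
      have x: "x \<in> V" using \<open>x \<in> span ?Z\<close> NB(2) B(3) span_mono by blast
      have "Q b x = 0" if "b \<in> B" for b
        using sylvester_basis_form(2,3)[OF assms NB(2) u, of b] that by (cases "b \<in> ?Z") (auto simp: signature_def)
      moreover have "functional_on V (Q x)" using x assms(2) hermitian_on_functional by blast
      ultimately have "Q x b = 0" if "b \<in> B" for b using hermitian_on_cnj[OF assms(2), of b x] x that BV by auto
      then have "Q x y = 0" if y: "y \<in> V" for y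
      proof -
        obtain w where w: "y = (\<Sum>b\<in>B. w b *c b)" using span_finite_coordinates[OF B(1), of y] y B(3) by blast
        show ?thesis unfolding w 
          using \<open>\<And>b. b \<in> B \<Longrightarrow> Q x b = 0\<close> BV functional_on_sum[OF \<open>functional_on V (Q x)\<close> sub B(1), of "\<lambda>x. x" w]
          by (auto intro!: sum.neutral)
      qed
      then have "Q y x = 0" if "y \<in> V" for y using hermitian_on_cnj[OF assms(2) x that] that by simp
      then show "x \<in> radical V Q" using x by (simp add: radical_def)
    qed
  qed
  show "nullity V Q = card ?Z"
    unfolding nullity_def rad by (rule dim_span_eq_card_independent[OF independent_mono[OF B(2) NB(2)]])
qed

lemma index_ge:
  assumes "fin_dim V" "hermitian_on V Q" "negative_family V Q N"
  shows "card N \<le> index V Q"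
proof -
  obtain B where B: "sylvester_basis V Q B" using sylvester_basis_exists assms by blast
  have "card ` {B. negative_family V Q B} \<subseteq> {..dim V}"
    using fin_dim_independent[OF assms(1)] by (auto simp: negative_family_def)
  then have "finite (card ` {B. negative_family V Q B})" using finite_subset by blast
  then show ?thesis unfolding index_def using assms(3) by (intro Max_ge) auto
qed

lemma index_negative_family:
  assumes "fin_dim V" "hermitian_on V Q"
  obtains N where "negative_family V Q N" "card N = index V Q"
proof -
  obtain B where B: "sylvester_basis V Q B" using sylvester_basis_exists[OF assms] ..
  show ?thesis by (rule that[OF index_attained[OF B assms(2)]]) (simp add: index_eq_card[OF B assms(2)])
qed

lemma index_le_functionals:
  assumes "fin_dim V" "hermitian_on V Q" "finite J" "\<And>j. j \<in> J \<Longrightarrow> functional_on V (\<phi> j)"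
    "\<And>x. x \<in> V \<Longrightarrow> x \<noteq> 0 \<Longrightarrow> (\<And>j. j \<in> J \<Longrightarrow> \<phi> j x = 0) \<Longrightarrow> Re (Q x x) \<ge> 0"
  shows "index V Q \<le> card J"
proof -
  obtain N where N: "negative_family V Q N" "card N = index V Q"
    using index_negative_family[OF assms(1,2)] .
  have "card N \<le> card J"
    by (rule negative_family_le_functionals[OF assms(1) N(1) assms(3), of \<phi>]) (fact assms(4,5))+
  with N(2) show ?thesis by simp
qed

text \<open>
  The negative and the null vectors of a Sylvester basis span a subspace on which \<open>Q\<close> is
  nonpositive, and on it \<open>Q x x = 0\<close> already forces \<open>x\<close> into the radical.
\<close>

lemma nonpositive_family_exists:
  assumes "fin_dim V" "hermitian_on V Q"
  obtains N where "finite N" "N \<subseteq> V" "independent N" "card N = index V Q + nullity V Q"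
    "\<And>x. x \<in> span N \<Longrightarrow> Re (Q x x) \<le> 0"
    "\<And>x. x \<in> span N \<Longrightarrow> Re (Q x x) = 0 \<Longrightarrow> x \<in> radical V Q"
proof -
  obtain B where B: "sylvester_basis V Q B" using sylvester_basis_exists assms by blast
  let ?N = "signature Q B (-1) \<union> signature Q B 0"
  have NB: "?N \<subseteq> B" by (auto simp: signature_def)
  have fin: "finite B" "independent B" "B \<subseteq> V" using B span_superset by (auto simp: sylvester_basis_def)
  then have finN: "finite ?N" using NB finite_subset by blast
  have form: "Re (Q x x) = - (\<Sum>b\<in>signature Q B (-1). (cmod (u b))\<^sup>2)" if "x = (\<Sum>b\<in>?N. u b *c b)" for x u
  proof -
    have "Re (Q x x) = (\<Sum>b\<in>?N. (cmod (u b))\<^sup>2 * Re (Q b b))"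
      by (rule sylvester_basis_form(1)[OF B assms(2) NB that])
    also have "\<dots> = (\<Sum>b\<in>signature Q B (-1). (cmod (u b))\<^sup>2 * Re (Q b b)) + (\<Sum>b\<in>signature Q B 0. (cmod (u b))\<^sup>2 * Re (Q b b))"
      using finN by (intro sum.union_disjoint) (auto simp: signature_def)
    finally show ?thesis by (simp add: signature_def sum_negf)
  qed
  show ?thesis
  proof
    show "finite ?N" "?N \<subseteq> V" "independent ?N" using finN NB fin independent_mono by auto
    show "card ?N = index V Q + nullity V Q"
      using finN by (simp add: index_eq_card[OF B assms(2)] nullity_eq_card[OF B assms(2)] card_Un_disjoint signature_def disjoint_iff)
    fix x assume "x \<in> span ?N"
    then obtain u where u: "x = (\<Sum>b\<in>?N. u b *c b)" using span_finite_coordinates[OF finN] by blast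
    show "Re (Q x x) \<le> 0" using form[OF u] by (simp add: sum_nonneg)
    assume "Re (Q x x) = 0"
    then have "(\<Sum>b\<in>signature Q B (-1). (cmod (u b))\<^sup>2) = 0" using form[OF u] by simp
    then have "\<And>b. b \<in> signature Q B (-1) \<Longrightarrow> u b = 0"
      using finN by (subst (asm) sum_nonneg_eq_0_iff) auto
    then have "u b *c b \<in> span (signature Q B 0)" if "b \<in> ?N" for b
      using that by (cases "b \<in> signature Q B (-1)") (auto simp: span_zero span_base span_scale)
    then have "x \<in> span (signature Q B 0)" unfolding u by (rule span_sum)
    then show "x \<in> radical V Q" using radical_eq_span[OF B assms(2)] by simp
  qed
qed

lemma index_nullity_le_functionals:
  assumes "fin_dim V" "hermitian_on V Q" "finite J" "\<And>j. j \<in> J \<Longrightarrow> functional_on V (\<phi> j)"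
    "\<And>x. x \<in> V \<Longrightarrow> x \<noteq> 0 \<Longrightarrow> (\<And>j. j \<in> J \<Longrightarrow> \<phi> j x = 0) \<Longrightarrow> Re (Q x x) > 0"
  shows "index V Q + nullity V Q \<le> card J"
proof (rule ccontr)
  assume c: "\<not> ?thesis"
  obtain N where N: "finite N" "N \<subseteq> V" "independent N" "card N = index V Q + nullity V Q"
    "\<And>x. x \<in> span N \<Longrightarrow> Re (Q x x) \<le> 0" using nonpositive_family_exists[OF assms(1,2)] by metis
  have NV: "span N \<subseteq> V" using N(2) fin_dim_subspace[OF assms(1)] by (simp add: span_minimal)
  have "dim (span N) = card N" using N(3) by (rule dim_span_eq_card_independent)
  then have "card J < dim (span N)" using c N(4) by simp
  then obtain x where x: "x \<in> span N" "x \<noteq> 0" "\<forall>j\<in>J. \<phi> j x = 0"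
    using functionals_common_zero[OF assms(3) fin_dim_span[OF N(1)], of \<phi>]
      functional_on_subset[OF assms(4) NV] by blast
  have "0 < Re (Q x x)" using x NV by (intro assms(5)) auto
  with N(5)[OF x(1)] show False by simp
qed

lemma index_mono:
  assumes "fin_dim V" "hermitian_on V Q" "hermitian_on V R" "\<And>x. x \<in> V \<Longrightarrow> Re (R x x) \<le> Re (Q x x)"
  shows "index V Q \<le> index V R"
proof -
  obtain N where N: "negative_family V Q N" "card N = index V Q" using index_negative_family[OF assms(1,2)] .
  then have "span N \<subseteq> V" using fin_dim_subspace[OF assms(1)] by (simp add: span_minimal negative_family_def)
  then have "negative_family V R N" using N assms(4) unfolding negative_family_def by (meson le_less_trans subsetD)
  then show ?thesis using index_ge[OF assms(1,3)] N by metis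
qed

text \<open>
  A form that is strictly smaller on the radical of \<open>Q\<close> turns the null directions of \<open>Q\<close> into negative
  ones.  The limit forms of the slow eigenvalues decrease with their parameter only in some directions,
  but these include the radical.
\<close>

lemma index_strict_mono:
  assumes "fin_dim V" "hermitian_on V Q" "hermitian_on V R" "\<And>x. x \<in> V \<Longrightarrow> Re (R x x) \<le> Re (Q x x)"
    "\<And>x. x \<in> radical V Q \<Longrightarrow> x \<noteq> 0 \<Longrightarrow> Re (R x x) < Re (Q x x)"
  shows "index V Q + nullity V Q \<le> index V R"
proof -
  obtain N where N: "finite N" "N \<subseteq> V" "independent N" "card N = index V Q + nullity V Q"
    "\<And>x. x \<in> span N \<Longrightarrow> Re (Q x x) \<le> 0" "\<And>x. x \<in> span N \<Longrightarrow> Re (Q x x) = 0 \<Longrightarrow> x \<in> radical V Q" 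
    using nonpositive_family_exists[OF assms(1,2)] by metis
  have NV: "span N \<subseteq> V" using N(2) fin_dim_subspace[OF assms(1)] by (simp add: span_minimal)
  have "negative_family V R N" unfolding negative_family_def
  proof (intro conjI ballI impI)
    fix x assume x: "x \<in> span N" "x \<noteq> 0"
    then show "Re (R x x) < 0"
      using N(5)[of x] N(6)[of x] assms(4)[of x] assms(5)[of x] NV by (cases "Re (Q x x) = 0") force+
  qed (use N in auto)
  then show ?thesis using index_ge[OF assms(1,3)] N by metis
qed

end

locale complex_space_pair = src: complex_space s1 + tgt: complex_space s2
  for s1 :: "complex \<Rightarrow> 'a::ab_group_add \<Rightarrow> 'a" and s2 :: "complex \<Rightarrow> 'b::ab_group_add \<Rightarrow> 'b"
begin

sublocale vector_space_pair s1 s2 ..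

lemma independent_inj_image:
  assumes "Vector_Spaces.linear s1 s2 T" "src.subspace V" "inj_on T V" "B \<subseteq> V" "src.independent B"
  shows "tgt.independent (T ` B)" "card (T ` B) = card B"
proof -
  have "src.span B \<subseteq> V" using assms by (simp add: src.span_minimal)
  then show "tgt.independent (T ` B)"
    by (intro linear_independent_injective_image assms inj_on_subset[OF assms(3)])
  show "card (T ` B) = card B" using assms(3,4) by (intro card_image) (rule inj_on_subset)
qed

lemma dim_inj_image:
  assumes "Vector_Spaces.linear s1 s2 T" "src.subspace V" "inj_on T V"
  shows "tgt.dim (T ` V) = src.dim V"
proof -
  obtain B where B: "B \<subseteq> V" "src.independent B" "V \<subseteq> src.span B" "card B = src.dim V"
    using src.basis_exists by blast
  have "T ` V \<subseteq> tgt.span (T ` B)"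
    unfolding linear_span_image[OF assms(1)] using B(3) by (rule image_mono)
  then show ?thesis
    using tgt.basis_card_eq_dim[OF image_mono[OF B(1), of T]] independent_inj_image[OF assms B(1,2)] B(4) by simp
qed

lemma index_le_image:
  assumes T: "Vector_Spaces.linear s1 s2 T" and V: "src.fin_dim V" "inj_on T V" "T ` V \<subseteq> V'" 
    and Q: "src.hermitian_on V Q" and Q': "tgt.fin_dim V'" "tgt.hermitian_on V' Q'"
    and le: "\<And>x. x \<in> V \<Longrightarrow> Re (Q' (T x) (T x)) \<le> Re (Q x x)"
  shows "src.index V Q \<le> tgt.index V' Q'"
proof -
  obtain N where N: "src.negative_family V Q N" "card N = src.index V Q"
    using src.index_negative_family[OF V(1) Q] .
  then have N': "finite N" "N \<subseteq> V" "src.independent N" "\<And>x. x \<in> src.span N \<Longrightarrow> x \<noteq> 0 \<Longrightarrow> Re (Q x x) < 0"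
    by (auto simp: src.negative_family_def)
  note sub = src.fin_dim_subspace[OF V(1)]
  note im = independent_inj_image[OF T sub V(2) N'(2,3)]
  have "tgt.negative_family V' Q' (T ` N)" unfolding tgt.negative_family_def
  proof (intro conjI ballI impI)
    fix y assume "y \<in> tgt.span (T ` N)" "y \<noteq> 0"
    then obtain x where x: "x \<in> src.span N" "y = T x"
      unfolding linear_span_image[OF T] by auto
    have "x \<noteq> 0" using x(2) \<open>y \<noteq> 0\<close> linear_0[OF T] by auto
    moreover have "x \<in> V" using x(1) src.span_minimal[OF N'(2) sub] by auto
    ultimately show "Re (Q' y y) < 0" using N'(4)[OF x(1)] le[of x] x(2) by auto
  qed (use N' im V(3) in auto)
  then have "card (T ` N) \<le> tgt.index V' Q'"
    by (rule tgt.index_ge[OF Q'])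
  then show ?thesis using im(2) N(2) by simp
qed

end

context complex_space
begin

text \<open>
  Expand in a basis that is orthonormal for \<open>m\<close>; the constant is the size of the matrix of \<open>q\<close> in it.
\<close>

lemma form_dominated:
  assumes W: "fin_dim W" and q: "hermitian_on W q" and m: "hermitian_on W m"
    and pos: "\<And>x. x \<in> W \<Longrightarrow> x \<noteq> 0 \<Longrightarrow> Re (m x x) > 0"
  obtains K where "K \<ge> 0" "\<And>x. x \<in> W \<Longrightarrow> \<bar>Re (q x x)\<bar> \<le> K * Re (m x x)"
proof -
  obtain B where B: "sylvester_basis W m B" using sylvester_basis_exists[OF W m] ..
  have B': "finite B" "independent B" "span B = W" "\<And>b. b \<in> B \<Longrightarrow> m b b \<in> {-1, 0, 1}"
    using B by (auto simp: sylvester_basis_def)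
  have BW: "B \<subseteq> W" using B'(3) span_superset by blast
  have one: "m b b = 1" if b: "b \<in> B" for b
  proof -
    have "b \<noteq> 0" using b B'(2) dependent_zero by auto
    then have "Re (m b b) > 0" using b BW by (intro pos) auto
    then show ?thesis using B'(4)[OF b] by auto
  qed
  define \<eta> where "\<eta> = (\<Sum>b\<in>B. \<Sum>c\<in>B. cmod (q b c))"
  have \<eta>0: "\<eta> \<ge> 0" unfolding \<eta>_def by (intro sum_nonneg) auto
  have \<eta>: "cmod (q b c) \<le> \<eta>" if bc: "b \<in> B" "c \<in> B" for b c
  proof -
    have "cmod (q b c) \<le> (\<Sum>c\<in>B. cmod (q b c))" using bc B'(1) by (intro member_le_sum) auto
    also have "\<dots> \<le> \<eta>" unfolding \<eta>_def using bc B'(1)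
      by (intro member_le_sum[where f = "\<lambda>b. \<Sum>c\<in>B. cmod (q b c)"] sum_nonneg) auto
    finally show ?thesis .
  qed
  show ?thesis
  proof (rule that)
    show "\<eta> * card B \<ge> 0" using \<eta>0 by simp
    fix x assume x: "x \<in> W"
    obtain u where u: "x = (\<Sum>b\<in>B. u b *c b)"
      using span_finite_coordinates[OF B'(1), of x] x B'(3) by blast
    have "Re (m x x) = (\<Sum>b\<in>B. (cmod (u b))\<^sup>2)"
      using sylvester_basis_form(1)[OF B m subset_refl u] one by simp
    moreover have "q x x = (\<Sum>b\<in>B. \<Sum>c\<in>B. cnj (u b) * u c * q b c)"
      unfolding u by (rule hermitian_on_sum[OF q fin_dim_subspace[OF W] B'(1) _ B'(1)]) (use BW in auto)
    ultimately have "cmod (q x x) \<le> \<eta> * card B * Re (m x x)"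
      using bounded_perturbation[OF B'(1) \<eta>] by simp
    then show "\<bar>Re (q x x)\<bar> \<le> \<eta> * card B * Re (m x x)" using abs_Re_le_cmod order_trans by blast
  qed
qed

lemma eventually_definite_on_orthonormal:
  fixes s :: real
  assumes Q: "\<forall>\<^sub>F t in F. hermitian_on V (Q t)" and V: "subspace V" and B: "finite B" "B \<subseteq> V"
    and lim: "\<And>b c. b \<in> B \<Longrightarrow> c \<in> B \<Longrightarrow> ((\<lambda>t. Q t b c) \<longlongrightarrow> (if b = c then of_real s else 0)) F"
    and s: "\<bar>s\<bar> = 1"
  shows "\<forall>\<^sub>F t in F. \<forall>x\<in>span B. x \<noteq> 0 \<longrightarrow> s * Re (Q t x x) > 0"
proof -
  (* the quadratic form of a matrix with entries below eta is at most eta * card B < 1 times the sum of squares *)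
  define \<eta> where "\<eta> = 1 / (2 * (card B + 1))"
  have "\<eta> > 0" by (simp add: \<eta>_def)
  have "\<forall>\<^sub>F t in F. \<forall>b\<in>B. \<forall>c\<in>B. dist (Q t b c) (if b = c then of_real s else 0) < \<eta>"
    by (intro eventually_ball_finite ballI B(1) tendstoD[OF lim \<open>\<eta> > 0\<close>])
  then show ?thesis using Q
  proof eventually_elim
    case (elim t)
    show ?case
    proof (intro ballI impI)
      fix x assume x: "x \<in> span B" "x \<noteq> 0"
      obtain u where u: "x = (\<Sum>b\<in>B. u b *c b)" using span_finite_coordinates[OF B(1) x(1)] .
      define S where "S = (\<Sum>b\<in>B. (cmod (u b))\<^sup>2)"
      have "\<exists>b\<in>B. u b \<noteq> 0"
      proof (rule ccontr)
        assume "\<not> ?thesis"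
        then have "x = 0" unfolding u by (intro sum.neutral) auto
        then show False using x(2) by simp
      qed
      then obtain b where b: "b \<in> B" "u b \<noteq> 0" by blast
      have "S > 0" unfolding S_def
        by (rule sum_pos2[OF B(1) b(1)]) (use b in auto)
      define E where "E b c = Q t b c - (if b = c then of_real s else 0)" for b c
      have "Q t x x = (\<Sum>b\<in>B. \<Sum>c\<in>B. cnj (u b) * u c * Q t b c)"
        unfolding u using elim(2) V B by (intro hermitian_on_sum[where V = V]) auto
      also have "\<dots> = (\<Sum>b\<in>B. \<Sum>c\<in>B. cnj (u b) * u c * E b c + (if c = b then cnj (u b) * u b * of_real s else 0))"
        by (intro sum.cong) (auto simp: E_def algebra_simps)
      also have "\<dots> = (\<Sum>b\<in>B. \<Sum>c\<in>B. cnj (u b) * u c * E b c) + (\<Sum>b\<in>B. cnj (u b) * u b * of_real s)"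
        using B(1) by (simp add: sum.distrib)
      also have "(\<Sum>b\<in>B. cnj (u b) * u b * of_real s) = of_real (s * S)"
        by (simp add: S_def sum_distrib_left complex_norm_square mult_ac del: of_real_power)
      finally have eq: "Q t x x = (\<Sum>b\<in>B. \<Sum>c\<in>B. cnj (u b) * u c * E b c) + of_real (s * S)" .
      have "cmod (\<Sum>b\<in>B. \<Sum>c\<in>B. cnj (u b) * u c * E b c) \<le> \<eta> * card B * S"
        unfolding S_def E_def
        by (intro bounded_perturbation B(1)) (use elim(1) in \<open>unfold dist_norm, blast intro: less_imp_le\<close>)
      also have "\<dots> < 1 * S"
        using \<open>S > 0\<close> by (intro mult_strict_right_mono) (simp_all add: \<eta>_def field_simps)
      finally have "\<bar>Re (\<Sum>b\<in>B. \<Sum>c\<in>B. cnj (u b) * u c * E b c)\<bar> < 1 * S"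
        using abs_Re_le_cmod le_less_trans by blast
      moreover have "s = 1 \<or> s = -1" using s by linarith
      ultimately show "s * Re (Q t x x) > 0" unfolding eq by auto
    qed
  qed
qed

lemma functional_on_representation:
  assumes "independent B"
  shows "functional_on (span B) (\<lambda>x. representation B x b)"
  using assms by (simp add: functional_on_def representation_add representation_scale)

text \<open>
  Near \<open>R\<close>, the form stays definite on the spans of the negative and of the positive vectors of a
  Sylvester basis of \<open>R\<close>.  Only the null vectors of \<open>R\<close> are undecided, whence the defect.
\<close>

lemma index_semicontinuous:
  assumes V: "fin_dim V" and Q: "\<forall>\<^sub>F t in F. hermitian_on V (Q t)" and R: "hermitian_on V R"
    and lim: "\<And>x y. x \<in> V \<Longrightarrow> y \<in> V \<Longrightarrow> ((\<lambda>t. Q t x y) \<longlongrightarrow> R x y) F"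
  shows "\<forall>\<^sub>F t in F. index V R \<le> index V (Q t) \<and> index V (Q t) \<le> index V R + nullity V R"
proof -
  obtain B where B: "sylvester_basis V R B" using sylvester_basis_exists[OF V R] ..
  have B': "finite B" "independent B" "span B = V" "\<And>x y. x\<in>B \<Longrightarrow> y\<in>B \<Longrightarrow> x \<noteq> y \<Longrightarrow> R x y = 0"
    "\<And>x. x \<in> B \<Longrightarrow> R x x \<in> {-1, 0, 1}"
    using B by (auto simp: sylvester_basis_def)
  note sub = fin_dim_subspace[OF V]
  have BV: "B \<subseteq> V" using B'(3) span_superset by blast
  define N Z P where "N = signature R B (-1)" and "Z = signature R B 0" and "P = signature R B 1"
  have sub': "N \<subseteq> B" "Z \<subseteq> B" "P \<subseteq> B" and fin: "finite N" "finite Z" "finite P"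
    using B'(1) by (auto simp: N_def Z_def P_def signature_def)
  have BNZP: "B = N \<union> Z \<union> P" and disj: "P \<inter> (N \<union> Z) = {}" "N \<inter> Z = {}"
    using B'(5) by (auto simp: N_def Z_def P_def signature_def)
  have lim': "((\<lambda>t. Q t b c) \<longlongrightarrow> (if b = c then of_real s else 0)) F"
    if "b \<in> signature R B (of_real s)" "c \<in> signature R B (of_real s)" for b c s
    using lim[of b c] that subsetD[OF BV] B'(4)[of b c] by (auto simp: signature_def)
  have ev1: "\<forall>\<^sub>F t in F. \<forall>x\<in>span N. x \<noteq> 0 \<longrightarrow> -1 * Re (Q t x x) > 0"
    using lim'[of _ "-1"] sub'(1) BV fin(1) unfolding N_def
    by (intro eventually_definite_on_orthonormal[OF Q sub]) simp_all
  have ev2: "\<forall>\<^sub>F t in F. \<forall>x\<in>span P. x \<noteq> 0 \<longrightarrow> 1 * Re (Q t x x) > 0"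
    using lim'[of _ "1"] sub'(3) BV fin(3) unfolding P_def
    by (intro eventually_definite_on_orthonormal[OF Q sub]) simp_all
  show ?thesis using ev1 ev2 Q
  proof eventually_elim
    case (elim t)
    have "negative_family V (Q t) N"
      using elim(1) fin(1) sub'(1) BV independent_mono[OF B'(2) sub'(1)] by (auto simp: negative_family_def)
    then have 1: "index V R \<le> index V (Q t)"
      using index_ge[OF V elim(3)] index_eq_card[OF B R] by (simp add: N_def)
    have "index V (Q t) \<le> card (N \<union> Z)"
    proof (rule index_le_functionals[OF V elim(3), of "N \<union> Z" "\<lambda>b x. representation B x b"])
      show "functional_on V (\<lambda>x. representation B x b)" if "b \<in> N \<union> Z" for b
        using functional_on_representation[OF B'(2)] B'(3) by simp
      fix x assume x: "x \<in> V" "x \<noteq> 0" "\<And>b. b \<in> N \<union> Z \<Longrightarrow> representation B x b = 0"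
      have "x = (\<Sum>b\<in>B. representation B x b *c b)"
        using sum_representation_eq[OF B'(2) _ B'(1) subset_refl] x(1) B'(3) by simp
      also have "\<dots> = (\<Sum>b\<in>P. representation B x b *c b)"
        using x(3) B'(1) sub'(3) BNZP by (intro sum.mono_neutral_right) auto
      finally have "x \<in> span P" by (metis (no_types, lifting) span_base span_scale span_sum)
      then show "Re (Q t x x) \<ge> 0" using elim(2) x(2) by auto
    qed (use fin in auto)
    also have "card (N \<union> Z) = index V R + nullity V R"
      using fin disj by (simp add: card_Un_disjoint index_eq_card[OF B R] nullity_eq_card[OF B R] N_def Z_def)
    finally show ?case using 1 by simp
  qed
qed

text \<open>
  The index is unchanged under an invertible change of variables, so it is enough that the matrix of
  \<open>Q t\<close> converges after the basis vectors are rescaled, by factors that may blow up.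
\<close>

lemma index_semicontinuous_weighted:
  fixes w :: "'t \<Rightarrow> 'v \<Rightarrow> real"
  assumes B: "finite B" "independent B" "span B = V" and w: "\<forall>\<^sub>F t in F. \<forall>b\<in>B. w t b \<noteq> 0"
    and Q: "\<forall>\<^sub>F t in F. hermitian_on V (Q t)" and R: "hermitian_on V R"
    and lim: "\<And>b c. b \<in> B \<Longrightarrow> c \<in> B \<Longrightarrow> ((\<lambda>t. of_real (w t b * w t c) * Q t b c) \<longlongrightarrow> R b c) F"
  shows "\<forall>\<^sub>F t in F. index V R \<le> index V (Q t) \<and> index V (Q t) \<le> index V R + nullity V R"
proof -
  interpret self: complex_space_pair scale scale ..
  have V: "fin_dim V" using B fin_dim_span by blast
  note sub = fin_dim_subspace[OF V]
  have BV: "B \<subseteq> V" using B(3) span_superset by blast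
  define T where "T v = self.construct B (\<lambda>b. complex_of_real (v b) *c b)" for v
  have lin: "Vector_Spaces.linear scale scale (T v)" for v
    unfolding T_def by (rule self.linear_construct[OF B(2)])
  have Tb: "T v b = complex_of_real (v b) *c b" if "b \<in> B" for v b
    unfolding T_def by (rule self.construct_basis[OF B(2) that])
  have Tsum: "T v (\<Sum>b\<in>B. u b *c b) = (\<Sum>b\<in>B. (u b * of_real (v b)) *c b)" for u v
    unfolding self.linear_sum[OF lin] self.linear_scale[OF lin] by (intro sum.cong) (auto simp: Tb)
  have TV: "T v x \<in> V" if x: "x \<in> V" for v x
  proof -
    obtain u where u: "x = (\<Sum>b\<in>B. u b *c b)" using span_finite_coordinates[OF B(1), of x] x B(3) by blast
    show ?thesis unfolding u Tsum using sub BV by (auto intro!: subspace_sum subspace_scale)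
  qed
  have inv: "T v (T v' x) = x" if xV: "x \<in> V" and vv: "\<And>b. b \<in> B \<Longrightarrow> v b * v' b = 1" for v v' x
  proof -
    obtain u where u: "x = (\<Sum>b\<in>B. u b *c b)" using span_finite_coordinates[OF B(1), of x] xV B(3) by blast
    show ?thesis unfolding u Tsum using vv
      by (intro sum.cong) (auto simp: mult_ac simp flip: of_real_mult)
  qed
  define Q' where "Q' t x y = Q t (T (w t) x) (T (w t) y)" for t x y
  have herm: "hermitian_on V (Q' t)" if "hermitian_on V (Q t)" for t
    unfolding hermitian_on_def
  proof (intro conjI ballI)
    fix x assume x: "x \<in> V"
    show "functional_on V (Q' t x)" unfolding functional_on_def Q'_def self.linear_add[OF lin] self.linear_scale[OF lin]
      using hermitian_on_add_right[OF that] hermitian_on_scale_right[OF that] TV x by auto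
    show "Q' t y x = cnj (Q' t x y)" if "y \<in> V" for y
      unfolding Q'_def using TV x that by (intro hermitian_on_cnj[OF \<open>hermitian_on V (Q t)\<close>]) auto
  qed
  have lim': "((\<lambda>t. Q' t x y) \<longlongrightarrow> R x y) F" if xy: "x \<in> V" "y \<in> V" for x y
  proof -
    obtain u where u: "x = (\<Sum>b\<in>B. u b *c b)" using span_finite_coordinates[OF B(1), of x] xy(1) B(3) by blast
    obtain v where v: "y = (\<Sum>b\<in>B. v b *c b)" using span_finite_coordinates[OF B(1), of y] xy(2) B(3) by blast
    have "R x y = (\<Sum>b\<in>B. \<Sum>c\<in>B. cnj (u b) * v c * R b c)"
      unfolding u v using R sub B(1) BV by (intro hermitian_on_sum[where V = V]) auto
    moreover have "((\<lambda>t. \<Sum>b\<in>B. \<Sum>c\<in>B. cnj (u b) * v c * (of_real (w t b * w t c) * Q t b c)) \<longlongrightarrow>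
      (\<Sum>b\<in>B. \<Sum>c\<in>B. cnj (u b) * v c * R b c)) F"
      by (intro tendsto_sum tendsto_mult_left lim)
    moreover have "\<forall>\<^sub>F t in F. Q' t x y = (\<Sum>b\<in>B. \<Sum>c\<in>B. cnj (u b) * v c * (of_real (w t b * w t c) * Q t b c))"
      using Q
    proof eventually_elim
      case (elim t)
      have "Q' t x y = (\<Sum>b\<in>B. \<Sum>c\<in>B. cnj (u b * of_real (w t b)) * (v c * of_real (w t c)) * Q t b c)"
        unfolding Q'_def u v Tsum using elim sub B(1) BV by (intro hermitian_on_sum[where V = V]) auto
      then show ?case by (simp add: mult_ac)
    qed
    ultimately show ?thesis by (simp add: tendsto_cong)
  qed
  have "\<forall>\<^sub>F t in F. index V R \<le> index V (Q' t) \<and> index V (Q' t) \<le> index V R + nullity V R"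
    using Q by (intro index_semicontinuous[OF V _ R lim']) (auto elim: eventually_mono intro: herm)
  then show ?thesis using Q w
  proof eventually_elim
    case (elim t)
    have inj: "inj_on (T v) V" if "\<And>b. b \<in> B \<Longrightarrow> v b \<noteq> 0" for v
      by (rule inj_on_inverseI[of _ "T (\<lambda>b. 1 / v b)"]) (use that in \<open>auto intro!: inv\<close>)
    have "index V (Q' t) \<le> index V (Q t)"
      using elim TV by (intro self.index_le_image[OF lin[of "w t"] V inj]) (auto simp: Q'_def herm V)
    moreover have "index V (Q t) \<le> index V (Q' t)"
    proof (intro self.index_le_image[OF lin[of "\<lambda>b. 1 / w t b"] V inj])
      fix x assume "x \<in> V"
      then have "T (w t) (T (\<lambda>b. 1 / w t b) x) = x" using elim(3) by (intro inv) auto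
      then show "Re (Q' t (T (\<lambda>b. 1 / w t b) x) (T (\<lambda>b. 1 / w t b) x)) \<le> Re (Q t x x)"
        by (simp add: Q'_def)
    qed (use elim TV in \<open>auto simp: herm V\<close>)
    ultimately show ?case using elim(1) by simp
  qed
qed

end

section \<open>Counting functions with jumps\<close>

text \<open>
  Integer-valued counting functions of the type ``number of eigenvalues below \<open>t\<close>, with \<open>d t\<close> the
  multiplicity of \<open>t\<close>'': an eigenvalue is counted to its right, not at the point itself.
\<close>

definition jumps_on :: "real set \<Rightarrow> (real \<Rightarrow> nat) \<Rightarrow> (real \<Rightarrow> nat) \<Rightarrow> bool" where
  "jumps_on S c d \<longleftrightarrow> mono_on S c \<and>
     (\<forall>t\<in>S. (\<forall>\<^sub>F s in at_left t. c s = c t) \<and> (\<forall>\<^sub>F s in at_right t. c s = c t + d t))"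

text \<open>
  The \<open>n\<close>-th eigenvalue, as seen by its counting function on \<open>S\<close>.
\<close>

definition level :: "real set \<Rightarrow> (real \<Rightarrow> nat) \<Rightarrow> nat \<Rightarrow> real" where
  "level S c n = Inf {t \<in> S. n \<le> c t}"

lemma eventually_at_left_less: "\<forall>\<^sub>F s in at_left t. s < (t::real)"
  by (simp add: eventually_at_filter)

text \<open>
  To the right of \<open>t\<close>, monotonicity bounds the index from below by index plus nullity, and
  semicontinuity bounds it from above by the same number.  To the left both bounds equal the index at \<open>t\<close>.
\<close>

lemma (in complex_space) index_jumps_on:
  assumes V: "fin_dim V" and S: "open S" and Q: "\<And>t. t \<in> S \<Longrightarrow> hermitian_on V (Q t)"
    and cont: "\<And>t x y. t \<in> S \<Longrightarrow> x \<in> V \<Longrightarrow> y \<in> V \<Longrightarrow> ((\<lambda>s. Q s x y) \<longlongrightarrow> Q t x y) (at t)"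
    and decr: "\<And>s t x. s \<in> S \<Longrightarrow> t \<in> S \<Longrightarrow> s < t \<Longrightarrow> x \<in> V \<Longrightarrow> Re (Q t x x) \<le> Re (Q s x x)"
    and strict: "\<And>s t x. s \<in> S \<Longrightarrow> t \<in> S \<Longrightarrow> s < t \<Longrightarrow> x \<in> radical V (Q s) \<Longrightarrow> x \<noteq> 0 \<Longrightarrow> Re (Q t x x) < Re (Q s x x)"
  shows "jumps_on S (\<lambda>t. index V (Q t)) (\<lambda>t. nullity V (Q t))"
  unfolding jumps_on_def
proof (intro conjI ballI)
  show mono: "mono_on S (\<lambda>t. index V (Q t))"
  proof (rule mono_onI)
    fix r s assume rs: "r \<in> S" "s \<in> S" "r \<le> s"
    show "index V (Q r) \<le> index V (Q s)"
      using rs decr by (cases "r = s") (auto intro!: index_mono[OF V Q Q])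
  qed
  fix t assume t: "t \<in> S"
  have near: "\<forall>\<^sub>F s in at t. s \<in> S"
    using S t by (rule eventually_at_in_open')
  have semi: "\<forall>\<^sub>F s in at t. index V (Q t) \<le> index V (Q s) \<and> index V (Q s) \<le> index V (Q t) + nullity V (Q t)"
    by (intro index_semicontinuous[OF V _ Q[OF t]] cont[OF t] eventually_mono[OF near Q])
  show "\<forall>\<^sub>F s in at_left t. index V (Q s) = index V (Q t)"
    using filter_leD[OF at_le[OF subset_UNIV] near] filter_leD[OF at_le[OF subset_UNIV] semi] eventually_at_left_less[of t]
  proof eventually_elim
    case (elim s)
    then show ?case using mono_onD[OF mono, of s t] t by simp
  qed
  show "\<forall>\<^sub>F s in at_right t. index V (Q s) = index V (Q t) + nullity V (Q t)"
    using filter_leD[OF at_le[OF subset_UNIV] near] filter_leD[OF at_le[OF subset_UNIV] semi] eventually_at_right_less[of t]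
  proof eventually_elim
    case (elim s)
    then have "index V (Q t) + nullity V (Q t) \<le> index V (Q s)"
      using t decr strict by (intro index_strict_mono[OF V Q Q]) auto
    then show ?case using elim by simp
  qed
qed

lemma jumps_on_jump_le:
  assumes "jumps_on S c d" "s \<in> S" "t \<in> S" "s < t" "{s..t} \<subseteq> S"
  shows "c s + d s \<le> c t"
proof -
  have "\<forall>\<^sub>F r in at_right s. c r = c s + d s"
    using assms by (auto simp: jumps_on_def)
  moreover have "\<forall>\<^sub>F r in at_right s. r \<in> {s<..<t}"
    using assms(4) by (rule eventually_at_right_real)
  ultimately have "\<forall>\<^sub>F r in at_right s. c r = c s + d s \<and> r \<in> {s<..<t}"
    by (rule eventually_conj)
  then obtain r where r: "c r = c s + d s" "r \<in> {s<..<t}"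
    using eventually_happens'[of "at_right s"] by (auto simp: trivial_limit_at_right_real)
  then have "c r \<le> c t"
    using assms by (intro mono_onD[of S c]) (auto simp: jumps_on_def)
  then show ?thesis using r by simp
qed

text \<open>
  The counting function is recovered from its jumps, because both sides change in the same way near
  every point and the domain is connected.  In particular it depends only on the multiplicities; this
  is what makes the number of pieces of an edge irrelevant.
\<close>

lemma jumps_on_sum:
  assumes J: "jumps_on S c d" and S: "open S" "connected S" "\<And>x. x \<in> S \<Longrightarrow> {..x} \<subseteq> S"
    and a: "a \<in> S" "c a = 0" and x: "x \<in> S"
  shows "finite {y. y < x \<and> d y \<noteq> 0} \<and> c x = sum d {y. y < x \<and> d y \<noteq> 0}"
proof (rule connected_induction_simple[of S a x "\<lambda>x. finite {y. y < x \<and> d y \<noteq> 0} \<and> c x = sum d {y. y < x \<and> d y \<noteq> 0}", OF S(2) a(1) x])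
  have "d y = 0" if "y < a" for y
  proof -
    have "y \<in> S" "{y..a} \<subseteq> S" using S(3)[OF a(1)] that by auto
    then show ?thesis using jumps_on_jump_le[OF J _ a(1) that] a(2) by simp
  qed
  then have "{y. y < a \<and> d y \<noteq> 0} = {}" by auto
  then show "finite {y. y < a \<and> d y \<noteq> 0} \<and> c a = sum d {y. y < a \<and> d y \<noteq> 0}"
    using a(2) by (simp only: finite.emptyI sum.empty simp_thms)
next
  fix t assume t: "t \<in> S"
  have "\<forall>\<^sub>F s in at_left t. c s = c t" "\<forall>\<^sub>F s in at_right t. c s = c t + d t"
    using J t by (auto simp: jumps_on_def)
  then obtain l r where l: "l < t" "\<And>s. s > l \<Longrightarrow> s < t \<Longrightarrow> c s = c t"
    and r: "r > t" "\<And>s. s > t \<Longrightarrow> s < r \<Longrightarrow> c s = c t + d t"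
    unfolding eventually_at_left_field eventually_at_right_field by blast
  obtain e where e: "e > 0" "ball t e \<subseteq> S" using S(1) t by (meson openE)
  define h where "h = Min {e, t - l, r - t}"
  have h: "h > 0" "h \<le> e" "h \<le> t - l" "h \<le> r - t"
    using e(1) l(1) r(1) by (auto simp: h_def)
  define T where "T = {t - h<..<t + h}"
  have TS: "T \<subseteq> S" using e(2) h(2) by (auto simp: T_def ball_def dist_real_def subset_iff)
  have cl: "c s = c t" if "s \<in> T" "s \<le> t" for s
    using that l(2)[of s] h by (cases "s = t") (auto simp: T_def)
  have cr: "c s = c t + d t" if "s \<in> T" "s > t" for s
    using that r(2)[of s] h by (auto simp: T_def)
  have d0: "d s = 0" if "s \<in> T" "s \<noteq> t" for s
  proof (cases "s < t")
    case True
    have "{s..t} \<subseteq> S" "s \<in> S" using S(3)[OF t] TS that by auto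
    then show ?thesis using jumps_on_jump_le[OF J _ t True] cl that True by auto
  next
    case False
    (* a second point to the right of s, where c has the same value as at s *)
    define s' where "s' = (s + t + h) / 2"
    have s': "s' \<in> T" "s < s'" "s' > t" using that False by (auto simp: T_def s'_def)
    then have "s \<in> S" "s' \<in> S" using TS that by auto
    moreover have "{s..s'} \<subseteq> S" using S(3)[OF \<open>s' \<in> S\<close>] by auto
    ultimately show ?thesis using jumps_on_jump_le[OF J _ _ s'(2)] cr[OF s'(1,3)] cr[of s] that False by auto
  qed
  define A where "A = {y. y \<le> t - h \<and> d y \<noteq> 0}"
  have set: "{y. y < s \<and> d y \<noteq> 0} = (if s \<le> t \<or> d t = 0 then A else insert t A)" if "s \<in> T" for s
  proof (intro set_eqI iffI)
    fix y assume "y \<in> {y. y < s \<and> d y \<noteq> 0}"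
    then have y: "y < s" "d y \<noteq> 0" by auto
    show "y \<in> (if s \<le> t \<or> d t = 0 then A else insert t A)"
    proof (cases "y = t")
      case True
      have "\<not> (s \<le> t \<or> d t = 0)" using y unfolding True by simp
      then show ?thesis unfolding True by simp
    next
      case False
      have "y \<notin> T" using d0[of y] y(2) False by auto
      then have "y \<le> t - h" using y(1) that by (auto simp: T_def)
      then show ?thesis using y(2) by (auto simp: A_def)
    qed
  next
    fix y assume y: "y \<in> (if s \<le> t \<or> d t = 0 then A else insert t A)"
    have "t - h < s" using that by (auto simp: T_def)
    then show "y \<in> {y. y < s \<and> d y \<noteq> 0}"
      using y by (cases "s \<le> t \<or> d t = 0") (auto simp: A_def)
  qed
  have tA: "t \<notin> A" using h(1) by (auto simp: A_def)
  have "finite {y. y < s \<and> d y \<noteq> 0} \<and> c s = sum d {y. y < s \<and> d y \<noteq> 0} \<longleftrightarrow> finite A \<and> c t = sum d A"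
    if "s \<in> T" for s
    unfolding set[OF that] using tA cl[OF that] cr[OF that] by (cases "s \<le> t"; cases "d t = 0") auto
  moreover have "openin (top_of_set S) T" using TS by (simp add: T_def openin_open_eq S(1))
  moreover have "t \<in> T" using h(1) by (simp add: T_def)
  ultimately show "\<exists>T. openin (top_of_set S) T \<and> t \<in> T \<and>
     (\<forall>x\<in>T. \<forall>y\<in>T. (finite {y. y < x \<and> d y \<noteq> 0} \<and> c x = sum d {y. y < x \<and> d y \<noteq> 0}) \<longrightarrow>
        (finite {z. z < y \<and> d z \<noteq> 0} \<and> c y = sum d {z. z < y \<and> d z \<noteq> 0}))"
    by blast
qed

lemma level_less_iff:
  assumes J: "jumps_on S c d" and S: "\<And>x. x \<in> S \<Longrightarrow> {..x} \<subseteq> S"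
    and a: "a \<in> S" "c a < n" and n: "b \<in> S" "n \<le> c b" and t: "t \<in> S"
  shows "level S c n < t \<longleftrightarrow> n \<le> c t"
proof
  have mono: "c r \<le> c s" if "r \<le> s" "s \<in> S" for r s
    using J S[OF that(2)] that by (auto simp: jumps_on_def mono_on_def)
  have "a \<le> s" if "s \<in> S" "n \<le> c s" for s
    using mono[of s a] that a by (cases "a \<le> s") auto
  then have bdd: "bdd_below {s \<in> S. n \<le> c s}"
    by (intro bdd_belowI[of _ a]) auto
  show "level S c n < t" if nt: "n \<le> c t"
  proof -
    have "\<forall>\<^sub>F s in at_left t. c s = c t" using J t by (auto simp: jumps_on_def)
    then have "\<forall>\<^sub>F s in at_left t. c s = c t \<and> s < t"
      using eventually_at_left_less by (rule eventually_conj)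
    then obtain s where "c s = c t" "s < t"
      using eventually_happens'[of "at_left t"] by (auto simp: trivial_limit_at_left_real)
    moreover have "s \<in> S" using S[OF t] \<open>s < t\<close> by auto
    ultimately have "level S c n \<le> s" unfolding level_def using nt by (intro cInf_lower bdd) auto
    with \<open>s < t\<close> show ?thesis by simp
  qed
  show "n \<le> c t" if lt: "level S c n < t"
  proof -
    obtain s where "n \<le> c s" "s < t"
      using cInf_lessD[of "{t \<in> S. n \<le> c t}" t] lt n by (auto simp: level_def)
    then show ?thesis using mono[of s t] t by simp
  qed
qed

lemma level_enumerates:
  assumes J: "jumps_on UNIV c d" and a: "c a = 0" and unb: "\<And>n. \<exists>t. n \<le> c t"
  shows "mono_on {1..} (level UNIV c)" "{n \<in> {1..}. level UNIV c n = t} = {c t + 1..c t + d t}"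
proof -
  have iff: "level UNIV c n < t \<longleftrightarrow> n \<le> c t" if "1 \<le> n" for n t
    using unb[of n] level_less_iff[OF J, of a n _ t] a that by auto
  show "mono_on {1..} (level UNIV c)"
  proof (rule mono_onI)
    fix m n :: nat assume mn: "m \<in> {1..}" "n \<in> {1..}" "m \<le> n"
    show "level UNIV c m \<le> level UNIV c n"
    proof (rule dense_le)
      fix s assume "s < level UNIV c m"
      then have "\<not> m \<le> c s" using iff[of m s] mn by auto
      then have "\<not> n \<le> c s" using mn by simp
      then show "s \<le> level UNIV c n" using iff[of n s] mn by auto
    qed
  qed
  show "{n \<in> {1..}. level UNIV c n = t} = {c t + 1..c t + d t}"
  proof (intro set_eqI iffI)
    fix n assume "n \<in> {n \<in> {1..}. level UNIV c n = t}"
    then have n: "1 \<le> n" "level UNIV c n = t" by auto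
    have "\<forall>\<^sub>F r in at_right t. c r = c t + d t \<and> t < r"
      using J by (intro eventually_conj eventually_at_right_less) (auto simp: jumps_on_def)
    then obtain r where "c r = c t + d t" "t < r"
      using eventually_happens'[of "at_right t"] by (auto simp: trivial_limit_at_right_real)
    then show "n \<in> {c t + 1..c t + d t}" using iff[OF n(1), of t] iff[OF n(1), of r] n(2) by auto
  next
    fix n assume n: "n \<in> {c t + 1..c t + d t}"
    then have n1: "1 \<le> n" by auto
    have "\<not> level UNIV c n < t" using iff[OF n1] n by auto
    moreover have "level UNIV c n \<le> t"
    proof (rule dense_ge)
      fix s assume "t < s"
      then have "n \<le> c s" using jumps_on_jump_le[OF J, of t s] n by auto
      then show "level UNIV c n \<le> s" using iff[OF n1, of s] by simp
    qed
    ultimately show "n \<in> {n \<in> {1..}. level UNIV c n = t}" using n1 by auto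
  qed
qed

text \<open>
  The bounds \<open>j t\<close> and \<open>j t + z t\<close> on the counting functions differ only at the jumps of \<open>j\<close>, and the
  jump at \<open>t\<close> is already contained in \<open>j s\<close> for \<open>s > t\<close>; so the levels are squeezed to that of \<open>j\<close>.
\<close>

lemma level_tendsto:
  assumes J: "jumps_on UNIV j z" and a: "j a < n" and n: "n \<le> j b"
    and L: "\<And>t. \<forall>\<^sub>F e in F. L e < t \<longleftrightarrow> n \<le> C e t"
    and C: "\<And>t. \<forall>\<^sub>F e in F. j t \<le> C e t \<and> C e t \<le> j t + z t"
  shows "(L \<longlongrightarrow> level UNIV j n) F"
proof (rule order_tendstoI)
  fix t assume "level UNIV j n < t"
  then have nj: "n \<le> j t" using level_less_iff[OF J _ _ a _ n, of t] by simp
  show "\<forall>\<^sub>F e in F. L e < t"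
    using L[of t] C[of t] by eventually_elim (use nj in auto)
next
  fix t assume t: "t < level UNIV j n"
  obtain s where s: "t < s" "s < level UNIV j n" using dense[OF t] by auto
  obtain r where r: "s < r" "r < level UNIV j n" using dense[OF s(2)] by auto
  have "\<not> n \<le> j r" using level_less_iff[OF J _ _ a _ n, of r] r by simp
  then have jz: "j s + z s < n" using jumps_on_jump_le[OF J, of s r] r by auto
  show "\<forall>\<^sub>F e in F. t < L e"
    using L[of s] C[of s] by eventually_elim (use s jz in auto)
qed

section \<open>Two-scale limits of perturbed forms\<close>

context complex_space
begin

lemma hermitian_on_plus:
  assumes "hermitian_on V Q" "hermitian_on V R" shows "hermitian_on V (\<lambda>x y. Q x y + R x y)"
  unfolding hermitian_on_def functional_on_def
proof (intro conjI ballI allI)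
  fix x y z c assume x: "x \<in> V" "y \<in> V"
  show "Q y x + R y x = cnj (Q x y + R x y)"
    unfolding hermitian_on_cnj[OF assms(1) x] hermitian_on_cnj[OF assms(2) x] by simp
  show "Q x (c *c y) + R x (c *c y) = c * (Q x y + R x y)"
    unfolding hermitian_on_scale_right[OF assms(1) x] hermitian_on_scale_right[OF assms(2) x] by (simp add: algebra_simps)
  assume z: "z \<in> V"
  show "Q x (y + z) + R x (y + z) = Q x y + R x y + (Q x z + R x z)"
    unfolding hermitian_on_add_right[OF assms(1) x z] hermitian_on_add_right[OF assms(2) x z] by simp
qed

lemma hermitian_on_real_scale:
  assumes "hermitian_on V Q" shows "hermitian_on V (\<lambda>x y. complex_of_real r * Q x y)"
  unfolding hermitian_on_def functional_on_def
proof (intro conjI ballI allI)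
  fix x y z c assume x: "x \<in> V" "y \<in> V"
  show "complex_of_real r * Q y x = cnj (complex_of_real r * Q x y)"
    unfolding hermitian_on_cnj[OF assms(1) x] by simp
  show "complex_of_real r * Q x (c *c y) = c * (complex_of_real r * Q x y)"
    unfolding hermitian_on_scale_right[OF assms(1) x] by (simp add: algebra_simps)
  assume z: "z \<in> V"
  show "complex_of_real r * Q x (y + z) = complex_of_real r * Q x y + complex_of_real r * Q x z"
    unfolding hermitian_on_add_right[OF assms(1) x z] by (simp add: algebra_simps)
qed

lemma hermitian_on_pullback:
  assumes "hermitian_on V Q" "Vector_Spaces.linear scale scale T" "\<And>x. x \<in> V \<Longrightarrow> T x \<in> V"
  shows "hermitian_on V (\<lambda>x y. Q (T x) (T y))"
proof -
  interpret T: Vector_Spaces.linear scale scale T by fact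
  show ?thesis
    unfolding hermitian_on_def functional_on_def T.add T.scale
    using hermitian_on_add_right[OF assms(1)] hermitian_on_scale_right[OF assms(1)] assms(3)
    by (auto intro: hermitian_on_cnj[OF assms(1)])
qed

end

text \<open>
  The algebraic situation behind the slow eigenvalues.  Here \<open>A \<tau>\<close> stands for the form of
  \<open>- d\<^sup>2/dx\<^sup>2 - \<tau>\<close> and \<open>A 0\<close> is nonnegative with kernel spanned by \<open>Bm \<union> B0 \<union> Bp\<close>; on this
  kernel \<open>A \<tau>\<close> starts with the term \<open>- \<tau> m\<close>, and the perturbation \<open>q\<close> is diagonal there with
  entries \<open>-1\<close>, \<open>0\<close> and \<open>1\<close>.  The set \<open>Bw\<close> completes the basis of \<open>V\<close>.
\<close>

locale two_scale_forms = complex_space scale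
  for scale :: "complex \<Rightarrow> 'v::ab_group_add \<Rightarrow> 'v" (infixr "*c" 75) +
  fixes V :: "'v set" and A :: "real \<Rightarrow> 'v \<Rightarrow> 'v \<Rightarrow> complex" and q m :: "'v \<Rightarrow> 'v \<Rightarrow> complex"
    and Bm B0 Bp Bw :: "'v set"
  assumes fin: "finite Bm" "finite B0" "finite Bp" "finite Bw"
    and disj: "Bm \<inter> B0 = {}" "(Bm \<union> B0) \<inter> Bp = {}" "(Bm \<union> B0 \<union> Bp) \<inter> Bw = {}"
    and basis: "independent (Bm \<union> B0 \<union> Bp \<union> Bw)" "span (Bm \<union> B0 \<union> Bp \<union> Bw) = V"
    and A_herm: "hermitian_on V (A \<tau>)" and q_herm: "hermitian_on V q" and m_herm: "hermitian_on V m"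
    and A_0: "\<And>b x. b \<in> Bm \<union> B0 \<union> Bp \<Longrightarrow> x \<in> V \<Longrightarrow> A 0 b x = 0"
    and A_lim: "\<And>x y. x \<in> V \<Longrightarrow> y \<in> V \<Longrightarrow> ((\<lambda>\<tau>. A \<tau> x y) \<longlongrightarrow> A 0 x y) (at 0)"
    and A_slope: "\<And>b x. b \<in> Bm \<union> B0 \<union> Bp \<Longrightarrow> x \<in> V \<Longrightarrow> ((\<lambda>\<tau>. A \<tau> b x / of_real \<tau>) \<longlongrightarrow> - m b x) (at 0)"
    and A_nonneg: "\<And>x. x \<in> V \<Longrightarrow> 0 \<le> Re (A 0 x x)"
    and A_zero: "\<And>x. x \<in> V \<Longrightarrow> Re (A 0 x x) = 0 \<Longrightarrow> x \<in> span (Bm \<union> B0 \<union> Bp)"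
    and m_pos: "\<And>x. x \<in> span (Bm \<union> B0 \<union> Bp) \<Longrightarrow> x \<noteq> 0 \<Longrightarrow> Re (m x x) > 0"
    and q_orth: "\<And>b c. b \<in> Bm \<union> B0 \<union> Bp \<Longrightarrow> c \<in> Bm \<union> B0 \<union> Bp \<Longrightarrow> b \<noteq> c \<Longrightarrow> q b c = 0"
    and q_diag: "\<And>b. b \<in> Bm \<Longrightarrow> q b b = -1" "\<And>b. b \<in> B0 \<Longrightarrow> q b b = 0" "\<And>b. b \<in> Bp \<Longrightarrow> q b b = 1"
begin

abbreviation "BF \<equiv> Bm \<union> B0 \<union> Bp"
abbreviation "B \<equiv> Bm \<union> B0 \<union> Bp \<union> Bw"

sublocale self: complex_space_pair scale scale ..

lemma B_fin: "finite B" using fin by simp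
lemma V_fin_dim: "fin_dim V" using fin_dim_span[OF B_fin] unfolding basis(2) .
lemmas V_sub = fin_dim_subspace[OF V_fin_dim]
lemma B_sub: "b \<in> B \<Longrightarrow> b \<in> V" using span_superset[of B] unfolding basis(2) by (rule subsetD)

definition proj :: "'v set \<Rightarrow> 'v \<Rightarrow> 'v" where
  "proj C = self.construct B (\<lambda>b. if b \<in> C then b else 0)"

definition coord :: "'v \<Rightarrow> 'v \<Rightarrow> complex" where "coord b x = representation B x b"

lemma proj_linear: "Vector_Spaces.linear scale scale (proj C)"
  unfolding proj_def by (rule self.linear_construct[OF basis(1)])

lemma proj_basis: "b \<in> B \<Longrightarrow> proj C b = (if b \<in> C then b else 0)"
  unfolding proj_def by (rule self.construct_basis[OF basis(1)])

lemma coord_functional: "functional_on V (coord b)"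
  using functional_on_representation[OF basis(1), of b] basis(2) by (simp add: coord_def[abs_def])

lemma coord_sum: "x \<in> V \<Longrightarrow> x = (\<Sum>b\<in>B. coord b x *c b)"
  unfolding coord_def using sum_representation_eq[OF basis(1) _ B_fin subset_refl, of x] basis(2) by simp

lemma proj_sum:
  assumes "C \<subseteq> B" "x \<in> V" shows "proj C x = (\<Sum>b\<in>C. coord b x *c b)"
proof -
  have "proj C x = proj C (\<Sum>b\<in>B. coord b x *c b)" using coord_sum[OF assms(2)] by simp
  also have "\<dots> = (\<Sum>b\<in>B. coord b x *c proj C b)"
    unfolding self.linear_sum[OF proj_linear] self.linear_scale[OF proj_linear] ..
  also have "\<dots> = (\<Sum>b\<in>C. coord b x *c b)"
    using assms(1) B_fin by (intro sum.mono_neutral_cong_right) (auto simp: proj_basis)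
  finally show ?thesis .
qed

lemma proj_span:
  assumes "C \<subseteq> B" "x \<in> V" shows "proj C x \<in> span C"
  unfolding proj_sum[OF assms] by (intro span_sum span_scale span_base)

lemma proj_V: assumes "C \<subseteq> B" "x \<in> V" shows "proj C x \<in> V"
  using proj_span[OF assms] span_mono[OF assms(1)] basis(2) by auto

lemma coord_span:
  assumes "C \<subseteq> B" "x \<in> span C" "b \<in> B - C" shows "coord b x = 0"
proof -
  have "representation B x = representation C x"
    by (rule representation_extend[OF basis(1) assms(2,1)])
  then show ?thesis using representation_ne_zero[of C x b] assms(3) unfolding coord_def by auto
qed

lemma proj_id: assumes "C \<subseteq> B" "x \<in> span C" shows "proj C x = x"
proof -
  have x: "x \<in> V" using assms span_mono[OF assms(1)] basis(2) by auto
  have "(\<Sum>b\<in>C. coord b x *c b) = (\<Sum>b\<in>B. coord b x *c b)"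
    using assms(1) B_fin coord_span[OF assms] by (intro sum.mono_neutral_left) auto
  then show ?thesis using proj_sum[OF assms(1) x] coord_sum[OF x] by simp
qed

lemma proj_zero:
  assumes "C \<subseteq> B" "D \<subseteq> B" "C \<inter> D = {}" "x \<in> span D" shows "proj C x = 0"
proof -
  have x: "x \<in> V" using assms(2,4) span_mono[OF assms(2)] basis(2) by auto
  have "coord b x = 0" if "b \<in> C" for b using coord_span[OF assms(2,4), of b] that assms(1,3) by auto
  then show ?thesis unfolding proj_sum[OF assms(1) x] by simp
qed

lemma proj_Un:
  assumes "C \<subseteq> B" "D \<subseteq> B" "C \<inter> D = {}" "x \<in> V" shows "proj (C \<union> D) x = proj C x + proj D x"
  using assms B_fin by (simp add: proj_sum sum.union_disjoint finite_subset)

lemma proj_B: "x \<in> V \<Longrightarrow> proj B x = x"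
  using proj_sum[of B x] coord_sum[of x] by simp

lemma proj_eq_0_co: assumes "C \<subseteq> B" "x \<in> V" "proj C x = 0" "b \<in> C" shows "coord b x = 0"
proof -
  have "independent C" using independent_mono[OF basis(1) assms(1)] .
  moreover have "finite C" using assms(1) B_fin finite_subset by blast
  ultimately show ?thesis using assms(3,4) unfolding proj_sum[OF assms(1,2)]
    by (intro independentD[of C C "\<lambda>b. coord b x" b]) auto
qed

lemma coord_all_zero: assumes "x \<in> V" "\<And>b. b \<in> B \<Longrightarrow> coord b x = 0" shows "x = 0"
  using coord_sum[OF assms(1)] assms(2) by simp

text \<open>
  A basis vector of the kernel is annihilated from both sides, so \<open>A 0\<close> sees only the \<open>Bw\<close>-component
  of a vector.
\<close>

lemma A0_BF: assumes "f \<in> span BF" "x \<in> V" shows "A 0 f x = 0" "A 0 x f = 0"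
proof -
  have BFV: "BF \<subseteq> V" using B_sub by auto
  have fV: "f \<in> V" using assms(1) span_minimal[OF BFV V_sub] by auto
  obtain u where u: "f = (\<Sum>b\<in>BF. u b *c b)" using span_finite_coordinates[of BF f] fin assms(1) by auto
  have xb: "A 0 x b = 0" if "b \<in> BF" for b
    using hermitian_on_cnj[OF A_herm[of 0], of b x] A_0[OF that assms(2)] that BFV assms(2) by auto
  show "A 0 x f = 0" unfolding u
    using functional_on_sum[OF hermitian_on_functional[OF A_herm assms(2)] V_sub, of BF "\<lambda>b. b" 0 u] fin BFV xb by auto
  then show "A 0 f x = 0" using hermitian_on_cnj[OF A_herm assms(2) fV, of 0] by simp
qed

lemma q_on_BF:
  assumes "C \<subseteq> BF" "D \<subseteq> BF"
  shows "q (\<Sum>b\<in>C. u b *c b) (\<Sum>b\<in>D. v b *c b) = (\<Sum>b\<in>C \<inter> D. cnj (u b) * v b * q b b)"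
proof -
  have f: "finite C" "finite D" using assms fin by (meson finite_UnI finite_subset)+
  have "q (\<Sum>b\<in>C. u b *c b) (\<Sum>b\<in>D. v b *c b) = (\<Sum>b\<in>C. \<Sum>c\<in>D. cnj (u b) * v c * q b c)"
    using f assms B_sub by (intro hermitian_on_sum[OF q_herm V_sub]) auto
  also have "\<dots> = (\<Sum>b\<in>C. \<Sum>c\<in>D. if c = b then cnj (u b) * v b * q b b else 0)"
    using assms q_orth by (intro sum.cong refl) (auto simp: subset_iff)
  also have "\<dots> = (\<Sum>b\<in>C. if b \<in> D then cnj (u b) * v b * q b b else 0)" using f by simp
  also have "\<dots> = (\<Sum>b\<in>C \<inter> D. cnj (u b) * v b * q b b)" using f by (simp add: sum.inter_restrict)
  finally show ?thesis .
qed

lemma q_self: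
  assumes "C \<subseteq> BF" "x \<in> V"
  shows "Re (q (proj C x) (proj C x)) = (\<Sum>b\<in>C \<inter> Bp. (cmod (coord b x))\<^sup>2) - (\<Sum>b\<in>C \<inter> Bm. (cmod (coord b x))\<^sup>2)"
proof -
  have CB: "C \<subseteq> B" using assms(1) by auto
  have f: "finite C" using assms(1) fin by (meson finite_UnI finite_subset)
  have "q (proj C x) (proj C x) = (\<Sum>b\<in>C \<inter> C. cnj (coord b x) * coord b x * q b b)"
    unfolding proj_sum[OF CB assms(2)] by (rule q_on_BF[OF assms(1,1)])
  also have "\<dots> = (\<Sum>b\<in>C. of_real ((cmod (coord b x))\<^sup>2) * q b b)"
    by (simp add: complex_norm_square mult_ac del: of_real_power)
  also have "\<dots> = (\<Sum>b\<in>C. of_real ((if b \<in> Bp then (cmod (coord b x))\<^sup>2 else 0) - (if b \<in> Bm then (cmod (coord b x))\<^sup>2 else 0)))"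
    using assms(1) q_diag disj by (intro sum.cong refl) (auto simp: subset_iff disjoint_iff)
  finally show ?thesis using f by (simp add: sum_subtractf sum.inter_restrict)
qed

lemma slope:
  assumes b: "b \<in> BF" and x: "x \<in> V" and h: "(h \<longlongrightarrow> 0) F" "\<forall>\<^sub>F e in F. h e \<noteq> (0::real)"
  shows "((\<lambda>e. A (c * h e) b x / of_real (h e)) \<longlongrightarrow> - of_real c * m b x) F"
proof (cases "c = 0")
  case True
  then show ?thesis using A_0[OF b x] by simp
next
  case False
  have "filterlim (\<lambda>e. c * h e) (at 0) F"
    unfolding filterlim_at using False h by (auto intro!: tendsto_mult_right_zero elim: eventually_mono)
  then have "((\<lambda>e. A (c * h e) b x / of_real (c * h e)) \<longlongrightarrow> - m b x) F"
    by (rule filterlim_compose[OF A_slope[OF b x]])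
  then have "((\<lambda>e. of_real c * (A (c * h e) b x / of_real (c * h e))) \<longlongrightarrow> of_real c * (- m b x)) F"
    by (rule tendsto_mult_left)
  then show ?thesis using False by simp
qed

lemma A_lim':
  assumes "x \<in> V" "y \<in> V" "(h \<longlongrightarrow> 0) F"
  shows "((\<lambda>e. A (h e) x y) \<longlongrightarrow> A 0 x y) F"
  using isCont_tendsto_compose[of 0 "\<lambda>\<tau>. A \<tau> x y" h F] A_lim[OF assms(1,2)] assms(3) by (simp add: isCont_def)

text \<open>
  Entries of the rescaled matrix need only be treated on one side of the diagonal.
\<close>

lemma weighted_symmetric:
  assumes "b \<in> V" "c \<in> V" "hermitian_on V R" and Q: "\<And>e. hermitian_on V (Q e)"
    and "((\<lambda>e. of_real (w e b * w e c) * Q e b c) \<longlongrightarrow> R b c) F"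
  shows "((\<lambda>e. of_real (w e c * w e b) * Q e c b) \<longlongrightarrow> R c b) F"
proof -
  have eq: "cnj (of_real (w e b * w e c) * Q e b c) = of_real (w e c * w e b) * Q e c b" for e
  proof -
    have "Q e c b = cnj (Q e b c)" by (rule hermitian_on_cnj[OF Q assms(1,2)])
    then show ?thesis by (simp add: mult.commute)
  qed
  have "cnj (R b c) = R c b" by (rule hermitian_on_cnj[OF assms(3,1,2), symmetric])
  with tendsto_cnj[OF assms(5)] show ?thesis unfolding eq by (simp only:)
qed

definition perturbed :: "real \<Rightarrow> real \<Rightarrow> 'v \<Rightarrow> 'v \<Rightarrow> complex" where
  "perturbed \<epsilon> \<tau> x y = A \<tau> x y + of_real \<epsilon> * q x y"

lemma perturbed_herm: "hermitian_on V (perturbed \<epsilon> \<tau>)"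
  unfolding perturbed_def by (intro hermitian_on_plus hermitian_on_real_scale A_herm q_herm)

text \<open>
  The limit of \<open>perturbed \<epsilon> (c * \<epsilon>)\<close> when the kernel vectors are rescaled by \<open>1 / sqrt \<epsilon>\<close>: this
  factor makes \<open>\<epsilon> q\<close> and \<open>- c \<epsilon> m\<close> of order one on the kernel, while the terms that couple the
  kernel to \<open>Bw\<close> keep a factor \<open>sqrt \<epsilon>\<close> and disappear.
\<close>

definition slow_limit :: "real \<Rightarrow> 'v \<Rightarrow> 'v \<Rightarrow> complex" where
  "slow_limit c x y = A 0 x y + (q (proj BF x) (proj BF y) + of_real (- c) * m (proj BF x) (proj BF y))"

lemma proj_herm: "hermitian_on V Q \<Longrightarrow> C \<subseteq> B \<Longrightarrow> hermitian_on V (\<lambda>x y. Q (proj C x) (proj C y))"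
  by (rule hermitian_on_pullback[OF _ proj_linear proj_V])

lemma slow_limit_herm: "hermitian_on V (slow_limit c)"
proof -
  have BFB: "BF \<subseteq> B" by (rule Un_upper1)
  show ?thesis
    unfolding slow_limit_def[abs_def]
    by (rule hermitian_on_plus[OF A_herm hermitian_on_plus[OF proj_herm[OF q_herm BFB] hermitian_on_real_scale[OF proj_herm[OF m_herm BFB]]]])
qed

lemma index_squeezed_slow_limit:
  "\<forall>\<^sub>F \<epsilon> in at_right 0. index V (slow_limit c) \<le> index V (perturbed \<epsilon> (c * \<epsilon>)) \<and>
      index V (perturbed \<epsilon> (c * \<epsilon>)) \<le> index V (slow_limit c) + nullity V (slow_limit c)"
proof -
  define w where "w \<epsilon> b = (if b \<in> BF then 1 / sqrt \<epsilon> else 1)" for \<epsilon> b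
  have pos: "\<forall>\<^sub>F \<epsilon> in at_right 0. \<epsilon> > (0::real)" by (simp add: eventually_at_right_less)
  then have nz: "\<forall>\<^sub>F \<epsilon> in at_right 0. \<epsilon> \<noteq> (0::real)" by eventually_elim auto
  have id0: "((\<lambda>\<epsilon>. \<epsilon>) \<longlongrightarrow> (0::real)) (at_right 0)" by (rule tendsto_ident_at)
  have sq0: "((\<lambda>\<epsilon>. complex_of_real (sqrt \<epsilon>)) \<longlongrightarrow> 0) (at_right 0)"
    by (rule tendsto_eq_intros id0 refl | simp)+
  have FF: "((\<lambda>\<epsilon>. of_real (w \<epsilon> b * w \<epsilon> b') * perturbed \<epsilon> (c * \<epsilon>) b b') \<longlongrightarrow> slow_limit c b b') (at_right 0)"
    if b: "b \<in> BF" "b' \<in> BF" for b b'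
  proof -
    have bV: "b' \<in> V" using b B_sub by blast
    have "((\<lambda>\<epsilon>. A (c * \<epsilon>) b b' / of_real \<epsilon> + q b b') \<longlongrightarrow> - of_real c * m b b' + q b b') (at_right 0)"
      by (intro tendsto_add slope[OF b(1) bV id0 nz] tendsto_const)
    moreover have "\<forall>\<^sub>F \<epsilon> in at_right 0. A (c * \<epsilon>) b b' / of_real \<epsilon> + q b b' = of_real (w \<epsilon> b * w \<epsilon> b') * perturbed \<epsilon> (c * \<epsilon>) b b'"
      using pos
    proof eventually_elim
      case (elim \<epsilon>)
      then have ww: "w \<epsilon> b * w \<epsilon> b' = 1 / \<epsilon>" using b by (auto simp: w_def)
      show ?case unfolding ww perturbed_def using elim by (simp add: field_simps)
    qed
    moreover have "slow_limit c b b' = - of_real c * m b b' + q b b'"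
      using b A_0[OF b(1) bV] by (simp add: slow_limit_def proj_basis)
    ultimately show ?thesis by (simp add: tendsto_cong)
  qed
  have FW: "((\<lambda>\<epsilon>. of_real (w \<epsilon> b * w \<epsilon> b') * perturbed \<epsilon> (c * \<epsilon>) b b') \<longlongrightarrow> slow_limit c b b') (at_right 0)"
    if b: "b \<in> BF" "b' \<in> Bw" for b b'
  proof -
    have bV: "b' \<in> V" using b B_sub by blast
    have b': "b' \<notin> BF" using disj b by blast
    have "((\<lambda>\<epsilon>. of_real (sqrt \<epsilon>) * (A (c * \<epsilon>) b b' / of_real \<epsilon> + q b b')) \<longlongrightarrow> 0 * (- of_real c * m b b' + q b b')) (at_right 0)"
      by (intro tendsto_mult sq0 tendsto_add slope[OF b(1) bV id0 nz] tendsto_const)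
    moreover have "\<forall>\<^sub>F \<epsilon> in at_right 0. of_real (sqrt \<epsilon>) * (A (c * \<epsilon>) b b' / of_real \<epsilon> + q b b') = of_real (w \<epsilon> b * w \<epsilon> b') * perturbed \<epsilon> (c * \<epsilon>) b b'"
      using pos
    proof eventually_elim
      case (elim \<epsilon>)
      have ww: "w \<epsilon> b * w \<epsilon> b' = sqrt \<epsilon> / \<epsilon>" using b b' elim by (auto simp: w_def real_div_sqrt field_simps)
      show ?case unfolding ww perturbed_def using elim by (simp add: field_simps)
    qed
    moreover have "slow_limit c b b' = 0"
      using b b' A_0[OF b(1) bV] hermitian_on_scale_right[OF q_herm, of b 0 0] hermitian_on_scale_right[OF m_herm, of b 0 0] B_sub[of b] subspace_0[OF V_sub]
      by (simp add: slow_limit_def proj_basis)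
    ultimately show ?thesis by (simp add: tendsto_cong)
  qed
  have WW: "((\<lambda>\<epsilon>. of_real (w \<epsilon> b * w \<epsilon> b') * perturbed \<epsilon> (c * \<epsilon>) b b') \<longlongrightarrow> slow_limit c b b') (at_right 0)"
    if b: "b \<in> Bw" "b' \<in> Bw" for b b'
  proof -
    have bV: "b \<in> V" "b' \<in> V" using b B_sub by blast+
    have b': "b \<notin> BF" "b' \<notin> BF" using disj b by blast+
    have "((\<lambda>\<epsilon>. A (c * \<epsilon>) b b' + of_real \<epsilon> * q b b') \<longlongrightarrow> A 0 b b' + of_real 0 * q b b') (at_right 0)"
      by (intro tendsto_add A_lim'[OF bV] tendsto_mult tendsto_of_real id0 tendsto_const tendsto_mult_right_zero)
    moreover have "slow_limit c b b' = A 0 b b'"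
      using b b' hermitian_on_scale_right[OF q_herm, of 0 0 0] hermitian_on_scale_right[OF m_herm, of 0 0 0] subspace_0[OF V_sub]
      by (simp add: slow_limit_def proj_basis)
    ultimately show ?thesis using b' by (simp add: w_def perturbed_def)
  qed
  show ?thesis
  proof (rule index_semicontinuous_weighted[OF B_fin basis, where w = w and Q = "\<lambda>\<epsilon>. perturbed \<epsilon> (c * \<epsilon>)"])
    show "\<forall>\<^sub>F \<epsilon> in at_right 0. \<forall>b\<in>B. w \<epsilon> b \<noteq> 0" using pos by eventually_elim (auto simp: w_def)
    show "hermitian_on V (slow_limit c)" by (rule slow_limit_herm)
    fix b b' assume b: "b \<in> B" "b' \<in> B"
    show "((\<lambda>\<epsilon>. of_real (w \<epsilon> b * w \<epsilon> b') * perturbed \<epsilon> (c * \<epsilon>) b b') \<longlongrightarrow> slow_limit c b b') (at_right 0)"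
      using b FF[of b b'] FW[of b b'] WW[of b b']
        weighted_symmetric[OF _ _ slow_limit_herm perturbed_herm FW[of b' b]] B_sub[of b] B_sub[of b'] by blast
  qed (simp add: perturbed_herm)
qed

lemma slow_limit_self: "Re (slow_limit c x x) = Re (A 0 x x) + Re (q (proj BF x) (proj BF x)) - c * Re (m (proj BF x) (proj BF x))"
  by (simp add: slow_limit_def)

lemma m_BF_nonneg: "x \<in> span BF \<Longrightarrow> 0 \<le> Re (m x x)"
  using m_pos[of x] hermitian_on_scale_right[OF m_herm, of 0 0 0] subspace_0[OF V_sub] by (cases "x = 0") auto

lemma radical_self: "x \<in> radical V Q \<Longrightarrow> Q x x = 0"
  by (simp add: radical_def)

text \<open>
  A radical vector without kernel component would be a null vector of \<open>A 0\<close> and hence lie in the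
  kernel; so \<open>m\<close> is positive on the kernel component, and the form decreases strictly.
\<close>

lemma slow_limit_jumps_on: "jumps_on UNIV (\<lambda>c. index V (slow_limit c)) (\<lambda>c. nullity V (slow_limit c))"
proof (rule index_jumps_on[OF V_fin_dim])
  show "((\<lambda>s. slow_limit s x y) \<longlongrightarrow> slow_limit t x y) (at t)" for t x y
    unfolding slow_limit_def by (intro tendsto_intros)
  fix s t :: real and x assume st: "s < t"
  show "Re (slow_limit t x x) \<le> Re (slow_limit s x x)" if "x \<in> V"
    unfolding slow_limit_self using st m_BF_nonneg[OF proj_span[of BF x]] that by (simp add: mult_right_mono)
  assume x: "x \<in> radical V (slow_limit s)" "x \<noteq> 0"
  then have xV: "x \<in> V" by (simp add: radical_def)
  have BFB: "BF \<subseteq> B" by auto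
  have "proj BF x \<noteq> 0"
  proof
    assume p: "proj BF x = 0"
    have "q 0 0 = 0" "m 0 0 = 0"
      using hermitian_on_scale_right[OF q_herm, of 0 0 0] hermitian_on_scale_right[OF m_herm, of 0 0 0] subspace_0[OF V_sub] by auto
    then have "Re (A 0 x x) = 0" using slow_limit_self[of s x] radical_self[OF x(1)] p by simp
    then have "proj BF x = x" using A_zero[OF xV] proj_id[OF BFB] by blast
    with p x(2) show False by simp
  qed
  then have "Re (m (proj BF x) (proj BF x)) > 0" using m_pos proj_span[OF BFB xV] by blast
  then show "Re (slow_limit t x x) < Re (slow_limit s x x)" unfolding slow_limit_self using st by simp
qed (auto intro: slow_limit_herm)

lemma q_zero: "q 0 0 = 0" and m_zero: "m 0 0 = 0"
  using hermitian_on_scale_right[OF q_herm, of 0 0 0] hermitian_on_scale_right[OF m_herm, of 0 0 0] subspace_0[OF V_sub] by auto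

lemma proj_zero_co:
  assumes "C \<subseteq> B" "x \<in> V" "\<And>b. b \<in> C \<Longrightarrow> coord b x = 0" shows "proj C x = 0"
  using assms(3) unfolding proj_sum[OF assms(1,2)] by simp

lemma A0_zero_iff:
  assumes "x \<in> V" "Re (A 0 x x) = 0" shows "proj BF x = x" "proj Bw x = 0"
proof -
  have x: "x \<in> span BF" using A_zero assms by blast
  show "proj BF x = x" by (rule proj_id[OF _ x]) (rule Un_upper1)
  show "proj Bw x = 0" using disj(3) by (intro proj_zero[OF _ _ _ x]) auto
qed

text \<open>
  Lower bounds on an index come from spans of kernel vectors, where \<open>A 0\<close> drops out.
\<close>

lemma index_ge_kernel_span:
  assumes C: "C \<subseteq> BF" and Q: "hermitian_on V Q"
    and neg: "\<And>x. x \<in> V \<Longrightarrow> x \<noteq> 0 \<Longrightarrow> proj C x = x \<Longrightarrow> (\<And>b. b \<in> B - C \<Longrightarrow> coord b x = 0) \<Longrightarrow> Re (A 0 x x) = 0 \<Longrightarrow> Re (Q x x) < 0"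
  shows "card C \<le> index V Q"
proof (rule index_ge[OF V_fin_dim Q])
  have CB: "C \<subseteq> B" using C by auto
  show "negative_family V Q C" unfolding negative_family_def
  proof (intro conjI ballI impI)
    show "finite C" using CB B_fin finite_subset by blast
    show "C \<subseteq> V" using CB B_sub by blast
    show "independent C" by (rule independent_mono[OF basis(1) CB])
    fix x assume x: "x \<in> span C" "x \<noteq> 0"
    have xV: "x \<in> V" using x(1) span_mono[OF CB] basis(2) by auto
    have "x \<in> span BF" using x(1) span_mono[OF C] by auto
    then have "Re (A 0 x x) = 0" using A0_BF(1)[OF _ xV] by simp
    then show "Re (Q x x) < 0" using neg[OF xV x(2) proj_id[OF CB x(1)] coord_span[OF CB x(1)]] by simp
  qed
qed

lemma slow_limit_index_neg: "card Bm \<le> index V (slow_limit 0)"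
proof (rule index_ge_kernel_span[OF _ slow_limit_herm])
  fix x assume x: "x \<in> V" "x \<noteq> 0" "proj Bm x = x" "\<And>b. b \<in> B - Bm \<Longrightarrow> coord b x = 0" "Re (A 0 x x) = 0"
  have "Re (slow_limit 0 x x) = Re (q (proj Bm x) (proj Bm x))"
    unfolding slow_limit_self x(3) A0_zero_iff(1)[OF x(1,5)] using x(5) by simp
  also have "\<dots> = (\<Sum>b\<in>Bm \<inter> Bp. (cmod (coord b x))\<^sup>2) - (\<Sum>b\<in>Bm \<inter> Bm. (cmod (coord b x))\<^sup>2)"
    by (rule q_self[OF _ x(1)]) auto
  also have "Bm \<inter> Bp = {}" using disj(2) by auto
  finally have eq: "Re (slow_limit 0 x x) = - (\<Sum>b\<in>Bm. (cmod (coord b x))\<^sup>2)" by simp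
  have "\<exists>b\<in>Bm. coord b x \<noteq> 0"
  proof (rule ccontr)
    assume "\<not> ?thesis"
    then have "coord b x = 0" if "b \<in> B" for b using x(4)[of b] that by (cases "b \<in> Bm") auto
    then show False using coord_all_zero[OF x(1)] x(2) by blast
  qed
  then obtain b where "b \<in> Bm" "coord b x \<noteq> 0" by blast
  then have "0 < (\<Sum>b\<in>Bm. (cmod (coord b x))\<^sup>2)" using fin(1) by (intro sum_pos2) auto
  then show "Re (slow_limit 0 x x) < 0" using eq by simp
qed auto

lemma slow_limit_index_nullity: "index V (slow_limit 0) + nullity V (slow_limit 0) \<le> card Bm + card B0"
proof -
  have "index V (slow_limit 0) + nullity V (slow_limit 0) \<le> card (Bm \<union> B0)"
  proof (rule index_nullity_le_functionals[OF V_fin_dim slow_limit_herm, where \<phi> = coord])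
    fix x assume x: "x \<in> V" "x \<noteq> 0" "\<And>b. b \<in> Bm \<union> B0 \<Longrightarrow> coord b x = 0"
    have "Re (q (proj BF x) (proj BF x)) = (\<Sum>b\<in>BF \<inter> Bp. (cmod (coord b x))\<^sup>2) - (\<Sum>b\<in>BF \<inter> Bm. (cmod (coord b x))\<^sup>2)"
      by (rule q_self[OF _ x(1)]) auto
    also have "(\<Sum>b\<in>BF \<inter> Bm. (cmod (coord b x))\<^sup>2) = 0" using x(3) by (intro sum.neutral) auto
    also have "BF \<inter> Bp = Bp" by auto
    finally have eq: "Re (slow_limit 0 x x) = Re (A 0 x x) + (\<Sum>b\<in>Bp. (cmod (coord b x))\<^sup>2)" unfolding slow_limit_self by simp
    show "0 < Re (slow_limit 0 x x)"
    proof (cases "Re (A 0 x x) = 0")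
      case True
      have "\<exists>b\<in>Bp. coord b x \<noteq> 0"
      proof (rule ccontr)
        assume "\<not> ?thesis"
        then have "proj BF x = 0" using x(3) by (intro proj_zero_co[OF _ x(1)]) auto
        then show False using A0_zero_iff(1)[OF x(1) True] x(2) by simp
      qed
      then obtain b where "b \<in> Bp" "coord b x \<noteq> 0" by blast
      then have "0 < (\<Sum>b\<in>Bp. (cmod (coord b x))\<^sup>2)" using fin(3) by (intro sum_pos2) auto
      then show ?thesis using eq True by simp
    next
      case False
      then have "0 < Re (A 0 x x)" using A_nonneg[OF x(1)] by simp
      moreover have "0 \<le> (\<Sum>b\<in>Bp. (cmod (coord b x))\<^sup>2)" by (simp add: sum_nonneg)
      ultimately show ?thesis using eq by simp
    qed
  qed (use fin coord_functional in auto)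
  also have "card (Bm \<union> B0) = card Bm + card B0" using fin disj(1) by (simp add: card_Un_disjoint)
  finally show ?thesis .
qed

text \<open>
  On the kernel \<open>q\<close> is dominated by a multiple of \<open>m\<close>, so \<open>q - c m\<close> is positive for very
  negative \<open>c\<close> and negative for large \<open>c\<close>.
\<close>

lemma slow_limit_extreme: obtains K where "K \<ge> 0" "index V (slow_limit (- K)) = 0" "card BF \<le> index V (slow_limit (K + 1))"
proof -
  have BFB: "BF \<subseteq> B" by (rule Un_upper1)
  have finBF: "finite BF" using fin by simp
  have sV: "span BF \<subseteq> V" using span_mono[OF BFB] unfolding basis(2) .
  obtain K where K: "K \<ge> 0" "\<And>x. x \<in> span BF \<Longrightarrow> \<bar>Re (q x x)\<bar> \<le> K * Re (m x x)"
    using form_dominated[OF fin_dim_span[OF finBF] hermitian_on_subset[OF q_herm sV] hermitian_on_subset[OF m_herm sV] m_pos]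
    by blast
  have "index V (slow_limit (- K)) \<le> card ({} :: nat set)"
  proof (rule index_le_functionals[where \<phi> = "\<lambda>_ _. 0", OF V_fin_dim slow_limit_herm])
    fix x assume x: "x \<in> V"
    show "0 \<le> Re (slow_limit (- K) x x)"
      unfolding slow_limit_self using A_nonneg[OF x] K(2)[OF proj_span[OF BFB x]] by simp
  qed auto
  moreover have "card BF \<le> index V (slow_limit (K + 1))"
  proof (rule index_ge_kernel_span[OF subset_refl slow_limit_herm])
    fix x assume x: "x \<in> V" "x \<noteq> 0" "proj BF x = x" "Re (A 0 x x) = 0"
    have s: "x \<in> span BF" using proj_span[OF BFB x(1)] x(3) by simp
    have "Re (q x x) \<le> K * Re (m x x)" using K(2)[OF s] by simp
    also have "\<dots> < (K + 1) * Re (m x x)" using m_pos[OF s x(2)] by simp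
    finally show "Re (slow_limit (K + 1) x x) < 0" unfolding slow_limit_self x(3) using x(4) by simp
  qed
  ultimately show ?thesis using that[OF K(1)] by simp
qed

text \<open>
  The limit of \<open>perturbed \<epsilon> (c * \<epsilon>\<^sup>2)\<close> when the vectors of \<open>B0\<close> are rescaled by \<open>1 / \<epsilon>\<close> and those of
  \<open>Bm \<union> Bp\<close> by \<open>1 / sqrt \<epsilon>\<close>.  The terms with \<open>B0 \<union> Bw\<close> and with \<open>Bw\<close> together give the coupling
  \<open>2 Re q(k, w)\<close> between the \<open>B0\<close>-component \<open>k\<close> and the \<open>Bw\<close>-component \<open>w\<close> of a vector, since \<open>q\<close>
  vanishes on \<open>B0\<close>; it survives because the factor \<open>1 / \<epsilon>\<close> cancels the \<open>\<epsilon>\<close> in front of \<open>q\<close>.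
  Minimising over \<open>w\<close> gives the second order term of perturbation theory.
\<close>

definition exotic_limit :: "real \<Rightarrow> 'v \<Rightarrow> 'v \<Rightarrow> complex" where
  "exotic_limit c x y = A 0 x y + (q (proj (Bm \<union> Bp) x) (proj (Bm \<union> Bp) y) + (q (proj (B0 \<union> Bw) x) (proj (B0 \<union> Bw) y)
     + (of_real (- 1) * q (proj Bw x) (proj Bw y) + of_real (- c) * m (proj B0 x) (proj B0 y))))"

lemma sub_B: "Bm \<union> Bp \<subseteq> B" "B0 \<union> Bw \<subseteq> B" "Bw \<subseteq> B" "B0 \<subseteq> B" "BF \<subseteq> B"
  by auto

lemma exotic_limit_herm: "hermitian_on V (exotic_limit c)"
  unfolding exotic_limit_def[abs_def]
  by (rule hermitian_on_plus[OF A_herm hermitian_on_plus[OF proj_herm[OF q_herm sub_B(1)] hermitian_on_plus[OF proj_herm[OF q_herm sub_B(2)]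
     hermitian_on_plus[OF hermitian_on_real_scale[OF proj_herm[OF q_herm sub_B(3)]] hermitian_on_real_scale[OF proj_herm[OF m_herm sub_B(4)]]]]]])

lemma zero_args: "x \<in> V \<Longrightarrow> q x 0 = 0" "x \<in> V \<Longrightarrow> q 0 x = 0" "x \<in> V \<Longrightarrow> m x 0 = 0" "x \<in> V \<Longrightarrow> m 0 x = 0"
  using hermitian_on_scale_right[OF q_herm, of x 0 0] hermitian_on_scale_right[OF m_herm, of x 0 0]
    hermitian_on_cnj[OF q_herm, of x 0] hermitian_on_cnj[OF m_herm, of x 0] subspace_0[OF V_sub] by auto

lemma exotic_limit_basis:
  assumes "b \<in> B" "b' \<in> B"
  shows "exotic_limit c b b' = A 0 b b' + (if b \<in> Bm \<union> Bp \<and> b' \<in> Bm \<union> Bp then q b b' else 0)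
    + (if b \<in> B0 \<union> Bw \<and> b' \<in> B0 \<union> Bw then q b b' else 0) - (if b \<in> Bw \<and> b' \<in> Bw then q b b' else 0)
    - of_real c * (if b \<in> B0 \<and> b' \<in> B0 then m b b' else 0)"
  unfolding exotic_limit_def proj_basis[OF assms(1)] proj_basis[OF assms(2)]
  using zero_args[OF B_sub[OF assms(1)]] zero_args[OF B_sub[OF assms(2)]] q_zero m_zero by simp

text \<open>
  With weights \<open>1/\<epsilon>\<close>, \<open>1/sqrt \<epsilon>\<close> and \<open>1\<close> on \<open>B0\<close>, \<open>Bm \<union> Bp\<close> and \<open>Bw\<close>, each of the six types of matrix
  entries is checked against the expansion \<open>A (c * \<epsilon>\<^sup>2) b \<approx> - c \<epsilon>\<^sup>2 m b\<close> of the kernel rows.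
\<close>

lemma index_squeezed_exotic_limit:
  "\<forall>\<^sub>F \<epsilon> in at_right 0. index V (exotic_limit c) \<le> index V (perturbed \<epsilon> (c * \<epsilon>\<^sup>2)) \<and>
      index V (perturbed \<epsilon> (c * \<epsilon>\<^sup>2)) \<le> index V (exotic_limit c) + nullity V (exotic_limit c)"
proof -
  define w where "w \<epsilon> b = (if b \<in> B0 then 1 / \<epsilon> else if b \<in> Bm \<union> Bp then 1 / sqrt \<epsilon> else 1)" for \<epsilon> :: real and b
  have pos: "\<forall>\<^sub>F \<epsilon> in at_right 0. \<epsilon> > (0::real)" by (simp add: eventually_at_right_less)
  then have nz: "\<forall>\<^sub>F \<epsilon> in at_right 0. \<epsilon>\<^sup>2 \<noteq> (0::real)" by eventually_elim auto
  have id0: "((\<lambda>\<epsilon>. \<epsilon>) \<longlongrightarrow> (0::real)) (at_right 0)" by (rule tendsto_ident_at)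
  have id0c: "((\<lambda>\<epsilon>. complex_of_real \<epsilon>) \<longlongrightarrow> 0) (at_right 0)" using tendsto_of_real[OF id0] by simp
  have id2: "((\<lambda>\<epsilon>. \<epsilon>\<^sup>2) \<longlongrightarrow> (0::real)) (at_right 0)" by (rule tendsto_eq_intros id0 refl | simp)+
  have sq0: "((\<lambda>\<epsilon>. complex_of_real (sqrt \<epsilon>)) \<longlongrightarrow> 0) (at_right 0)"
    by (rule tendsto_eq_intros id0 refl | simp)+
  have sl: "((\<lambda>\<epsilon>. A (c * \<epsilon>\<^sup>2) b b' / of_real (\<epsilon>\<^sup>2)) \<longlongrightarrow> - of_real c * m b b') (at_right 0)"
    if "b \<in> BF" "b' \<in> V" for b b' by (rule slope[OF that id2 nz])
  have B0m: "b \<notin> Bm \<union> Bp" "b \<notin> Bw" "b \<in> BF" "b \<in> B" if "b \<in> B0" for b using that disj by auto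
  have Bmp: "b \<notin> B0" "b \<notin> Bw" "b \<in> BF" "b \<in> B" if "b \<in> Bm \<union> Bp" for b using that disj by auto
  have Bww: "b \<notin> B0" "b \<notin> Bm \<union> Bp" "b \<notin> BF" "b \<in> B" if "b \<in> Bw" for b using that disj by auto
  let ?L = "\<lambda>b b'. ((\<lambda>\<epsilon>. of_real (w \<epsilon> b * w \<epsilon> b') * perturbed \<epsilon> (c * \<epsilon>\<^sup>2) b b') \<longlongrightarrow> exotic_limit c b b') (at_right 0)"
  have KK: "?L b b'" if b: "b \<in> B0" "b' \<in> B0" for b b'
  proof -
    have q0: "q b b' = 0" using q_orth[of b b'] q_diag(2)[of b] b by (cases "b = b'") auto
    have bV: "b' \<in> V" using B_sub B0m(4) b(2) by blast
    have "\<forall>\<^sub>F \<epsilon> in at_right 0. A (c * \<epsilon>\<^sup>2) b b' / of_real (\<epsilon>\<^sup>2) = of_real (w \<epsilon> b * w \<epsilon> b') * perturbed \<epsilon> (c * \<epsilon>\<^sup>2) b b'"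
      using pos
    proof eventually_elim
      case (elim \<epsilon>)
      have ww: "w \<epsilon> b * w \<epsilon> b' = 1 / \<epsilon>\<^sup>2" using b by (simp add: w_def power2_eq_square)
      show ?case unfolding ww perturbed_def q0 by simp
    qed
    moreover have "exotic_limit c b b' = - of_real c * m b b'"
      unfolding exotic_limit_basis[OF B0m(4)[OF b(1)] B0m(4)[OF b(2)]] using A_0[OF B0m(3)[OF b(1)] bV] b B0m(1)[OF b(1)] B0m(2)[OF b(1)] q0 by simp
    ultimately show ?thesis using sl[OF B0m(3)[OF b(1)] bV] by (simp add: tendsto_cong)
  qed
  have KY: "?L b b'" if b: "b \<in> B0" "b' \<in> Bm \<union> Bp" for b b'
  proof -
    have q0: "q b b' = 0" using q_orth[of b b'] b Bmp(1,3)[of b'] B0m(3)[of b] by blast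
    have bV: "b' \<in> V" using B_sub Bmp(4) b(2) by blast
    have "((\<lambda>\<epsilon>. of_real (sqrt \<epsilon>) * (A (c * \<epsilon>\<^sup>2) b b' / of_real (\<epsilon>\<^sup>2))) \<longlongrightarrow> 0 * (- of_real c * m b b')) (at_right 0)"
      by (intro tendsto_mult sq0 sl[OF B0m(3)[OF b(1)] bV])
    moreover have "\<forall>\<^sub>F \<epsilon> in at_right 0. of_real (sqrt \<epsilon>) * (A (c * \<epsilon>\<^sup>2) b b' / of_real (\<epsilon>\<^sup>2)) = of_real (w \<epsilon> b * w \<epsilon> b') * perturbed \<epsilon> (c * \<epsilon>\<^sup>2) b b'"
      using pos
    proof eventually_elim
      case (elim \<epsilon>)
      have "w \<epsilon> b * w \<epsilon> b' = 1 / \<epsilon> * (1 / sqrt \<epsilon>)" using b Bmp(1)[OF b(2)] by (simp add: w_def)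
      also have "1 / sqrt \<epsilon> = sqrt \<epsilon> / \<epsilon>" using elim by (simp add: real_div_sqrt field_simps)
      finally have ww: "w \<epsilon> b * w \<epsilon> b' = sqrt \<epsilon> / \<epsilon>\<^sup>2" by (simp add: power2_eq_square)
      show ?case unfolding ww perturbed_def q0 by simp
    qed
    moreover have "exotic_limit c b b' = 0"
      unfolding exotic_limit_basis[OF B0m(4)[OF b(1)] Bmp(4)[OF b(2)]]
      using A_0[OF B0m(3)[OF b(1)] bV] B0m(1,2)[OF b(1)] Bmp(1,2)[OF b(2)] by simp
    ultimately show ?thesis by (simp add: tendsto_cong)
  qed
  have KW: "?L b b'" if b: "b \<in> B0" "b' \<in> Bw" for b b'
  proof -
    have bV: "b' \<in> V" using B_sub Bww(4) b(2) by blast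
    have "((\<lambda>\<epsilon>. of_real \<epsilon> * (A (c * \<epsilon>\<^sup>2) b b' / of_real (\<epsilon>\<^sup>2)) + q b b') \<longlongrightarrow> 0 * (- of_real c * m b b') + q b b') (at_right 0)"
      by (intro tendsto_add tendsto_mult id0c sl[OF B0m(3)[OF b(1)] bV] tendsto_const)
    moreover have "\<forall>\<^sub>F \<epsilon> in at_right 0. of_real \<epsilon> * (A (c * \<epsilon>\<^sup>2) b b' / of_real (\<epsilon>\<^sup>2)) + q b b' = of_real (w \<epsilon> b * w \<epsilon> b') * perturbed \<epsilon> (c * \<epsilon>\<^sup>2) b b'"
      using pos
    proof eventually_elim
      case (elim \<epsilon>)
      have ww: "w \<epsilon> b * w \<epsilon> b' = 1 / \<epsilon>" using b(1) Bww(1,2)[OF b(2)] by (simp add: w_def)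
      show ?case unfolding ww perturbed_def using elim by (simp add: field_simps power2_eq_square)
    qed
    moreover have "exotic_limit c b b' = q b b'"
      unfolding exotic_limit_basis[OF B0m(4)[OF b(1)] Bww(4)[OF b(2)]]
      using A_0[OF B0m(3)[OF b(1)] bV] b B0m(1,2)[OF b(1)] Bww(1,2)[OF b(2)] by simp
    ultimately show ?thesis by (simp add: tendsto_cong)
  qed
  have YY: "?L b b'" if b: "b \<in> Bm \<union> Bp" "b' \<in> Bm \<union> Bp" for b b'
  proof -
    have bV: "b' \<in> V" using B_sub Bmp(4) b(2) by blast
    have "((\<lambda>\<epsilon>. of_real \<epsilon> * (A (c * \<epsilon>\<^sup>2) b b' / of_real (\<epsilon>\<^sup>2)) + q b b') \<longlongrightarrow> 0 * (- of_real c * m b b') + q b b') (at_right 0)"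
      by (intro tendsto_add tendsto_mult id0c sl[OF Bmp(3)[OF b(1)] bV] tendsto_const)
    moreover have "\<forall>\<^sub>F \<epsilon> in at_right 0. of_real \<epsilon> * (A (c * \<epsilon>\<^sup>2) b b' / of_real (\<epsilon>\<^sup>2)) + q b b' = of_real (w \<epsilon> b * w \<epsilon> b') * perturbed \<epsilon> (c * \<epsilon>\<^sup>2) b b'"
      using pos
    proof eventually_elim
      case (elim \<epsilon>)
      have "w \<epsilon> b * w \<epsilon> b' = 1 / sqrt \<epsilon> * (1 / sqrt \<epsilon>)" using b Bmp(1) by (simp add: w_def)
      then have ww: "w \<epsilon> b * w \<epsilon> b' = 1 / \<epsilon>" using elim by simp
      show ?case unfolding ww perturbed_def using elim by (simp add: field_simps power2_eq_square)
    qed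
    moreover have "exotic_limit c b b' = q b b'"
      unfolding exotic_limit_basis[OF Bmp(4)[OF b(1)] Bmp(4)[OF b(2)]]
      using A_0[OF Bmp(3)[OF b(1)] bV] b Bmp(1,2)[OF b(1)] by simp
    ultimately show ?thesis by (simp add: tendsto_cong)
  qed
  have YW: "?L b b'" if b: "b \<in> Bm \<union> Bp" "b' \<in> Bw" for b b'
  proof -
    have bV: "b' \<in> V" using B_sub Bww(4) b(2) by blast
    have "((\<lambda>\<epsilon>. of_real (sqrt \<epsilon>) * (of_real \<epsilon> * (A (c * \<epsilon>\<^sup>2) b b' / of_real (\<epsilon>\<^sup>2)) + q b b')) \<longlongrightarrow> 0 * (0 * (- of_real c * m b b') + q b b')) (at_right 0)"
      by (intro tendsto_add tendsto_mult id0c sq0 sl[OF Bmp(3)[OF b(1)] bV] tendsto_const)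
    moreover have "\<forall>\<^sub>F \<epsilon> in at_right 0. of_real (sqrt \<epsilon>) * (of_real \<epsilon> * (A (c * \<epsilon>\<^sup>2) b b' / of_real (\<epsilon>\<^sup>2)) + q b b') = of_real (w \<epsilon> b * w \<epsilon> b') * perturbed \<epsilon> (c * \<epsilon>\<^sup>2) b b'"
      using pos
    proof eventually_elim
      case (elim \<epsilon>)
      have "w \<epsilon> b * w \<epsilon> b' = 1 / sqrt \<epsilon>" using b(1) Bmp(1)[OF b(1)] Bww(1,2)[OF b(2)] by (simp add: w_def)
      also have "1 / sqrt \<epsilon> = sqrt \<epsilon> / \<epsilon>" using elim by (simp add: real_div_sqrt field_simps)
      finally have ww: "w \<epsilon> b * w \<epsilon> b' = sqrt \<epsilon> / \<epsilon>" .
      show ?case unfolding ww perturbed_def using elim by (simp add: field_simps power2_eq_square)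
    qed
    moreover have "exotic_limit c b b' = 0"
      unfolding exotic_limit_basis[OF Bmp(4)[OF b(1)] Bww(4)[OF b(2)]]
      using A_0[OF Bmp(3)[OF b(1)] bV] Bmp(1,2)[OF b(1)] Bww(1,2)[OF b(2)] by simp
    ultimately show ?thesis by (simp add: tendsto_cong)
  qed
  have WW: "?L b b'" if b: "b \<in> Bw" "b' \<in> Bw" for b b'
  proof -
    have bV: "b \<in> V" "b' \<in> V" using b B_sub by blast+
    have id2': "((\<lambda>\<epsilon>. c * \<epsilon>\<^sup>2) \<longlongrightarrow> 0) (at_right 0)" using tendsto_mult_right_zero[OF id2] .
    have "((\<lambda>\<epsilon>. A (c * \<epsilon>\<^sup>2) b b' + of_real \<epsilon> * q b b') \<longlongrightarrow> A 0 b b' + 0 * q b b') (at_right 0)"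
      by (intro tendsto_add A_lim'[OF bV id2'] tendsto_mult id0c tendsto_const)
    moreover have "exotic_limit c b b' = A 0 b b'"
      unfolding exotic_limit_basis[OF Bww(4)[OF b(1)] Bww(4)[OF b(2)]]
      using b Bww(1,2)[OF b(1)] Bww(1,2)[OF b(2)] by simp
    ultimately show ?thesis using Bww(1,2)[OF b(1)] Bww(1,2)[OF b(2)] by (simp add: w_def perturbed_def)
  qed
  note sym = weighted_symmetric[OF B_sub B_sub exotic_limit_herm perturbed_herm]
  show ?thesis
  proof (rule index_semicontinuous_weighted[OF B_fin basis, where w = w and Q = "\<lambda>\<epsilon>. perturbed \<epsilon> (c * \<epsilon>\<^sup>2)"])
    show "\<forall>\<^sub>F \<epsilon> in at_right 0. \<forall>b\<in>B. w \<epsilon> b \<noteq> 0" using pos by eventually_elim (auto simp: w_def)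
    show "hermitian_on V (exotic_limit c)" by (rule exotic_limit_herm)
    fix b b' assume b: "b \<in> B" "b' \<in> B"
    then consider "b \<in> B0" "b' \<in> B0" | "b \<in> B0" "b' \<in> Bm \<union> Bp" | "b \<in> B0" "b' \<in> Bw"
      | "b \<in> Bm \<union> Bp" "b' \<in> B0" | "b \<in> Bm \<union> Bp" "b' \<in> Bm \<union> Bp" | "b \<in> Bm \<union> Bp" "b' \<in> Bw"
      | "b \<in> Bw" "b' \<in> B0" | "b \<in> Bw" "b' \<in> Bm \<union> Bp" | "b \<in> Bw" "b' \<in> Bw" by blast
    then show "?L b b'"
    proof cases
      case 1 then show ?thesis by (rule KK)
    next case 2 then show ?thesis by (rule KY)
    next case 3 then show ?thesis by (rule KW)
    next case 4 show ?thesis by (rule sym[OF b(2,1) KY[OF 4(2,1)]])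
    next case 5 then show ?thesis by (rule YY)
    next case 6 then show ?thesis by (rule YW)
    next case 7 show ?thesis by (rule sym[OF b(2,1) KW[OF 7(2,1)]])
    next case 8 show ?thesis by (rule sym[OF b(2,1) YW[OF 8(2,1)]])
    next case 9 then show ?thesis by (rule WW)
    qed
  qed (simp add: perturbed_herm)
qed

lemma exotic_limit_self: "Re (exotic_limit c x x) = Re (A 0 x x) + Re (q (proj (Bm \<union> Bp) x) (proj (Bm \<union> Bp) x))
   + (Re (q (proj (B0 \<union> Bw) x) (proj (B0 \<union> Bw) x)) - Re (q (proj Bw x) (proj Bw x))) - c * Re (m (proj B0 x) (proj B0 x))"
  by (simp add: exotic_limit_def)

lemma proj_B0_Bw: "x \<in> V \<Longrightarrow> proj (B0 \<union> Bw) x = proj B0 x + proj Bw x"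
  using disj by (intro proj_Un) auto

lemma proj_B0_span: "x \<in> V \<Longrightarrow> proj B0 x \<in> span BF"
  using proj_span[of B0 x] span_mono[of B0 BF] by auto

text \<open>
  Suppose that a radical vector had no \<open>B0\<close>-component.  Testing against \<open>Bm \<union> Bp\<close>, where \<open>q\<close> is
  nondegenerate, removes that component as well, and what remains is a null vector of \<open>A 0\<close> inside
  the span of \<open>Bw\<close>, hence zero.
\<close>

lemma exotic_limit_jumps_on: "jumps_on UNIV (\<lambda>c. index V (exotic_limit c)) (\<lambda>c. nullity V (exotic_limit c))"
proof (rule index_jumps_on[OF V_fin_dim])
  show "((\<lambda>s. exotic_limit s x y) \<longlongrightarrow> exotic_limit t x y) (at t)" for t x y
    unfolding exotic_limit_def by (intro tendsto_intros)
  fix s t :: real and x assume st: "s < t"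
  show "Re (exotic_limit t x x) \<le> Re (exotic_limit s x x)" if "x \<in> V"
    unfolding exotic_limit_self using st m_BF_nonneg[OF proj_B0_span[OF that]] by (simp add: mult_right_mono)
  assume x: "x \<in> radical V (exotic_limit s)" "x \<noteq> 0"
  then have xV: "x \<in> V" by (simp add: radical_def)
  have "proj B0 x \<noteq> 0"
  proof
    assume p: "proj B0 x = 0"
    have co0: "coord b x = 0" if "b \<in> B0" for b by (rule proj_eq_0_co[OF sub_B(4) xV p that])
    have coY: "coord b x = 0" if b: "b \<in> Bm \<union> Bp" for b
    proof -
      have bB: "b \<in> B" and bV: "b \<in> V" using b B_sub by auto
      have nb: "b \<notin> B0" "b \<notin> Bw" using b disj by auto
      have "0 = exotic_limit s b x" using x(1) bV by (simp add: radical_def)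
      also have "\<dots> = q b (proj (Bm \<union> Bp) x)"
        unfolding exotic_limit_def proj_basis[OF bB] using b nb A_0[of b x] xV zero_args proj_V[OF sub_B(1) xV] proj_V[OF sub_B(2) xV] proj_V[OF sub_B(3) xV] proj_V[OF sub_B(4) xV]
        by auto
      also have "\<dots> = q (\<Sum>c\<in>{b}. 1 *c c) (\<Sum>c\<in>Bm \<union> Bp. coord c x *c c)"
        unfolding proj_sum[OF sub_B(1) xV] by simp
      also have "\<dots> = (\<Sum>c\<in>{b} \<inter> (Bm \<union> Bp). cnj 1 * coord c x * q c c)"
        by (rule q_on_BF) (use b in auto)
      also have "{b} \<inter> (Bm \<union> Bp) = {b}" using b by auto
      finally have "coord b x * q b b = 0" by simp
      moreover have "q b b \<noteq> 0" using b q_diag by auto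
      ultimately show ?thesis by simp
    qed
    have "proj (Bm \<union> Bp) x = 0" by (rule proj_zero_co[OF sub_B(1) xV coY])
    then have "Re (exotic_limit s x x) = Re (A 0 x x)" unfolding exotic_limit_self proj_B0_Bw[OF xV] p using q_zero m_zero by simp
    then have "Re (A 0 x x) = 0" using radical_self[OF x(1)] by simp
    then have "proj BF x = x" by (rule A0_zero_iff(1)[OF xV])
    moreover have "proj BF x = 0" using co0 coY by (intro proj_zero_co[OF sub_B(5) xV]) auto
    ultimately show False using x(2) by simp
  qed
  then have "Re (m (proj B0 x) (proj B0 x)) > 0" using m_pos proj_B0_span[OF xV] by blast
  then show "Re (exotic_limit t x x) < Re (exotic_limit s x x)" unfolding exotic_limit_self using st by simp
qed (auto intro: exotic_limit_herm)

text \<open>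
  On the span of \<open>Bm \<union> B0\<close> the coupling to \<open>Bw\<close> drops out, and both remaining terms are negative as
  soon as \<open>c > 0\<close>.  This is the reason why the exotic eigenvalues have nonpositive limits.
\<close>

lemma exotic_limit_index_positive:
  assumes "c > 0" shows "card Bm + card B0 \<le> index V (exotic_limit c)"
proof -
  have "card (Bm \<union> B0) \<le> index V (exotic_limit c)"
  proof (rule index_ge_kernel_span[OF _ exotic_limit_herm])
    fix x assume x: "x \<in> V" "x \<noteq> 0" "\<And>b. b \<in> B - (Bm \<union> B0) \<Longrightarrow> coord b x = 0" "Re (A 0 x x) = 0"
    have w: "proj Bw x = 0" by (rule A0_zero_iff(2)[OF x(1,4)])
    have k: "Re (q (proj B0 x) (proj B0 x)) = 0"
    proof -
      have "B0 \<inter> Bp = {}" "B0 \<inter> Bm = {}" using disj by auto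
      moreover have "Re (q (proj B0 x) (proj B0 x)) = (\<Sum>b\<in>B0 \<inter> Bp. (cmod (coord b x))\<^sup>2) - (\<Sum>b\<in>B0 \<inter> Bm. (cmod (coord b x))\<^sup>2)"
        by (rule q_self[OF _ x(1)]) auto
      ultimately show ?thesis by simp
    qed
    have y: "Re (q (proj (Bm \<union> Bp) x) (proj (Bm \<union> Bp) x)) = - (\<Sum>b\<in>Bm. (cmod (coord b x))\<^sup>2)"
    proof -
      have "Re (q (proj (Bm \<union> Bp) x) (proj (Bm \<union> Bp) x)) = (\<Sum>b\<in>(Bm \<union> Bp) \<inter> Bp. (cmod (coord b x))\<^sup>2) - (\<Sum>b\<in>(Bm \<union> Bp) \<inter> Bm. (cmod (coord b x))\<^sup>2)"
        by (rule q_self[OF _ x(1)]) auto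
      also have "(\<Sum>b\<in>(Bm \<union> Bp) \<inter> Bp. (cmod (coord b x))\<^sup>2) = 0"
        using x(3) disj by (intro sum.neutral) auto
      also have "(Bm \<union> Bp) \<inter> Bm = Bm" by auto
      finally show ?thesis by simp
    qed
    have eq: "Re (exotic_limit c x x) = - (\<Sum>b\<in>Bm. (cmod (coord b x))\<^sup>2) - c * Re (m (proj B0 x) (proj B0 x))"
      unfolding exotic_limit_self proj_B0_Bw[OF x(1)] w y using k x(4) q_zero by simp
    have m0: "0 \<le> Re (m (proj B0 x) (proj B0 x))" by (rule m_BF_nonneg[OF proj_B0_span[OF x(1)]])
    have s0: "0 \<le> (\<Sum>b\<in>Bm. (cmod (coord b x))\<^sup>2)" by (simp add: sum_nonneg)
    show "Re (exotic_limit c x x) < 0"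
    proof (cases "proj B0 x = 0")
      case False
      then have "Re (m (proj B0 x) (proj B0 x)) > 0" using m_pos proj_B0_span[OF x(1)] by blast
      then have "c * Re (m (proj B0 x) (proj B0 x)) > 0" using assms by simp
      then show ?thesis using eq s0 by linarith
    next
      case True
      have "\<exists>b\<in>Bm. coord b x \<noteq> 0"
      proof (rule ccontr)
        assume no: "\<not> ?thesis"
        have "coord b x = 0" if "b \<in> B" for b
          using no x(3)[of b] proj_eq_0_co[OF sub_B(4) x(1) True, of b] that by blast
        then show False using coord_all_zero[OF x(1)] x(2) by blast
      qed
      then obtain b where "b \<in> Bm" "coord b x \<noteq> 0" by blast
      then have "0 < (\<Sum>b\<in>Bm. (cmod (coord b x))\<^sup>2)" using fin(1) by (intro sum_pos2) auto
      moreover have "0 \<le> c * Re (m (proj B0 x) (proj B0 x))" using m0 assms by simp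
      ultimately show ?thesis using eq by linarith
    qed
  qed auto
  then show ?thesis using fin disj(1) by (simp add: card_Un_disjoint)
qed

text \<open>
  A bound with some factor in front of \<open>A 0\<close> holds by finite dimension.  The factor is brought
  below \<open>1\<close> by scaling: replacing \<open>(k, w)\<close> by \<open>(t k, w / t)\<close> leaves the cross term \<open>2 Re q(k, w)\<close>
  unchanged but divides the \<open>A 0\<close>-part by \<open>t\<^sup>2\<close>.
\<close>

lemma cross_term_dominated:
  obtains C where "\<And>x. x \<in> V \<Longrightarrow>
    \<bar>Re (q (proj (B0 \<union> Bw) x) (proj (B0 \<union> Bw) x)) - Re (q (proj Bw x) (proj Bw x))\<bar> \<le> Re (A 0 x x) + C * Re (m (proj B0 x) (proj B0 x))"
proof -
  define g where "g x y = q (proj (B0 \<union> Bw) x) (proj (B0 \<union> Bw) y) + of_real (- 1) * q (proj Bw x) (proj Bw y)" for x y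
  define P where "P x y = A 0 x y + m (proj B0 x) (proj B0 y)" for x y
  have gh: "hermitian_on V g" unfolding g_def[abs_def]
    by (rule hermitian_on_plus[OF proj_herm[OF q_herm sub_B(2)] hermitian_on_real_scale[OF proj_herm[OF q_herm sub_B(3)]]])
  have Ph: "hermitian_on V P" unfolding P_def[abs_def]
    by (rule hermitian_on_plus[OF A_herm proj_herm[OF m_herm sub_B(4)]])
  let ?W = "span (B0 \<union> Bw)"
  have WV: "?W \<subseteq> V" using span_mono[OF sub_B(2)] unfolding basis(2) .
  have Ppos: "Re (P x x) > 0" if x: "x \<in> ?W" "x \<noteq> 0" for x
  proof (rule ccontr)
    assume neg: "\<not> Re (P x x) > 0"
    have xV: "x \<in> V" using x WV by blast
    have "0 \<le> Re (A 0 x x)" "0 \<le> Re (m (proj B0 x) (proj B0 x))"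
      using A_nonneg[OF xV] m_BF_nonneg[OF proj_B0_span[OF xV]] by auto
    then have z: "Re (A 0 x x) = 0" "Re (m (proj B0 x) (proj B0 x)) = 0" using neg by (auto simp: P_def)
    then have "proj B0 x = 0" using m_pos[OF proj_B0_span[OF xV]] by force
    moreover have "x = proj B0 x + proj Bw x" using proj_id[OF sub_B(2) x(1)] proj_B0_Bw[OF xV] by simp
    ultimately show False using A0_zero_iff(2)[OF xV z(1)] x(2) by simp
  qed
  have fW: "finite (B0 \<union> Bw)" using fin by simp
  obtain K where K: "K \<ge> 0" "\<And>x. x \<in> ?W \<Longrightarrow> \<bar>Re (g x x)\<bar> \<le> K * Re (P x x)"
    using form_dominated[OF fin_dim_span[OF fW] hermitian_on_subset[OF gh WV] hermitian_on_subset[OF Ph WV] Ppos] by blast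
  define t where "t = sqrt (K + 1)"
  have t: "t > 0" "t\<^sup>2 = K + 1" using K(1) by (simp_all add: t_def)
  show ?thesis
  proof (rule that)
    fix x assume x: "x \<in> V"
    define k w where "k = proj B0 x" and "w = proj Bw x"
    have kV: "k \<in> V" and wV: "w \<in> V" unfolding k_def w_def by (rule proj_V[OF sub_B(4) x], rule proj_V[OF sub_B(3) x])
    have kB: "k \<in> span BF" unfolding k_def by (rule proj_B0_span[OF x])
    (* the scaled vector t k + w / t *)
    define a b where "a = of_real t *c k" and "b = of_real (1 / t) *c w"
    have aV: "a \<in> V" and bV: "b \<in> V" unfolding a_def b_def using kV wV V_sub by (auto intro: subspace_scale)
    have ks: "k \<in> span B0" and ws: "w \<in> span Bw" unfolding k_def w_def by (rule proj_span[OF sub_B(4) x], rule proj_span[OF sub_B(3) x])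
    have as: "a \<in> span B0" and bs: "b \<in> span Bw" unfolding a_def b_def using ks ws by (auto intro: span_scale)
    have d: "B0 \<inter> Bw = {}" "Bw \<inter> B0 = {}" using disj by auto
    have prab: "proj B0 (a + b) = a" "proj Bw (a + b) = b"
      unfolding self.linear_add[OF proj_linear]
      using proj_id[OF sub_B(4) as] proj_id[OF sub_B(3) bs] proj_zero[OF sub_B(4,3) d(1) bs] proj_zero[OF sub_B(3,4) d(2) as] by simp_all
    have abV: "a + b \<in> V" using aV bV V_sub by (simp add: subspace_add)
    have abW: "a + b \<in> ?W" using as bs span_mono[of B0 "B0 \<union> Bw"] span_mono[of Bw "B0 \<union> Bw"] by (auto intro!: span_add)
    have qkk: "Re (q k k) = 0"
    proof -
      have "B0 \<inter> Bp = {}" "B0 \<inter> Bm = {}" using disj by auto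
      moreover have "Re (q k k) = (\<Sum>b\<in>B0 \<inter> Bp. (cmod (coord b x))\<^sup>2) - (\<Sum>b\<in>B0 \<inter> Bm. (cmod (coord b x))\<^sup>2)"
        unfolding k_def by (rule q_self[OF _ x]) auto
      ultimately show ?thesis by simp
    qed
    have expand: "Re (q (u + v) (u + v)) - Re (q v v) = Re (q u u) + 2 * Re (q u v)" if "u \<in> V" "v \<in> V" for u v
    proof -
      have "q (u + v) (u + v) = q u u + q u v + (q v u + q v v)"
        using that V_sub by (simp add: hermitian_on_add_left[OF q_herm] hermitian_on_add_right[OF q_herm] subspace_add)
      moreover have "Re (q v u) = Re (q u v)" using hermitian_on_cnj[OF q_herm that] by simp
      ultimately show ?thesis by simp
    qed
    have "q a b = of_real (t * (1 / t)) * q k w"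
      unfolding a_def b_def using kV wV V_sub
      by (simp add: hermitian_on_scale_left[OF q_herm] hermitian_on_scale_right[OF q_herm] subspace_scale)
    then have qab: "q a b = q k w" using t(1) by simp
    have "q a a = of_real (t * t) * q k k"
      unfolding a_def using kV V_sub
      by (simp add: hermitian_on_scale_left[OF q_herm] hermitian_on_scale_right[OF q_herm] subspace_scale)
    then have qaa: "Re (q a a) = 0" using qkk by simp
    have "Re (g (a + b) (a + b)) = 2 * Re (q k w)"
      using expand[OF aV bV] qaa qab unfolding g_def proj_B0_Bw[OF abV] prab by simp
    also have "\<dots> = Re (q (proj (B0 \<union> Bw) x) (proj (B0 \<union> Bw) x)) - Re (q (proj Bw x) (proj Bw x))"
      using expand[OF kV wV] qkk unfolding proj_B0_Bw[OF x] k_def w_def by simp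
    finally have geq: "Re (g (a + b) (a + b)) = \<dots>" .
    have aB: "a \<in> span BF" unfolding a_def using kB by (rule span_scale)
    have "A 0 (a + b) (a + b) = A 0 b b"
      using A0_BF[OF aB abV] A0_BF[OF aB bV] hermitian_on_add_left[OF A_herm V_sub aV bV abV, of 0] hermitian_on_add_right[OF A_herm bV aV bV, of 0] by simp
    also have "\<dots> = of_real (1 / t * (1 / t)) * A 0 w w"
      unfolding b_def using wV V_sub
      by (simp add: hermitian_on_scale_left[OF A_herm] hermitian_on_scale_right[OF A_herm] subspace_scale)
    finally have Aab: "Re (A 0 (a + b) (a + b)) = Re (A 0 w w) / (K + 1)" using t by (simp add: power2_eq_square)
    have "m a a = of_real (t * t) * m k k"
      unfolding a_def using kV V_sub
      by (simp add: hermitian_on_scale_left[OF m_herm] hermitian_on_scale_right[OF m_herm] subspace_scale)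
    then have maa: "Re (m a a) = (K + 1) * Re (m k k)" using t by (simp add: power2_eq_square)
    define f where "f = proj BF x"
    have fB: "f \<in> span BF" and fV: "f \<in> V" unfolding f_def by (rule proj_span[OF sub_B(5) x], rule proj_V[OF sub_B(5) x])
    have "x = f + w" unfolding f_def w_def using proj_Un[OF sub_B(5,3) disj(3) x] proj_B[OF x] by simp
    then have Axx: "A 0 x x = A 0 w w"
      using A0_BF[OF fB x] A0_BF[OF fB wV] hermitian_on_add_left[OF A_herm V_sub fV wV x, of 0] hermitian_on_add_right[OF A_herm wV fV wV, of 0] by simp
    have Aw: "0 \<le> Re (A 0 w w)" by (rule A_nonneg[OF wV])
    have "\<bar>Re (g (a + b) (a + b))\<bar> \<le> K * (Re (A 0 w w) / (K + 1) + (K + 1) * Re (m k k))"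
      using K(2)[OF abW] Aab maa unfolding P_def prab by simp
    also have "\<dots> = K / (K + 1) * Re (A 0 w w) + K * (K + 1) * Re (m k k)" by (simp add: algebra_simps)
    also have "\<dots> \<le> 1 * Re (A 0 w w) + K * (K + 1) * Re (m k k)"
      using Aw K(1) by (intro add_right_mono mult_right_mono) auto
    finally show "\<bar>Re (q (proj (B0 \<union> Bw) x) (proj (B0 \<union> Bw) x)) - Re (q (proj Bw x) (proj Bw x))\<bar> \<le> Re (A 0 x x) + K * (K + 1) * Re (m (proj B0 x) (proj B0 x))"
      unfolding geq Axx k_def by simp
  qed
qed

lemma exotic_limit_index_lower: obtains a where "index V (exotic_limit a) \<le> card Bm"
proof -
  obtain C where C: "\<And>x. x \<in> V \<Longrightarrow>
    \<bar>Re (q (proj (B0 \<union> Bw) x) (proj (B0 \<union> Bw) x)) - Re (q (proj Bw x) (proj Bw x))\<bar> \<le> Re (A 0 x x) + C * Re (m (proj B0 x) (proj B0 x))"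
    using cross_term_dominated by blast
  have "index V (exotic_limit (- C)) \<le> card Bm"
  proof (rule index_le_functionals[OF V_fin_dim exotic_limit_herm fin(1), where \<phi> = coord])
    fix x assume x: "x \<in> V" "\<And>b. b \<in> Bm \<Longrightarrow> coord b x = 0"
    have "Re (q (proj (Bm \<union> Bp) x) (proj (Bm \<union> Bp) x)) = (\<Sum>b\<in>(Bm \<union> Bp) \<inter> Bp. (cmod (coord b x))\<^sup>2) - (\<Sum>b\<in>(Bm \<union> Bp) \<inter> Bm. (cmod (coord b x))\<^sup>2)"
      by (rule q_self[OF _ x(1)]) auto
    also have "(\<Sum>b\<in>(Bm \<union> Bp) \<inter> Bm. (cmod (coord b x))\<^sup>2) = 0" using x(2) by (intro sum.neutral) auto
    finally have "0 \<le> Re (q (proj (Bm \<union> Bp) x) (proj (Bm \<union> Bp) x))" by (simp add: sum_nonneg)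
    then show "0 \<le> Re (exotic_limit (- C) x x)" unfolding exotic_limit_self using C[OF x(1)] by linarith
  qed (rule coord_functional)
  then show ?thesis by (rule that)
qed

end

section \<open>Trigonometric functions of the spectral parameter\<close>

text \<open>
  The solutions of \<open>u'' = - \<nu> u\<close> with initial data \<open>(1, 0)\<close> and \<open>(0, 1)\<close>; the case distinction
  continues \<open>cos (sqrt \<nu> x)\<close> and \<open>sin (sqrt \<nu> x) / sqrt \<nu>\<close> analytically to \<open>\<nu> \<le> 0\<close>.
\<close>

definition cs :: "real \<Rightarrow> real \<Rightarrow> real" where
  "cs \<nu> x = (if \<nu> \<ge> 0 then cos (sqrt \<nu> * x) else cosh (sqrt (- \<nu>) * x))"

definition sn :: "real \<Rightarrow> real \<Rightarrow> real" where
  "sn \<nu> x = (if \<nu> = 0 then x else if \<nu> > 0 then sin (sqrt \<nu> * x) / sqrt \<nu>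
     else sinh (sqrt (- \<nu>) * x) / sqrt (- \<nu>))"

lemma cs_sn_cases:
  obtains "\<nu> = 0" "cs \<nu> = (\<lambda>x. 1)" "sn \<nu> = (\<lambda>x. x)"
  | k where "k > 0" "\<nu> = k\<^sup>2" "cs \<nu> = (\<lambda>x. cos (k * x))" "sn \<nu> = (\<lambda>x. sin (k * x) / k)"
  | k where "k > 0" "\<nu> = - k\<^sup>2" "cs \<nu> = (\<lambda>x. cosh (k * x))" "sn \<nu> = (\<lambda>x. sinh (k * x) / k)"
proof -
  consider "\<nu> = 0" | "\<nu> > 0" | "\<nu> < 0" by linarith
  then show ?thesis
  proof cases
    case 1
    then show ?thesis by (intro that(1)) (auto simp: cs_def sn_def)
  next
    case 2
    then show ?thesis by (intro that(2)[of "sqrt \<nu>"]) (auto simp: cs_def sn_def)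
  next
    case 3
    then show ?thesis by (intro that(3)[of "sqrt (- \<nu>)"]) (auto simp: cs_def sn_def)
  qed
qed

lemma cs_has_derivative: "(cs \<nu> has_real_derivative - \<nu> * sn \<nu> x) (at x within A)"
  by (cases rule: cs_sn_cases[of \<nu>])
    (auto intro!: derivative_eq_intros simp: power2_eq_square)

lemma sn_has_derivative: "(sn \<nu> has_real_derivative cs \<nu> x) (at x within A)"
  by (cases rule: cs_sn_cases[of \<nu>])
    (auto intro!: derivative_eq_intros simp: power2_eq_square)

lemma cs_sn_0 [simp]: "cs \<nu> 0 = 1" "sn \<nu> 0 = 0" "cs 0 x = 1" "sn 0 x = x"
  by (auto simp: cs_def sn_def)

lemma cs_sn_pythagoras: "(cs \<nu> x)\<^sup>2 + \<nu> * (sn \<nu> x)\<^sup>2 = 1"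
  by (cases rule: cs_sn_cases[of \<nu>]) (auto simp: power_divide cosh_square_eq)

lemma cs_add: "cs \<nu> (x + y) = cs \<nu> x * cs \<nu> y - \<nu> * sn \<nu> x * sn \<nu> y"
  by (cases rule: cs_sn_cases[of \<nu>])
    (auto simp: cos_add cosh_add ring_distribs power2_eq_square)

lemma sn_add: "sn \<nu> (x + y) = sn \<nu> x * cs \<nu> y + cs \<nu> x * sn \<nu> y"
  by (cases rule: cs_sn_cases[of \<nu>])
    (auto simp: sin_add sinh_add ring_distribs add_divide_distrib)

lemma
  assumes "h > 0"
  shows cs_rescale: "cs \<nu> h = cs (\<nu> * h\<^sup>2) 1" and sn_rescale: "sn \<nu> h = h * sn (\<nu> * h\<^sup>2) 1"
proof -
  have "sqrt (- (\<nu> * h\<^sup>2)) = sqrt (- \<nu> * h\<^sup>2)" by simp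
  also have "\<dots> = sqrt (- \<nu>) * h" unfolding real_sqrt_mult using assms by simp
  finally have "sqrt (- (\<nu> * h\<^sup>2)) = sqrt (- \<nu>) * h" .
  moreover have "sqrt (\<nu> * h\<^sup>2) = sqrt \<nu> * h" unfolding real_sqrt_mult using assms by simp
  moreover have "\<nu> * h\<^sup>2 \<ge> 0 \<longleftrightarrow> \<nu> \<ge> 0" "\<nu> * h\<^sup>2 = 0 \<longleftrightarrow> \<nu> = 0" "\<nu> * h\<^sup>2 > 0 \<longleftrightarrow> \<nu> > 0"
    using assms by (auto simp: zero_le_mult_iff zero_less_mult_iff)
  ultimately show "cs \<nu> h = cs (\<nu> * h\<^sup>2) 1" "sn \<nu> h = h * sn (\<nu> * h\<^sup>2) 1"
    using assms by (simp_all add: cs_def sn_def)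
qed

lemma sqrt_less_pi_half: "s < pi\<^sup>2 / 4 \<Longrightarrow> sqrt s < pi / 2"
  by (rule real_less_lsqrt) (auto simp: power_divide)

lemma cs_pos:
  assumes "s < pi\<^sup>2 / 4"
  shows "cs s 1 > 0"
proof (cases "s \<ge> 0")
  case True
  then have "- (pi / 2) < sqrt s" using real_sqrt_ge_zero[OF True] pi_gt_zero by linarith
  then have "cos (sqrt s) > 0" using sqrt_less_pi_half[OF assms] by (intro cos_gt_zero_pi)
  then show ?thesis using True by (simp add: cs_def)
qed (simp add: cs_def)

lemma sn_pos: "s < pi\<^sup>2 / 4 \<Longrightarrow> sn s 1 > 0"
  using sqrt_less_pi_half[of s] sin_gt_zero[of "sqrt s"] pi_gt_zero
  by (simp add: sn_def)

text \<open>
  The functions \<open>sqrt s * cot (sqrt s)\<close> and \<open>sqrt s * tan (sqrt s)\<close>, continued to \<open>s \<le> 0\<close>.  On an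
  interval of length \<open>2 h\<close> with \<open>\<nu> h\<^sup>2 = s\<close>, the energy \<open>\<integral> \<bar>f'\<bar>\<^sup>2 - \<nu> \<bar>f\<bar>\<^sup>2\<close> of the solution with end
  values \<open>-1, 1\<close> is \<open>(2 / h) rcot s\<close>, and that of the solution with end values \<open>1, 1\<close> is \<open>- (2 / h) rtan s\<close>.
\<close>

definition rcot :: "real \<Rightarrow> real" where "rcot s = cs s 1 / sn s 1"
definition rtan :: "real \<Rightarrow> real" where "rtan s = s * sn s 1 / cs s 1"

lemma rcot_rtan_0 [simp]: "rcot 0 = 1" "rtan 0 = 0"
  by (simp_all add: rcot_def rtan_def)

text \<open>
  The identity \<open>2 cot x = cot (x / 2) - tan (x / 2)\<close>.  It reduces the monotonicity of
  \<open>rcot\<close> to that of \<open>rtan\<close>, whose derivative is visibly positive.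
\<close>

lemma rcot_duplication:
  assumes "s < pi\<^sup>2 / 4"
  shows "rcot s = rcot (s / 4) - rtan (s / 4)"
proof -
  have "s / 4 < pi\<^sup>2 / 4" using assms by (cases "s \<ge> 0") (auto intro: order.strict_trans1[of _ 0])
  then have pos: "cs (s / 4) 1 > 0" "sn (s / 4) 1 > 0" by (auto intro: cs_pos sn_pos)
  have half: "cs s (1/2) = cs (s / 4) 1" "sn s (1/2) = sn (s / 4) 1 / 2"
    using cs_rescale[of "1/2" s] sn_rescale[of "1/2" s] by (simp_all add: power2_eq_square)
  have "cs s 1 = (cs (s/4) 1)\<^sup>2 - s / 4 * (sn (s/4) 1)\<^sup>2" "sn s 1 = sn (s/4) 1 * cs (s/4) 1"
    using cs_add[of s "1/2" "1/2"] sn_add[of s "1/2" "1/2"] by (simp_all add: half power2_eq_square)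
  then show ?thesis using pos by (simp add: rcot_def rtan_def field_simps power2_eq_square)
qed

lemma isCont_cs_1: "isCont (\<lambda>s. cs s 1) s"
proof -
  have "continuous_on ({0..} \<union> {..0}) (\<lambda>s. if 0 \<le> s then cos (sqrt s * 1) else cosh (sqrt (- s) * 1))"
    by (intro continuous_on_cases) (auto intro!: continuous_intros)
  then have "continuous_on ({0..} \<union> {..0}) (\<lambda>s. cs s 1)" by (simp add: cs_def)
  moreover have "{0..} \<union> {..0} = (UNIV :: real set)" by auto
  ultimately show ?thesis by (simp add: continuous_on_eq_continuous_at)
qed

lemma isCont_sn_1: "isCont (\<lambda>s. sn s 1) s"
proof -
  consider "s = 0" | "s > 0" | "s < 0" by linarith
  then show ?thesis
  proof cases
    case 1
    have "((\<lambda>h. sin h / h) \<longlongrightarrow> 1) (at (0::real))" "((\<lambda>h. sinh h / h) \<longlongrightarrow> 1) (at (0::real))"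
      using DERIV_sin[of "0::real"] has_field_derivative_sinh[OF DERIV_ident, of "0::real" UNIV]
      by (simp_all add: DERIV_def)
    moreover have "filterlim sqrt (at 0) (at_right 0)" "filterlim (\<lambda>s. sqrt (- s)) (at 0) (at_left 0)"
      by (auto simp: filterlim_at eventually_at_filter intro!: tendsto_eq_intros)
    ultimately have "((\<lambda>s. sin (sqrt s) / sqrt s) \<longlongrightarrow> 1) (at_right 0)"
      "((\<lambda>s. sinh (sqrt (- s)) / sqrt (- s)) \<longlongrightarrow> 1) (at_left 0)"
      using filterlim_compose by blast+
    moreover have "\<forall>\<^sub>F s in at_right 0. sn s 1 = sin (sqrt s) / sqrt s"
      "\<forall>\<^sub>F s in at_left 0. sn s 1 = sinh (sqrt (- s)) / sqrt (- s)"
      by (auto simp: eventually_at_filter sn_def)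
    ultimately have "((\<lambda>s. sn s 1) \<longlongrightarrow> 1) (at_right 0)" "((\<lambda>s. sn s 1) \<longlongrightarrow> 1) (at_left 0)"
      by (simp_all add: tendsto_cong)
    then show ?thesis using 1 by (simp add: isCont_def filterlim_split_at)
  next
    case 2
    have "isCont (\<lambda>s. sin (sqrt s) / sqrt s) s" using 2 by (auto intro!: continuous_intros)
    moreover have "\<forall>\<^sub>F r in nhds s. sn r 1 = sin (sqrt r) / sqrt r"
      using eventually_nhds_in_open[of "{0<..}" s] 2
      by (auto elim!: eventually_mono simp: sn_def)
    ultimately show ?thesis by (simp add: isCont_cong)
  next
    case 3
    have "isCont (\<lambda>s. sinh (sqrt (- s)) / sqrt (- s)) s" using 3 by (auto intro!: continuous_intros)
    moreover have "\<forall>\<^sub>F r in nhds s. sn r 1 = sinh (sqrt (- r)) / sqrt (- r)"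
      using eventually_nhds_in_open[of "{..<0}" s] 3
      by (auto elim!: eventually_mono simp: sn_def)
    ultimately show ?thesis by (simp add: isCont_cong)
  qed
qed

lemma isCont_rtan: "s < pi\<^sup>2 / 4 \<Longrightarrow> isCont rtan s"
  unfolding rtan_def[abs_def] using cs_pos[of s] by (intro continuous_intros isCont_cs_1 isCont_sn_1) auto

lemma isCont_rcot: "s < pi\<^sup>2 / 4 \<Longrightarrow> isCont rcot s"
  unfolding rcot_def[abs_def] using sn_pos[of s] by (intro continuous_intros isCont_cs_1 isCont_sn_1) auto

lemma rtan_over_tendsto: "((\<lambda>s. rtan s / s) \<longlongrightarrow> 1) (at 0)"
proof -
  have "isCont (\<lambda>s. sn s 1 / cs s 1) 0" by (intro continuous_intros isCont_cs_1 isCont_sn_1) auto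
  then have "((\<lambda>s. sn s 1 / cs s 1) \<longlongrightarrow> 1) (at 0)" by (simp add: isCont_def)
  moreover have "\<forall>\<^sub>F s in at 0. rtan s / s = sn s 1 / cs s 1"
    by (auto simp: eventually_at_filter rtan_def)
  ultimately show ?thesis by (simp add: tendsto_cong)
qed

lemma rtan_pos_eq:
  assumes "r > 0" shows "rtan r = sqrt r * tan (sqrt r)"
proof -
  have "rtan r = (r / sqrt r) * tan (sqrt r)"
    using assms by (simp add: rtan_def sn_def cs_def tan_def)
  then show ?thesis using assms by (simp only: real_div_sqrt[OF less_imp_le])
qed

lemma rtan_neg_eq:
  assumes "r < 0" shows "rtan r = - (sqrt (- r) * tanh (sqrt (- r)))"
proof -
  have "rtan r = - ((- r / sqrt (- r)) * tanh (sqrt (- r)))"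
    using assms by (simp add: rtan_def sn_def cs_def tanh_def)
  moreover have "- r / sqrt (- r) = sqrt (- r)"
    using assms by (intro real_div_sqrt) simp
  ultimately show ?thesis by (simp only:)
qed

lemma rtan_has_derivative:
  assumes "s < pi\<^sup>2 / 4" "s \<noteq> 0"
  shows "(rtan has_real_derivative (sn s 1 / cs s 1 + 1 / (cs s 1)\<^sup>2) / 2) (at s)"
proof (cases "s > 0")
  case True
  have k: "sqrt s > 0" "sqrt s < pi / 2" using True sqrt_less_pi_half[OF assms(1)] by auto
  have c: "cos (sqrt s) > 0" using cs_pos[OF assms(1)] True by (simp add: cs_def)
  have "((\<lambda>s. sqrt s * tan (sqrt s)) has_real_derivative
      (tan (sqrt s) / sqrt s + 1 / (cos (sqrt s))\<^sup>2) / 2) (at s)"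
    using True c k by (auto intro!: derivative_eq_intros simp: field_simps)
  moreover have "\<forall>\<^sub>F r in nhds s. rtan r = sqrt r * tan (sqrt r)"
    using eventually_nhds_in_open[of "{0<..}" s] True
    by (auto elim!: eventually_mono simp: rtan_pos_eq)
  ultimately show ?thesis
    using True by (subst DERIV_cong_ev[OF refl _ refl]) (simp_all add: sn_def cs_def tan_def divide_simps mult_ac)
next
  case False
  then have neg: "s < 0" using assms by simp
  have c: "cosh (sqrt (- s)) > 0" by simp
  have "((\<lambda>s. - (sqrt (- s) * tanh (sqrt (- s)))) has_real_derivative
      (tanh (sqrt (- s)) / sqrt (- s) + (1 - (tanh (sqrt (- s)))\<^sup>2)) / 2) (at s)"
    using neg by (auto intro!: derivative_eq_intros simp: field_simps)
  moreover have "\<forall>\<^sub>F r in nhds s. rtan r = - (sqrt (- r) * tanh (sqrt (- r)))"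
    using eventually_nhds_in_open[of "{..<0}" s] neg
    by (auto elim!: eventually_mono simp: rtan_neg_eq)
  moreover have "1 - (tanh (sqrt (- s)))\<^sup>2 = 1 / (cosh (sqrt (- s)))\<^sup>2"
    using c hyperbolic_pythagoras[of "sqrt (- s)"] by (simp add: tanh_def power_divide diff_divide_eq_iff)
  ultimately show ?thesis
    using neg by (subst DERIV_cong_ev[OF refl _ refl]) (simp_all add: sn_def cs_def tanh_def divide_simps mult_ac)
qed

text \<open>
  The derivative is at least \<open>1 / (2 (cs s 1)\<^sup>2)\<close>.  The point \<open>0\<close>, where the two explicit formulas
  meet, is covered by continuity.
\<close>

lemma rtan_increasing:
  assumes "A \<le> s" "s \<le> t" "t < pi\<^sup>2 / 4"
  defines "c \<equiv> 1 / (2 * (cosh (sqrt \<bar>A\<bar>))\<^sup>2)"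
  shows "c * (t - s) \<le> rtan t - rtan s"
proof -
  have der: "\<exists>y. ((\<lambda>r. rtan r - c * r) has_real_derivative y) (at r) \<and> 0 \<le> y"
    if r: "s \<le> r" "r \<le> t" "r \<noteq> 0" for r
  proof (intro exI conjI)
    have rp: "r < pi\<^sup>2 / 4" using r assms by simp
    show "((\<lambda>r. rtan r - c * r) has_real_derivative
       (sn r 1 / cs r 1 + 1 / (cs r 1)\<^sup>2) / 2 - c * 1) (at r)"
      by (intro DERIV_diff rtan_has_derivative DERIV_cmult DERIV_ident rp r)
    have "cs r 1 \<le> cosh (sqrt \<bar>A\<bar>)"
    proof (cases "r \<ge> 0")
      case True
      have "cs r 1 \<le> 1" using True by (simp add: cs_def)
      also have "1 \<le> cosh (sqrt \<bar>A\<bar>)" by (rule cosh_real_ge_1)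
      finally show ?thesis .
    next
      case False
      then have "sqrt (- r) \<le> sqrt \<bar>A\<bar>" using r assms by simp
      then show ?thesis using False by (simp add: cs_def cosh_real_nonneg_le_iff)
    qed
    then have "(cs r 1)\<^sup>2 \<le> (cosh (sqrt \<bar>A\<bar>))\<^sup>2" using cs_pos[OF rp] by (intro power_mono) auto
    then have "c \<le> 1 / (cs r 1)\<^sup>2 / 2" unfolding c_def using cs_pos[OF rp] by (simp add: frac_le)
    moreover have "0 \<le> sn r 1 / cs r 1" using cs_pos[OF rp] sn_pos[OF rp] by simp
    ultimately show "0 \<le> (sn r 1 / cs r 1 + 1 / (cs r 1)\<^sup>2) / 2 - c * 1" by simp
  qed
  have inc: "rtan a - c * a \<le> rtan b - c * b"
    if ab: "s \<le> a" "a \<le> b" "b \<le> t" "0 \<notin> {a<..<b}" for a b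
  proof (rule DERIV_nonneg_imp_increasing_open[OF ab(2)])
    show "\<exists>y. ((\<lambda>r. rtan r - c * r) has_real_derivative y) (at r) \<and> 0 \<le> y" if "a < r" "r < b" for r
      using that ab by (intro der) auto
    show "continuous_on {a..b} (\<lambda>r. rtan r - c * r)"
      using ab assms(3) by (intro continuous_at_imp_continuous_on ballI continuous_intros isCont_rtan) auto
  qed
  have "rtan s - c * s \<le> rtan t - c * t"
  proof (cases "s < 0 \<and> 0 < t")
    case True
    then show ?thesis using inc[of s 0] inc[of 0 t] by simp
  next
    case False
    then show ?thesis using inc[of s t] assms by auto
  qed
  then show ?thesis by (simp add: algebra_simps)
qed

text \<open>
  Iterating the duplication formula, the difference at \<open>s, t\<close> is at least the difference at
  \<open>s / 4\<^sup>n, t / 4\<^sup>n\<close>, which tends to \<open>0\<close>.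
\<close>

lemma rcot_antimono:
  assumes "s \<le> t" "t < pi\<^sup>2 / 4"
  shows "rcot t \<le> rcot s"
proof -
  have small: "r / 4 ^ n < pi\<^sup>2 / 4" if "r < pi\<^sup>2 / 4" for r :: real and n :: nat
  proof (cases "r \<ge> 0")
    case True
    then have "r / 4 ^ n \<le> r / 1" by (intro divide_left_mono) auto
    also have "r / 1 < pi\<^sup>2 / 4" using that by simp
    finally show ?thesis .
  next
    case False
    then have "r / 4 ^ n \<le> 0" by (simp add: divide_le_0_iff)
    then show ?thesis by (rule order.strict_trans1) simp
  qed
  have "rcot (s / 4 ^ n) - rcot (t / 4 ^ n) \<le> rcot s - rcot t" for n :: nat
  proof (induction n)
    case (Suc n)
    let ?s = "s / 4 ^ n" and ?t = "t / 4 ^ n"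
    have lt: "?s < pi\<^sup>2 / 4" "?t < pi\<^sup>2 / 4" using assms small by auto
    have "?s / 4 \<le> ?t / 4" "?t / 4 < pi\<^sup>2 / 4"
      using assms small[of t "Suc n"] by (auto simp: divide_right_mono mult_ac)
    then have "0 \<le> rtan (?t / 4) - rtan (?s / 4)"
      by (intro order_trans[OF _ rtan_increasing[of "?s / 4" "?s / 4" "?t / 4"]]) auto
    then have "rcot (?s / 4) - rcot (?t / 4) \<le> rcot ?s - rcot ?t"
      unfolding rcot_duplication[OF lt(1)] rcot_duplication[OF lt(2)] by simp
    then show ?case using Suc by (simp add: mult_ac)
  qed simp
  moreover have "(\<lambda>n. rcot (s / 4 ^ n) - rcot (t / 4 ^ n)) \<longlonglongrightarrow> rcot 0 - rcot 0"
  proof (intro tendsto_diff)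
    have "(\<lambda>n. r / 4 ^ n) \<longlonglongrightarrow> 0" for r :: real
      by (rule LIMSEQ_divide_realpow_zero) simp
    then show "(\<lambda>n. rcot (s / 4 ^ n)) \<longlonglongrightarrow> rcot 0" "(\<lambda>n. rcot (t / 4 ^ n)) \<longlonglongrightarrow> rcot 0"
      using isCont_tendsto_compose[OF isCont_rcot[of 0]] by auto
  qed
  ultimately have "rcot 0 - rcot 0 \<le> rcot s - rcot t"
    by (intro LIMSEQ_le_const2[of _ "rcot 0 - rcot 0"]) auto
  then show ?thesis by simp
qed

lemma rcot_rtan_rate:
  obtains c where "c > 0" "\<And>s t. A \<le> s \<Longrightarrow> s \<le> t \<Longrightarrow> t < pi\<^sup>2 / 4 \<Longrightarrow> c * (t - s) \<le> rtan t - rtan s"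
    "\<And>s t. A \<le> s \<Longrightarrow> s \<le> t \<Longrightarrow> t < pi\<^sup>2 / 4 \<Longrightarrow> c * (t - s) \<le> rcot s - rcot t"
proof -
  define c1 where "c1 = 1 / (2 * (cosh (sqrt \<bar>A\<bar>))\<^sup>2)"
  define c2 where "c2 = 1 / (2 * (cosh (sqrt \<bar>A / 4\<bar>))\<^sup>2) / 4"
  have pos: "c1 > 0" "c2 > 0" by (simp_all add: c1_def c2_def)
  show ?thesis
  proof (rule that[of "min c1 c2"])
    fix s t assume st: "A \<le> s" "s \<le> t" "t < pi\<^sup>2 / 4"
    have "min c1 c2 * (t - s) \<le> c1 * (t - s)" using st by (intro mult_right_mono) auto
    also have "\<dots> \<le> rtan t - rtan s" unfolding c1_def by (rule rtan_increasing[OF st])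
    finally show "min c1 c2 * (t - s) \<le> rtan t - rtan s" .
    have "t / 4 < pi\<^sup>2 / 4" "s < pi\<^sup>2 / 4" using st by (cases "t \<ge> 0"; auto intro: order.strict_trans1[of _ 0])+
    note st' = this
    have "min c1 c2 * (t - s) \<le> c2 * (t - s)" using st by (intro mult_right_mono) auto
    also have "\<dots> \<le> rtan (t / 4) - rtan (s / 4)"
      unfolding c2_def using rtan_increasing[of "A / 4" "s / 4" "t / 4"] st st' by (simp add: field_simps)
    also have "\<dots> \<le> rcot s - rcot t"
      unfolding rcot_duplication[OF st(3)] rcot_duplication[OF st'(2)]
      using rcot_antimono[of "s / 4" "t / 4"] st st' by simp
    finally show "min c1 c2 * (t - s) \<le> rcot s - rcot t" .
  qed (use pos in auto)
qed

lemma rcot_rtan_at_bot: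
  obtains A where "A < 0" "\<And>s. s \<le> A \<Longrightarrow> K \<le> rcot s \<and> rtan s \<le> - K"
proof -
  define M where "M = (K / tanh 1)\<^sup>2"
  have M: "M \<ge> 0" by (simp add: M_def)
  define A where "A = - (5 + 4 * M)"
  have t1: "tanh (1::real) > 0" by simp
  have rt: "rtan s \<le> - K" if "s \<le> A / 4" for s
  proof -
    define k where "k = sqrt (- s)"
    have s: "s < 0" "- s \<ge> 1" "- s \<ge> M" using that M by (auto simp: A_def)
    have "k \<ge> 1" using s by (simp add: k_def)
    have "k \<ge> K / tanh 1" unfolding k_def using s(3) real_le_rsqrt unfolding M_def by blast
    then have "K \<le> k * tanh 1" using t1 by (simp add: field_simps)
    also have "\<dots> \<le> k * tanh k" using \<open>k \<ge> 1\<close> by (intro mult_left_mono) (auto simp: tanh_real_le_iff)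
    also have "\<dots> = - rtan s" using s(1)
      by (simp add: k_def rtan_neg_eq)
    finally show ?thesis by simp
  qed
  have A: "A < 0" using M by (simp add: A_def)
  have "K \<le> rcot s \<and> rtan s \<le> - K" if "s \<le> A" for s
  proof
    have s: "s < 0" "s \<le> A / 4" using that A by auto
    then have "s < pi\<^sup>2 / 4" "s / 4 < pi\<^sup>2 / 4" by (auto intro: order.strict_trans1[of _ 0])
    then have "rcot (s / 4) \<ge> rcot 0" using s by (intro rcot_antimono) auto
    moreover have "rtan (s / 4) \<le> - K" using that by (intro rt) auto
    ultimately show "K \<le> rcot s" using rcot_duplication[OF \<open>s < pi\<^sup>2 / 4\<close>] by simp
    show "rtan s \<le> - K" using s by (intro rt)
  qed
  with A show ?thesis by (rule that)
qed

lemma rcot_less_rtan: "rcot ((pi / 3)\<^sup>2) < rtan ((pi / 3)\<^sup>2)"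
proof -
  have "rcot ((pi / 3)\<^sup>2) = pi / 3 / sqrt 3"
    by (simp add: rcot_def cs_def sn_def cos_60 sin_60 real_sqrt_divide)
  also have "\<dots> < pi / 3 * sqrt 3" by (simp add: field_simps)
  also have "\<dots> = rtan ((pi / 3)\<^sup>2)"
    by (simp add: rtan_def cs_def sn_def cos_60 sin_60 real_sqrt_divide power2_eq_square)
  finally show ?thesis .
qed

section \<open>Solutions of the eigenvalue equation on an edge\<close>

text \<open>
  The equation \<open>- f'' = z f\<close> as a first order system with \<open>g = f'\<close>, for functions that are extended by
  zero outside \<open>{0..L}\<close>.
\<close>

definition solves_ode :: "real \<Rightarrow> complex \<Rightarrow> (real \<Rightarrow> complex) \<Rightarrow> (real \<Rightarrow> complex) \<Rightarrow> bool" where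
  "solves_ode L z f g \<longleftrightarrow>
     (\<forall>x. x \<notin> {0..L} \<longrightarrow> f x = 0) \<and>
     (\<forall>x\<in>{0..L}. (f has_vector_derivative g x) (at x within {0..L}) \<and>
        (g has_vector_derivative - (z * f x)) (at x within {0..L}))"

lemma edge_deriv_eqI:
  assumes "L > 0" "x \<in> {0..L}" "(f has_vector_derivative d) (at x within {0..L})"
  shows "edge_deriv L f x = d"
  unfolding edge_deriv_def using assms
  by (intro vector_derivative_within_cbox[of 0 L, unfolded cbox_interval]) auto

text \<open>
  Regularity: \<open>f\<close> is differentiable, hence continuous, so \<open>f'\<close> is the integral of a continuous
  function and therefore differentiable everywhere.
\<close>

lemma eigenfunction_solves_ode:
  assumes L: "L > 0" and H: "has_H2_second_deriv L f (\<lambda>x. - (z * f x))"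
  shows "solves_ode L z f (edge_deriv L f)"
proof -
  have diff: "f differentiable (at x within {0..L})" if "x \<in> {0..L}" for x
    using H that unfolding has_H2_second_deriv_def by blast
  then have der: "(f has_vector_derivative edge_deriv L f x) (at x within {0..L})" if "x \<in> {0..L}" for x
    using that unfolding edge_deriv_def by (simp add: vector_derivative_works)
  have cont: "continuous_on {0..L} (\<lambda>t. - (z * f t))"
    using diff by (auto intro!: continuous_intros differentiable_imp_continuous_on simp: differentiable_on_def)
  have eq: "edge_deriv L f x = edge_deriv L f 0 + integral {0..x} (\<lambda>t. - (z * f t))" if x: "x \<in> {0..L}" for x
  proof -
    have "(\<lambda>t. - (z * f t)) absolutely_integrable_on {0..x}"
      using cont x by (intro absolutely_integrable_continuous_real) (auto elim: continuous_on_subset)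
    then have "(LINT t:{0..x}|lebesgue. - (z * f t)) = integral {0..x} (\<lambda>t. - (z * f t))"
      by (intro set_lebesgue_integral_eq_integral) auto
    moreover have "edge_deriv L f x = edge_deriv L f 0 + (LINT t:{0..x}|lebesgue. - (z * f t))"
      using H x unfolding has_H2_second_deriv_def by blast
    ultimately show ?thesis by (simp only:)
  qed
  have "(edge_deriv L f has_vector_derivative - (z * f x)) (at x within {0..L})" if x: "x \<in> {0..L}" for x
  proof (rule has_vector_derivative_transform[OF x eq])
    show "((\<lambda>x. edge_deriv L f 0 + integral {0..x} (\<lambda>t. - (z * f t))) has_vector_derivative - (z * f x)) (at x within {0..L})"
      using has_vector_derivative_add[OF has_vector_derivative_const integral_has_vector_derivative[OF cont x]]
      by simp
  qed
  moreover have "\<forall>x. x \<notin> {0..L} \<longrightarrow> f x = 0"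
    using H unfolding has_H2_second_deriv_def by blast
  ultimately show ?thesis using der unfolding solves_ode_def by blast
qed

lemma solves_ode_continuous:
  assumes "solves_ode L z f g" shows "continuous_on {0..L} f" "continuous_on {0..L} g"
  using assms unfolding solves_ode_def continuous_on_eq_continuous_within
  by (meson has_vector_derivative_continuous)+

lemma solves_ode_second_deriv:
  assumes L: "L > 0" and S: "solves_ode L z f g"
  shows "has_H2_second_deriv L f (\<lambda>x. - (z * f x))" "\<And>x. x \<in> {0..L} \<Longrightarrow> edge_deriv L f x = g x"
proof -
  show edge: "edge_deriv L f x = g x" if "x \<in> {0..L}" for x
    using L that S by (intro edge_deriv_eqI) (auto simp: solves_ode_def)
  have cont: "continuous_on {0..L} (\<lambda>x. - (z * f x))"
    by (intro continuous_intros solves_ode_continuous[OF S])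
  have sub: "{0<..<L} \<subseteq> {0..L}" by auto
  have "(\<lambda>x. - (z * f x)) \<in> borel_measurable (lebesgue_on {0<..<L})"
    by (intro continuous_imp_measurable_on_sets_lebesgue continuous_on_subset[OF cont sub]) auto
  moreover have "integrable (lebesgue_on {0<..<L}) (\<lambda>x. (cmod (- (z * f x)))\<^sup>2)"
  proof -
    have "(\<lambda>x. (cmod (- (z * f x)))\<^sup>2) absolutely_integrable_on {0..L}"
      by (intro absolutely_integrable_continuous_real continuous_intros continuous_on_norm cont)
    then have "(\<lambda>x. (cmod (- (z * f x)))\<^sup>2) absolutely_integrable_on {0<..<L}"
      by (rule set_integrable_subset) auto
    then show ?thesis by (simp add: integrable_restrict_space set_integrable_def)
  qed
  ultimately have sq: "square_integrable L (\<lambda>x. - (z * f x))" by (simp add: square_integrable_def)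
  have int: "g x = g 0 + (LINT t:{0..x}|lebesgue. - (z * f t))" if x: "x \<in> {0..L}" for x
  proof -
    have "(\<lambda>t. - (z * f t)) absolutely_integrable_on {0..x}"
      using x by (intro absolutely_integrable_continuous_real continuous_on_subset[OF cont]) auto
    then have "(LINT t:{0..x}|lebesgue. - (z * f t)) = integral {0..x} (\<lambda>t. - (z * f t))"
      by (intro set_lebesgue_integral_eq_integral) auto
    also have "((\<lambda>t. - (z * f t)) has_integral (g x - g 0)) {0..x}"
    proof (rule fundamental_theorem_of_calculus)
      fix y assume y: "y \<in> {0..x}"
      then have "(g has_vector_derivative - (z * f y)) (at y within {0..L})"
        using S x by (auto simp: solves_ode_def)
      then show "(g has_vector_derivative - (z * f y)) (at y within {0..x})"
        by (rule has_vector_derivative_within_subset) (use x in auto)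
    qed (use x in auto)
    then have "integral {0..x} (\<lambda>t. - (z * f t)) = g x - g 0" by (rule integral_unique)
    finally show ?thesis by simp
  qed
  show "has_H2_second_deriv L f (\<lambda>x. - (z * f x))"
    unfolding has_H2_second_deriv_def
  proof (intro conjI ballI)
    show "\<forall>x. x \<notin> {0..L} \<longrightarrow> f x = 0" using S by (simp add: solves_ode_def)
    show "square_integrable L (\<lambda>x. - (z * f x))" by (rule sq)
    fix x assume x: "x \<in> {0..L}"
    then have "(f has_vector_derivative g x) (at x within {0..L})"
      using S unfolding solves_ode_def by blast
    then show "f differentiable at x within {0..L}" by (rule differentiableI_vector)
    show "edge_deriv L f x = edge_deriv L f 0 + (LINT t:{0..x}|lebesgue. - (z * f t))"
      using edge[OF x] edge[of 0] int[OF x] L by simp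
  qed
qed

lemma cs_has_vector_derivative:
  "((\<lambda>x. complex_of_real (cs \<nu> x)) has_vector_derivative of_real (- \<nu> * sn \<nu> x)) (at x within A)"
  "((\<lambda>x. complex_of_real (sn \<nu> x)) has_vector_derivative of_real (cs \<nu> x)) (at x within A)"
  using cs_has_derivative sn_has_derivative
  by (auto simp only: has_vector_derivative_of_real has_real_derivative_iff_has_vector_derivative)

lemma solves_ode_real:
  assumes S: "solves_ode L (of_real \<nu>) f g" and x: "x \<in> {0..L}"
  shows "f x = f 0 * of_real (cs \<nu> x) + g 0 * of_real (sn \<nu> x)"
    "g x = g 0 * of_real (cs \<nu> x) - f 0 * of_real \<nu> * of_real (sn \<nu> x)"
proof -
  have df: "(f has_vector_derivative g x) (at x within {0..L})"
    and dg: "(g has_vector_derivative - (of_real \<nu> * f x)) (at x within {0..L})" if "x \<in> {0..L}" for x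
    using S that by (auto simp: solves_ode_def)
  define p where "p x = f x * of_real (cs \<nu> x) - g x * of_real (sn \<nu> x)" for x
  define r where "r x = f x * of_real \<nu> * of_real (sn \<nu> x) + g x * of_real (cs \<nu> x)" for x
  have "(p has_vector_derivative 0) (at x within {0..L})" if "x \<in> {0..L}" for x
    unfolding p_def[abs_def]
    by (rule has_vector_derivative_eq_rhs[OF has_vector_derivative_diff[OF
      has_vector_derivative_mult[OF df[OF that] cs_has_vector_derivative(1)]
      has_vector_derivative_mult[OF dg[OF that] cs_has_vector_derivative(2)]]])
      (simp add: algebra_simps)
  then obtain c where c: "p x = c" if "x \<in> {0..L}" for x
    using has_vector_derivative_zero_constant[of "{0..L}" p] by auto
  have "(r has_vector_derivative 0) (at x within {0..L})" if "x \<in> {0..L}" for x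
    unfolding r_def[abs_def]
    by (rule has_vector_derivative_eq_rhs[OF has_vector_derivative_add[OF
      has_vector_derivative_mult[OF has_vector_derivative_mult[OF df[OF that] has_vector_derivative_const] cs_has_vector_derivative(2)]
      has_vector_derivative_mult[OF dg[OF that] cs_has_vector_derivative(1)]]])
      (simp add: algebra_simps)
  then obtain d where d: "r x = d" if "x \<in> {0..L}" for x
    using has_vector_derivative_zero_constant[of "{0..L}" r] by auto
  have "p x = f 0" "r x = g 0"
    using c[of 0] d[of 0] c[OF x] d[OF x] x by (auto simp: p_def r_def)
  moreover have one: "complex_of_real (cs \<nu> x) * of_real (cs \<nu> x) + of_real \<nu> * (of_real (sn \<nu> x) * of_real (sn \<nu> x)) = 1"
    using cs_sn_pythagoras[of \<nu> x] unfolding power2_eq_square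
    by (metis of_real_1 of_real_add of_real_mult)
  moreover have "f x * (of_real (cs \<nu> x) * of_real (cs \<nu> x) + of_real \<nu> * (of_real (sn \<nu> x) * of_real (sn \<nu> x)))
     = p x * of_real (cs \<nu> x) + r x * of_real (sn \<nu> x)"
    "g x * (of_real (cs \<nu> x) * of_real (cs \<nu> x) + of_real \<nu> * (of_real (sn \<nu> x) * of_real (sn \<nu> x)))
     = r x * of_real (cs \<nu> x) - p x * of_real \<nu> * of_real (sn \<nu> x)"
    by (simp_all add: p_def r_def algebra_simps)
  ultimately show "f x = f 0 * of_real (cs \<nu> x) + g 0 * of_real (sn \<nu> x)"
    "g x = g 0 * of_real (cs \<nu> x) - f 0 * of_real \<nu> * of_real (sn \<nu> x)"
    by simp_all
qed

lemma solves_ode_cs_sn: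
  "solves_ode L (of_real \<nu>)
     (\<lambda>x. if x \<in> {0..L} then a * of_real (cs \<nu> x) + b * of_real (sn \<nu> x) else 0)
     (\<lambda>x. b * of_real (cs \<nu> x) - a * of_real \<nu> * of_real (sn \<nu> x))"
  unfolding solves_ode_def
proof (intro conjI ballI)
  fix x assume x: "x \<in> {0..L}"
  have "((\<lambda>x. a * of_real (cs \<nu> x) + b * of_real (sn \<nu> x)) has_vector_derivative
      b * of_real (cs \<nu> x) - a * of_real \<nu> * of_real (sn \<nu> x)) (at x within {0..L})"
    by (rule has_vector_derivative_eq_rhs[OF has_vector_derivative_add[OF
      has_vector_derivative_mult_right[OF cs_has_vector_derivative(1)]
      has_vector_derivative_mult_right[OF cs_has_vector_derivative(2)]]]) simp
  then show "((\<lambda>x. if x \<in> {0..L} then a * of_real (cs \<nu> x) + b * of_real (sn \<nu> x) else 0) has_vector_derivative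
      b * of_real (cs \<nu> x) - a * of_real \<nu> * of_real (sn \<nu> x)) (at x within {0..L})"
    by (rule has_vector_derivative_transform[OF x, rotated]) simp
  have "((\<lambda>x. b * of_real (cs \<nu> x) - a * of_real \<nu> * of_real (sn \<nu> x)) has_vector_derivative
      - (of_real \<nu> * (a * of_real (cs \<nu> x) + b * of_real (sn \<nu> x)))) (at x within {0..L})"
    by (rule has_vector_derivative_eq_rhs[OF has_vector_derivative_diff[OF
      has_vector_derivative_mult_right[OF cs_has_vector_derivative(1)]
      has_vector_derivative_mult_right[OF cs_has_vector_derivative(2)]]]) (simp add: algebra_simps)
  then show "((\<lambda>x. b * of_real (cs \<nu> x) - a * of_real \<nu> * of_real (sn \<nu> x)) has_vector_derivative
      - (of_real \<nu> * (if x \<in> {0..L} then a * of_real (cs \<nu> x) + b * of_real (sn \<nu> x) else 0))) (at x within {0..L})"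
    using x by simp
qed auto

text \<open>
  Lagrange's identity: the flux \<open>Im (cnj f * f')\<close> has derivative \<open>- Im z * \<bar>f\<bar>\<^sup>2\<close>.  So it is
  monotone, and if it takes the same value at both ends, then \<open>f\<close> vanishes.
\<close>

lemma solves_ode_flux:
  assumes L: "L > 0" and S: "solves_ode L z f g"
  shows "Im z * (Im (cnj (f L) * g L) - Im (cnj (f 0) * g 0)) \<le> 0"
    and "Im z \<noteq> 0 \<Longrightarrow> Im (cnj (f L) * g L) = Im (cnj (f 0) * g 0) \<Longrightarrow> f x = 0"
proof -
  define h where "h x = - (Im z * Im (cnj (f x) * g x))" for x
  have der: "(h has_real_derivative (Im z * cmod (f x))\<^sup>2) (at x within {0..L})" if x: "x \<in> {0..L}" for x
  proof -
    have "(f has_vector_derivative g x) (at x within {0..L})"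
      "(g has_vector_derivative - (z * f x)) (at x within {0..L})"
      using S x by (auto simp: solves_ode_def)
    from has_vector_derivative_mult[OF has_vector_derivative_cnj[OF this(1)] this(2)]
    have "((\<lambda>x. cnj (f x) * g x) has_vector_derivative (cnj (f x) * (- (z * f x)) + cnj (g x) * g x)) (at x within {0..L})" .
    from bounded_linear.has_vector_derivative[OF bounded_linear_Im this]
    have "((\<lambda>x. Im (cnj (f x) * g x)) has_vector_derivative Im (cnj (f x) * (- (z * f x)) + cnj (g x) * g x)) (at x within {0..L})" .
    from has_vector_derivative_minus[OF has_vector_derivative_mult_right[OF this, of "Im z"]]
    have "(h has_vector_derivative - (Im z * Im (cnj (f x) * (- (z * f x)) + cnj (g x) * g x))) (at x within {0..L})"
      unfolding h_def[abs_def] .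
    moreover have "- (Im z * Im (cnj (f x) * (- (z * f x)) + cnj (g x) * g x)) = (Im z * cmod (f x))\<^sup>2"
      unfolding power_mult_distrib cmod_power2 by (simp add: power2_eq_square algebra_simps)
    ultimately show ?thesis by (simp add: has_real_derivative_iff_has_vector_derivative)
  qed
  have mono: "h a \<le> h b" if "0 \<le> a" "a \<le> b" "b \<le> L" for a b
  proof (rule DERIV_nonneg_imp_increasing_open[OF that(2)])
    fix x assume x: "a < x" "x < b"
    then have "at x within {0..L} = at x" using that by (intro at_within_Icc_at) auto
    then have "(h has_real_derivative (Im z * cmod (f x))\<^sup>2) (at x)"
      using der[of x] x that by auto
    then show "\<exists>y. (h has_real_derivative y) (at x) \<and> 0 \<le> y" by fastforce
  next
    have "continuous_on {0..L} h" using der by (rule DERIV_continuous_on)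
    then show "continuous_on {a..b} h" by (rule continuous_on_subset) (use that in auto)
  qed
  show "Im z * (Im (cnj (f L) * g L) - Im (cnj (f 0) * g 0)) \<le> 0"
    using mono[of 0 L] L by (simp add: h_def algebra_simps)
  assume z: "Im z \<noteq> 0" and "Im (cnj (f L) * g L) = Im (cnj (f 0) * g 0)"
  then have const: "h x = h 0" if "x \<in> {0..L}" for x
    using mono[of 0 x] mono[of x L] that by (auto simp: h_def)
  show "f x = 0"
  proof (cases "x \<in> {0..L}")
    case True
    have "(h has_vector_derivative 0) (at x within {0..L})"
      by (rule has_vector_derivative_transform[OF True const has_vector_derivative_const])
    then have "(Im z * cmod (f x))\<^sup>2 = 0"
      using der[OF True] L True
        vector_derivative_unique_within_closed_interval[of 0 L x h "(Im z * cmod (f x))\<^sup>2" 0]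
      by (simp add: has_real_derivative_iff_has_vector_derivative)
    then show ?thesis using z by simp
  qed (use S in \<open>auto simp: solves_ode_def\<close>)
qed

section \<open>Vertex conditions\<close>

lemma hinner_add_right: "hinner G (F + F') = hinner G F + hinner G F'"
  by (simp add: hinner_def sum.distrib ring_distribs)

lemma hinner_scale_right: "hinner G (c *s F) = c * hinner G F"
  by (simp add: hinner_def sum_distrib_left mult_ac)

lemma hinner_zero [simp]: "hinner G 0 = 0" "hinner 0 F = 0"
  by (simp_all add: hinner_def)

lemma hinner_diff_right: "hinner G (F - F') = hinner G F - hinner G F'"
  by (simp add: hinner_def sum_subtractf ring_distribs)

lemma hinner_cnj: "hinner G F = cnj (hinner F G)"
  by (simp add: hinner_def mult_ac)

lemma hinner_self: "hinner F F = of_real (\<Sum>i\<in>UNIV. (cmod (F $ i))\<^sup>2)"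
  by (simp add: hinner_def complex_norm_square mult_ac del: of_real_power)

lemma hinner_self_eq_0: "hinner F F = 0 \<Longrightarrow> F = 0"
  unfolding hinner_self of_real_eq_0_iff by (simp add: sum_nonneg_eq_0_iff vec_eq_iff)

lemma hinner_adjoint: "hinner G (A *v F) = hinner (hermitian_adjoint A *v G) F"
proof -
  have "hinner G (A *v F) = (\<Sum>i\<in>UNIV. \<Sum>j\<in>UNIV. cnj (G $ i) * (A $ i $ j * F $ j))"
    by (simp add: hinner_def matrix_vector_mult_def sum_distrib_left)
  also have "\<dots> = (\<Sum>j\<in>UNIV. \<Sum>i\<in>UNIV. cnj (G $ i) * (A $ i $ j * F $ j))"
    by (rule sum.swap)
  also have "\<dots> = hinner (hermitian_adjoint A *v G) F"
    by (simp add: hinner_def matrix_vector_mult_def hermitian_adjoint_def sum_distrib_right sum_distrib_left mult_ac)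
  finally show ?thesis .
qed

lemma projector_symmetric: "orthogonal_projector P \<Longrightarrow> hinner G (P *v F) = hinner (P *v G) F"
  unfolding orthogonal_projector_def by (metis hinner_adjoint)

lemma projector_idem: "orthogonal_projector P \<Longrightarrow> P *v (P *v F) = P *v F"
  by (simp add: orthogonal_projector_def matrix_vector_mul_assoc)

text \<open>
  For \<open>x = Q F\<close> the three projections satisfy \<open>\<parallel>x\<parallel>\<^sup>2 = \<parallel>P x\<parallel>\<^sup>2 + \<parallel>x\<parallel>\<^sup>2 + \<parallel>R x\<parallel>\<^sup>2\<close>, so \<open>P x = 0\<close>.
\<close>

lemma complementary_projectors_orthogonal:
  assumes P: "orthogonal_projector P" and Q: "orthogonal_projector Q" and R: "orthogonal_projector R"
    and sum: "P + Q + R = mat 1"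
  shows "P *v (Q *v F) = 0"
proof -
  define x where "x = Q *v F"
  have self: "hinner x (S *v x) = hinner (S *v x) (S *v x)" if "orthogonal_projector S" for S
    using projector_symmetric[OF that, of x "S *v x"] projector_idem[OF that] by simp
  have "(P + Q + R) *v x = x" by (simp add: sum)
  then have "x = P *v x + x + R *v x"
    using projector_idem[OF Q, of F] by (simp add: matrix_vector_mult_add_rdistrib x_def)
  then have "hinner x x = hinner x (P *v x) + hinner x x + hinner x (R *v x)"
    by (metis hinner_add_right)
  then have "hinner (P *v x) (P *v x) + hinner (R *v x) (R *v x) = 0"
    using self[OF P] self[OF R] by simp
  then have "(\<Sum>i\<in>UNIV. (cmod ((P *v x) $ i))\<^sup>2) + (\<Sum>i\<in>UNIV. (cmod ((R *v x) $ i))\<^sup>2) = 0"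
    unfolding hinner_self of_real_add[symmetric] of_real_eq_0_iff .
  moreover have "0 \<le> (\<Sum>i\<in>UNIV. (cmod ((R *v x) $ i))\<^sup>2)" "0 \<le> (\<Sum>i\<in>UNIV. (cmod ((P *v x) $ i))\<^sup>2)"
    by (simp_all add: sum_nonneg)
  ultimately have "(\<Sum>i\<in>UNIV. (cmod ((P *v x) $ i))\<^sup>2) = 0" by linarith
  then have "hinner (P *v x) (P *v x) = 0" unfolding hinner_self by simp
  then show ?thesis using hinner_self_eq_0 unfolding x_def by blast
qed

lemma sum_endpoints: "(\<Sum>v\<in>UNIV. h v) = (\<Sum>e\<in>UNIV. h (Inl e) + h (Inr e))" for h :: "'e::finite + 'e \<Rightarrow> 'c::comm_monoid_add"
  unfolding UNIV_Plus_UNIV[symmetric] by (subst sum.Plus) (simp_all add: sum.distrib)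

locale vertex_conditions =
  fixes P\<^sub>D P\<^sub>N P\<^sub>R \<Lambda> :: "complex ^ ('e::finite + 'e) ^ ('e + 'e)"
  assumes projectors: "orthogonal_projector P\<^sub>D" "orthogonal_projector P\<^sub>N" "orthogonal_projector P\<^sub>R"
    and complete: "P\<^sub>D + P\<^sub>N + P\<^sub>R = mat 1"
    and robin: "invertible_selfadjoint_on (range (\<lambda>F. P\<^sub>R *v F)) \<Lambda>"
begin

definition coupling :: "complex ^ ('e + 'e) \<Rightarrow> complex ^ ('e + 'e) \<Rightarrow> complex" where
  "coupling G F = hinner G (P\<^sub>R *v (\<Lambda> *v (P\<^sub>R *v F)))"

lemma decompose: "P\<^sub>D *v F + P\<^sub>N *v F + P\<^sub>R *v F = F"
  using complete by (metis matrix_vector_mul_lid matrix_vector_mult_add_rdistrib)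

lemma orthogonal: "P\<^sub>D *v (P\<^sub>R *v F) = 0" "P\<^sub>D *v (P\<^sub>N *v F) = 0" "P\<^sub>R *v (P\<^sub>N *v F) = 0"
  using complementary_projectors_orthogonal[of P\<^sub>D P\<^sub>R P\<^sub>N] complementary_projectors_orthogonal[of P\<^sub>D P\<^sub>N P\<^sub>R]
    complementary_projectors_orthogonal[of P\<^sub>R P\<^sub>N P\<^sub>D] projectors complete
  by (simp_all add: add_ac)

lemma robin_range: "P\<^sub>R *v (\<Lambda> *v (P\<^sub>R *v F)) = \<Lambda> *v (P\<^sub>R *v F)"
proof -
  have "\<Lambda> *v (P\<^sub>R *v F) \<in> range (\<lambda>F. P\<^sub>R *v F)"
    using robin by (auto simp: invertible_selfadjoint_on_def bij_betw_def)
  then show ?thesis using projector_idem[OF projectors(3)] by auto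
qed

lemma coupling_cnj: "coupling F G = cnj (coupling G F)"
proof -
  have "coupling F G = hinner (P\<^sub>R *v F) (\<Lambda> *v (P\<^sub>R *v G))"
    unfolding coupling_def by (rule projector_symmetric[OF projectors(3)])
  also have "\<dots> = hinner (\<Lambda> *v (P\<^sub>R *v F)) (P\<^sub>R *v G)"
    using robin by (auto simp: invertible_selfadjoint_on_def)
  also have "\<dots> = cnj (hinner (P\<^sub>R *v G) (\<Lambda> *v (P\<^sub>R *v F)))" by (rule hinner_cnj)
  also have "hinner (P\<^sub>R *v G) (\<Lambda> *v (P\<^sub>R *v F)) = coupling G F"
    unfolding coupling_def by (rule projector_symmetric[OF projectors(3), symmetric])
  finally show ?thesis .
qed

lemma coupling_add_right: "coupling G (F + F') = coupling G F + coupling G F'"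
  by (simp add: coupling_def matrix_vector_right_distrib hinner_add_right)

lemma coupling_scale_right: "coupling G (c *s F) = c * coupling G F"
  by (simp add: coupling_def vec.scale hinner_scale_right)

text \<open>
  The Neumann and Robin conditions are the natural boundary conditions of the form: they hold
  iff the boundary term of the integration by parts cancels the coupling against all admissible \<open>G\<close>.
\<close>

lemma natural_conditions_iff:
  "(\<forall>G. P\<^sub>D *v G = 0 \<longrightarrow> hinner G F' = coupling G F) \<longleftrightarrow>
     P\<^sub>N *v F' = 0 \<and> P\<^sub>R *v F' = \<Lambda> *v (P\<^sub>R *v F)"
proof
  assume test: "\<forall>G. P\<^sub>D *v G = 0 \<longrightarrow> hinner G F' = coupling G F"
  have "hinner U (P\<^sub>N *v F') = 0" for U
  proof -
    have "hinner U (P\<^sub>N *v F') = hinner (P\<^sub>N *v U) F'" by (rule projector_symmetric[OF projectors(2)])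
    also have "\<dots> = coupling (P\<^sub>N *v U) F" using test orthogonal(2) by blast
    also have "\<dots> = 0" unfolding coupling_def projector_symmetric[OF projectors(3)] orthogonal(3) by simp
    finally show ?thesis .
  qed
  then have N: "P\<^sub>N *v F' = 0" using hinner_self_eq_0 by blast
  have "hinner U (P\<^sub>R *v F' - \<Lambda> *v (P\<^sub>R *v F)) = 0" for U
  proof -
    have "hinner U (P\<^sub>R *v F') = hinner (P\<^sub>R *v U) F'" by (rule projector_symmetric[OF projectors(3)])
    also have "\<dots> = coupling (P\<^sub>R *v U) F" using test orthogonal(1) by blast
    also have "\<dots> = hinner U (\<Lambda> *v (P\<^sub>R *v F))"
      unfolding coupling_def projector_symmetric[OF projectors(3), symmetric] robin_range ..
    finally show ?thesis by (simp add: hinner_diff_right)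
  qed
  then have "P\<^sub>R *v F' - \<Lambda> *v (P\<^sub>R *v F) = 0" using hinner_self_eq_0 by blast
  with N show "P\<^sub>N *v F' = 0 \<and> P\<^sub>R *v F' = \<Lambda> *v (P\<^sub>R *v F)" by simp
next
  assume c: "P\<^sub>N *v F' = 0 \<and> P\<^sub>R *v F' = \<Lambda> *v (P\<^sub>R *v F)"
  show "\<forall>G. P\<^sub>D *v G = 0 \<longrightarrow> hinner G F' = coupling G F"
  proof (intro allI impI)
    fix G assume G: "P\<^sub>D *v G = 0"
    have "hinner G F' = hinner G (P\<^sub>D *v F') + hinner G (P\<^sub>N *v F') + hinner G (P\<^sub>R *v F')"
      unfolding hinner_add_right[symmetric] decompose ..
    also have "hinner G (P\<^sub>D *v F') = 0" unfolding projector_symmetric[OF projectors(1)] G by simp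
    finally show "hinner G F' = coupling G F" using c by (simp add: coupling_def robin_range)
  qed
qed

lemma eigenspace_iff:
  assumes L: "\<And>e. L e > 0"
  shows "f \<in> eigenspace (graph_laplacian L P\<^sub>D P\<^sub>N P\<^sub>R \<Lambda>) z \<longleftrightarrow>
    (\<forall>e. solves_ode (L e) z (f e) (edge_deriv (L e) (f e))) \<and> P\<^sub>D *v boundary_values L f = 0 \<and>
    (\<forall>G. P\<^sub>D *v G = 0 \<longrightarrow> hinner G (boundary_derivs L f) = coupling G (boundary_values L f))"
proof -
  have "has_H2_second_deriv (L e) (f e) (\<lambda>x. - edge_scale z f e x) \<longleftrightarrow>
      solves_ode (L e) z (f e) (edge_deriv (L e) (f e))" for e
    using eigenfunction_solves_ode[OF L] solves_ode_second_deriv(1)[OF L] by (auto simp: edge_scale_def)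
  then show ?thesis
    unfolding natural_conditions_iff by (simp add: eigenspace_def graph_laplacian_def)
qed

text \<open>
  On each edge the increment of the flux has the sign of \<open>- Im z\<close>.  The vertex conditions make the sum of the
  increments over all edges vanish, so all of them vanish.
\<close>

lemma eigenspace_nonreal:
  assumes L: "\<And>e. L e > 0" and z: "Im z \<noteq> 0"
  shows "eigenspace (graph_laplacian L P\<^sub>D P\<^sub>N P\<^sub>R \<Lambda>) z \<subseteq> {0}"
proof
  fix f assume f: "f \<in> eigenspace (graph_laplacian L P\<^sub>D P\<^sub>N P\<^sub>R \<Lambda>) z"
  define g where "g e = edge_deriv (L e) (f e)" for e
  have S: "solves_ode (L e) z (f e) (g e)" for e
    using f unfolding eigenspace_iff[OF L] g_def by blast
  define t where "t e = Im (cnj (f e (L e)) * g e (L e)) - Im (cnj (f e 0) * g e 0)" for e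
  have sign: "Im z * t e \<le> 0" for e
    unfolding t_def by (rule solves_ode_flux(1)[OF L S])
  have "hinner (boundary_values L f) (boundary_derivs L f) = coupling (boundary_values L f) (boundary_values L f)"
    using f unfolding eigenspace_iff[OF L] by blast
  moreover have "Im (coupling F F) = 0" for F
    using coupling_cnj[of F F] by (simp add: complex_eq_iff)
  ultimately have "Im (hinner (boundary_values L f) (boundary_derivs L f)) = 0" by simp
  moreover have "hinner (boundary_values L f) (boundary_derivs L f)
      = (\<Sum>e\<in>UNIV. cnj (f e 0) * g e 0 - cnj (f e (L e)) * g e (L e))"
    by (simp add: hinner_def sum_endpoints boundary_values_def boundary_derivs_def g_def)
  ultimately have "(\<Sum>e\<in>UNIV. - t e) = 0"
    by (simp add: t_def Im_sum)
  then have "(\<Sum>e\<in>UNIV. - (Im z * t e)) = 0"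
    by (simp add: sum_negf sum_distrib_left[symmetric])
  then have "Im z * t e = 0" for e
    using sign by (subst (asm) sum_nonneg_eq_0_iff) auto
  then have "t e = 0" for e using z by simp
  then have "f e x = 0" for e x
    using solves_ode_flux(2)[OF L S z, of e] by (simp add: t_def)
  then show "f \<in> {0}" by (simp add: fun_eq_iff)
qed

end

section \<open>Nodal values\<close>

text \<open>
  Nodal values: \<open>y e j\<close> is the value at the \<open>j\<close>-th of the \<open>N + 1\<close> equidistant nodes of the edge \<open>e\<close>.
  The number \<open>N\<close> has to vary, so it cannot be part of the type.
\<close>

definition node_scale :: "complex \<Rightarrow> ('e \<Rightarrow> nat \<Rightarrow> complex) \<Rightarrow> ('e \<Rightarrow> nat \<Rightarrow> complex)" where
  "node_scale c y = (\<lambda>e j. c * y e j)"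

interpretation node: complex_space "node_scale :: complex \<Rightarrow> ('e \<Rightarrow> nat \<Rightarrow> complex) \<Rightarrow> _"
  by unfold_locales (auto simp: node_scale_def fun_eq_iff algebra_simps)

definition end_values :: "nat \<Rightarrow> ('e::finite \<Rightarrow> nat \<Rightarrow> complex) \<Rightarrow> complex ^ ('e + 'e)" where
  "end_values N y = (\<chi> v. case v of Inl e \<Rightarrow> y e 0 | Inr e \<Rightarrow> y e N)"

lemma end_values_add: "end_values N (y + z) = end_values N y + end_values N z"
  by (simp add: end_values_def vec_eq_iff split: sum.split)

lemma end_values_scale: "end_values N (node_scale c y) = c *s end_values N y"
  by (simp add: end_values_def node_scale_def vec_eq_iff split: sum.split)

lemma end_values_zero: "end_values N 0 = 0"
  by (simp add: end_values_def vec_eq_iff split: sum.split)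

text \<open>
  The dimensionless spectral parameter \<open>\<nu> h\<^sup>2\<close>, where \<open>h\<close> is half the length of a piece of \<open>e\<close>.
\<close>

definition piece_arg :: "('e \<Rightarrow> real) \<Rightarrow> nat \<Rightarrow> real \<Rightarrow> 'e \<Rightarrow> real" where
  "piece_arg L N \<nu> e = \<nu> * (L e / (2 * N))\<^sup>2"

text \<open>
  The minimum of \<open>\<integral> \<bar>f'\<bar>\<^sup>2 - \<nu> \<bar>f\<bar>\<^sup>2\<close> over all \<open>f\<close> with the nodal values \<open>y\<close> (polarised).  On each piece the
  minimiser is split into its antisymmetric and its symmetric part, proportional to the difference
  and to the sum of the two end values.
\<close>

definition stiff :: "('e::finite \<Rightarrow> real) \<Rightarrow> nat \<Rightarrow> real \<Rightarrow> ('e \<Rightarrow> nat \<Rightarrow> complex) \<Rightarrow> ('e \<Rightarrow> nat \<Rightarrow> complex) \<Rightarrow> complex" where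
  "stiff L N \<nu> y z = (\<Sum>e\<in>UNIV. \<Sum>j<N. of_real (N / L e) *
     (of_real (rcot (piece_arg L N \<nu> e)) * (cnj (y e j - y e (Suc j)) * (z e j - z e (Suc j)))
    - of_real (rtan (piece_arg L N \<nu> e)) * (cnj (y e j + y e (Suc j)) * (z e j + z e (Suc j)))))"

text \<open>
  Pieces so short that the minimum exists: \<open>\<nu>\<close> is below the first Dirichlet eigenvalue of each piece.
\<close>

definition valid :: "('e \<Rightarrow> real) \<Rightarrow> nat \<Rightarrow> real \<Rightarrow> bool" where
  "valid L N \<nu> \<longleftrightarrow> (\<forall>e. piece_arg L N \<nu> e < pi\<^sup>2 / 4)"

lemma stiff_self:
  "stiff L N \<nu> y y = of_real (\<Sum>e\<in>UNIV. \<Sum>j<N. N / L e *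
     (rcot (piece_arg L N \<nu> e) * (cmod (y e j - y e (Suc j)))\<^sup>2
    - rtan (piece_arg L N \<nu> e) * (cmod (y e j + y e (Suc j)))\<^sup>2))"
  unfolding stiff_def of_real_sum of_real_mult of_real_diff complex_norm_square by (simp only: mult_ac)

lemma stiff_hermitian: "node.hermitian_on UNIV (stiff L N \<nu>)"
  unfolding node.hermitian_on_def node.functional_on_def
proof (intro conjI ballI allI)
  show "stiff L N \<nu> x (y + z) = stiff L N \<nu> x y + stiff L N \<nu> x z" for x y z
    unfolding stiff_def sum.distrib[symmetric] by (intro sum.cong refl) (simp add: algebra_simps)
  show "stiff L N \<nu> x (node_scale c y) = c * stiff L N \<nu> x y" for x c y
    unfolding stiff_def sum_distrib_left node_scale_def by (intro sum.cong refl) (simp add: algebra_simps)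
  show "stiff L N \<nu> y x = cnj (stiff L N \<nu> x y)" for x y
    unfolding stiff_def cnj_sum by (intro sum.cong refl) (simp add: algebra_simps)
qed

text \<open>
  The half-angle coefficients turned into the entries \<open>cot\<close> and \<open>1 / sin\<close> of the
  Dirichlet-to-Neumann matrix of a piece.
\<close>

lemma piece_coefficients:
  fixes L :: "'e \<Rightarrow> real"
  assumes "L e > 0" "N \<ge> 1" "valid L N \<nu>"
  shows "sn \<nu> (L e / N) > 0"
    and "N / L e * (rcot (piece_arg L N \<nu> e) - rtan (piece_arg L N \<nu> e)) = cs \<nu> (L e / N) / sn \<nu> (L e / N)"
    and "N / L e * (rcot (piece_arg L N \<nu> e) + rtan (piece_arg L N \<nu> e)) = 1 / sn \<nu> (L e / N)"
proof -
  define h s C S where "h = L e / (2 * N)" and "s = piece_arg L N \<nu> e" and "C = cs s 1" and "S = sn s 1"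
  have h: "h > 0" using assms by (simp add: h_def)
  have s: "s = \<nu> * h\<^sup>2" by (simp add: s_def piece_arg_def h_def)
  have "s < pi\<^sup>2 / 4" using assms(3) by (simp add: s_def valid_def)
  then have pos: "C > 0" "S > 0" by (auto simp: C_def S_def intro: cs_pos sn_pos)
  have half: "cs \<nu> h = C" "sn \<nu> h = h * S"
    using cs_rescale[OF h] sn_rescale[OF h] by (simp_all add: C_def S_def s)
  have dbl: "L e / N = h + h" "N / L e = 1 / (2 * h)" using assms by (simp_all add: h_def)
  have snd: "sn \<nu> (L e / N) = 2 * h * (S * C)" and csd: "cs \<nu> (L e / N) = C\<^sup>2 - s * S\<^sup>2"
    unfolding dbl sn_add cs_add half by (simp_all add: s power2_eq_square)
  have one: "C\<^sup>2 + s * S\<^sup>2 = 1" unfolding C_def S_def by (rule cs_sn_pythagoras)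
  show "sn \<nu> (L e / N) > 0" using snd pos h by simp
  have r: "rcot s = C / S" "rtan s = s * S / C" by (simp_all add: rcot_def rtan_def C_def S_def)
  have diff: "rcot s - rtan s = (C\<^sup>2 - s * S\<^sup>2) / (S * C)" and sum: "rcot s + rtan s = (C\<^sup>2 + s * S\<^sup>2) / (S * C)"
    using pos by (simp_all add: r field_simps power2_eq_square)
  show "N / L e * (rcot (piece_arg L N \<nu> e) - rtan (piece_arg L N \<nu> e)) = cs \<nu> (L e / N) / sn \<nu> (L e / N)"
    "N / L e * (rcot (piece_arg L N \<nu> e) + rtan (piece_arg L N \<nu> e)) = 1 / sn \<nu> (L e / N)"
    unfolding s_def[symmetric] diff sum snd csd one dbl(2) by simp_all
qed

lemma stiff_fluxes:
  fixes L :: "'e::finite \<Rightarrow> real"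
  assumes "\<And>e. L e > 0" "N \<ge> 1" "valid L N \<nu>"
  shows "stiff L N \<nu> y z = (\<Sum>e\<in>UNIV. \<Sum>j<N.
     cnj (y e j) * ((of_real (cs \<nu> (L e / N)) * z e j - z e (Suc j)) / of_real (sn \<nu> (L e / N)))
   + cnj (y e (Suc j)) * ((of_real (cs \<nu> (L e / N)) * z e (Suc j) - z e j) / of_real (sn \<nu> (L e / N))))"
  unfolding stiff_def
proof (intro sum.cong refl)
  fix e j
  note k = piece_coefficients[OF assms(1)[of e] assms(2,3)]
  define m A B where "m = N / L e" and "A = rcot (piece_arg L N \<nu> e)" and "B = rtan (piece_arg L N \<nu> e)"
  have c: "complex_of_real (m * (A - B)) = of_real (cs \<nu> (L e / N)) / of_real (sn \<nu> (L e / N))"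
    "complex_of_real (m * (A + B)) = 1 / of_real (sn \<nu> (L e / N))"
    using k by (simp_all add: m_def A_def B_def)
  have "of_real m * (of_real A * (cnj (y e j - y e (Suc j)) * (z e j - z e (Suc j)))
    - of_real B * (cnj (y e j + y e (Suc j)) * (z e j + z e (Suc j))))
    = cnj (y e j) * (of_real (m * (A - B)) * z e j - of_real (m * (A + B)) * z e (Suc j))
    + cnj (y e (Suc j)) * (of_real (m * (A - B)) * z e (Suc j) - of_real (m * (A + B)) * z e j)"
    by (simp add: algebra_simps)
  also have "\<dots> = cnj (y e j) * ((of_real (cs \<nu> (L e / N)) * z e j - z e (Suc j)) / of_real (sn \<nu> (L e / N)))
    + cnj (y e (Suc j)) * ((of_real (cs \<nu> (L e / N)) * z e (Suc j) - z e j) / of_real (sn \<nu> (L e / N)))"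
    unfolding c using k(1) by (simp add: diff_divide_distrib)
  finally show "of_real (N / L e) * (of_real (rcot (piece_arg L N \<nu> e)) * (cnj (y e j - y e (Suc j)) * (z e j - z e (Suc j)))
    - of_real (rtan (piece_arg L N \<nu> e)) * (cnj (y e j + y e (Suc j)) * (z e j + z e (Suc j))))
    = cnj (y e j) * ((of_real (cs \<nu> (L e / N)) * z e j - z e (Suc j)) / of_real (sn \<nu> (L e / N)))
    + cnj (y e (Suc j)) * ((of_real (cs \<nu> (L e / N)) * z e (Suc j) - z e j) / of_real (sn \<nu> (L e / N)))"
    unfolding m_def A_def B_def .
qed

text \<open>
  The derivatives at the two ends of the edges, pointing into the edge, of the solution
  \<open>a cs + b sn\<close>.
\<close>

definition inward_derivs :: "('e::finite \<Rightarrow> real) \<Rightarrow> real \<Rightarrow> ('e \<Rightarrow> complex) \<Rightarrow> ('e \<Rightarrow> complex) \<Rightarrow> complex ^ ('e + 'e)" where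
  "inward_derivs L \<nu> a b = (\<chi> v. case v of Inl e \<Rightarrow> b e
     | Inr e \<Rightarrow> - (b e * of_real (cs \<nu> (L e)) - a e * of_real \<nu> * of_real (sn \<nu> (L e))))"

text \<open>
  Green's formula.  If \<open>z\<close> samples a solution of the equation, the fluxes on both sides of
  an interior node cancel, and the sum over the pieces telescopes.
\<close>

lemma stiff_green:
  fixes L :: "'e::finite \<Rightarrow> real"
  assumes "\<And>e. L e > 0" "N \<ge> 1" "valid L N \<nu>"
    and z: "\<And>e j. j \<le> N \<Longrightarrow> z e j = a e * of_real (cs \<nu> (j * (L e / N))) + b e * of_real (sn \<nu> (j * (L e / N)))"
  shows "stiff L N \<nu> y z = - hinner (end_values N y) (inward_derivs L \<nu> a b)"
proof -
  have "(\<Sum>j<N. cnj (y e j) * ((of_real (cs \<nu> (L e / N)) * z e j - z e (Suc j)) / of_real (sn \<nu> (L e / N)))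
     + cnj (y e (Suc j)) * ((of_real (cs \<nu> (L e / N)) * z e (Suc j) - z e j) / of_real (sn \<nu> (L e / N))))
    = cnj (y e N) * (b e * of_real (cs \<nu> (L e)) - a e * of_real \<nu> * of_real (sn \<nu> (L e))) - cnj (y e 0) * b e" for e
  proof -
    define d where "d = L e / N"
    define D where "D x = b e * of_real (cs \<nu> x) - a e * of_real \<nu> * of_real (sn \<nu> x)" for x
    define Z where "Z x = a e * of_real (cs \<nu> x) + b e * of_real (sn \<nu> x)" for x
    have sn: "sn \<nu> d \<noteq> 0" using piece_coefficients(1)[OF assms(1)[of e] assms(2,3)] by (simp add: d_def)
    have one: "complex_of_real (cs \<nu> d) * of_real (cs \<nu> d) = 1 - of_real \<nu> * (of_real (sn \<nu> d) * of_real (sn \<nu> d))"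
      using cs_sn_pythagoras[of \<nu> d] unfolding power2_eq_square
      by (metis add_diff_cancel_right' of_real_1 of_real_add of_real_mult)
    have f: "of_real (cs \<nu> d) * Z x - Z (x + d) = - (of_real (sn \<nu> d) * D x)" for x
      unfolding Z_def D_def cs_add sn_add by (simp add: algebra_simps)
    have g: "of_real (cs \<nu> d) * Z (x + d) - Z x = of_real (sn \<nu> d) * D (x + d)" for x
    proof -
      have "of_real (cs \<nu> d) * Z (x + d) - Z x =
        a e * of_real (cs \<nu> x) * (of_real (cs \<nu> d) * of_real (cs \<nu> d) - 1) - a e * of_real \<nu> * of_real (sn \<nu> x) * of_real (sn \<nu> d) * of_real (cs \<nu> d)
        + b e * of_real (sn \<nu> x) * (of_real (cs \<nu> d) * of_real (cs \<nu> d) - 1) + b e * of_real (cs \<nu> x) * of_real (sn \<nu> d) * of_real (cs \<nu> d)"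
        unfolding Z_def cs_add sn_add by (simp add: algebra_simps)
      also have "\<dots> = of_real (sn \<nu> d) * D (x + d)"
        unfolding one D_def cs_add sn_add by (simp add: algebra_simps)
      finally show ?thesis .
    qed
    have Zj: "z e j = Z (j * d)" if "j \<le> N" for j using z[OF that] by (simp add: Z_def d_def)
    have "(\<Sum>j<N. cnj (y e j) * ((of_real (cs \<nu> d) * z e j - z e (Suc j)) / of_real (sn \<nu> d))
     + cnj (y e (Suc j)) * ((of_real (cs \<nu> d) * z e (Suc j) - z e j) / of_real (sn \<nu> d)))
     = (\<Sum>j<N. cnj (y e (Suc j)) * D (Suc j * d) - cnj (y e j) * D (j * d))"
    proof (intro sum.cong refl)
      fix j assume "j \<in> {..<N}"
      then have j: "z e j = Z (j * d)" "z e (Suc j) = Z (j * d + d)"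
        using Zj[of j] Zj[of "Suc j"] by (simp_all add: algebra_simps)
      have Sj: "Suc j * d = j * d + d" by (simp add: algebra_simps)
      show "cnj (y e j) * ((of_real (cs \<nu> d) * z e j - z e (Suc j)) / of_real (sn \<nu> d))
     + cnj (y e (Suc j)) * ((of_real (cs \<nu> d) * z e (Suc j) - z e j) / of_real (sn \<nu> d))
     = cnj (y e (Suc j)) * D (Suc j * d) - cnj (y e j) * D (j * d)"
        unfolding j f g Sj using sn by simp
    qed
    also have "\<dots> = cnj (y e N) * D (N * d) - cnj (y e 0) * D (0 * d)"
      using sum_lessThan_telescope[of "\<lambda>j. cnj (y e j) * D (j * d)" N] by simp
    finally show ?thesis using assms(2) by (simp add: d_def D_def)
  qed
  then have "stiff L N \<nu> y z = (\<Sum>e\<in>UNIV. cnj (y e N) * (b e * of_real (cs \<nu> (L e)) - a e * of_real \<nu> * of_real (sn \<nu> (L e))) - cnj (y e 0) * b e)"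
    unfolding stiff_fluxes[OF assms(1-3)] by simp
  also have "\<dots> = - hinner (end_values N y) (inward_derivs L \<nu> a b)"
    unfolding hinner_def sum_endpoints sum_negf[symmetric]
    by (intro sum.cong) (simp_all add: end_values_def inward_derivs_def algebra_simps)
  finally show ?thesis .
qed

text \<open>
  Testing at an interior node expresses that the derivative does not jump there.
\<close>

lemma stiff_recurrence:
  fixes L :: "'e::finite \<Rightarrow> real"
  assumes "\<And>e. L e > 0" "N \<ge> 1" "valid L N \<nu>" and k: "0 < k" "k < N"
    and zero: "stiff L N \<nu> (\<lambda>e' j. if e' = e \<and> j = k then 1 else 0) z = 0"
  shows "z e (k + 1) + z e (k - 1) = 2 * of_real (cs \<nu> (L e / N)) * z e k"
proof -
  let ?c = "complex_of_real (cs \<nu> (L e / N))" and ?s = "complex_of_real (sn \<nu> (L e / N))"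
  define y where "y e' j = (if e' = e \<and> j = k then 1 else 0 :: complex)" for e' j
  have "stiff L N \<nu> y z = (\<Sum>e'\<in>UNIV. \<Sum>j<N.
     cnj (y e' j) * ((of_real (cs \<nu> (L e' / N)) * z e' j - z e' (Suc j)) / of_real (sn \<nu> (L e' / N)))
   + cnj (y e' (Suc j)) * ((of_real (cs \<nu> (L e' / N)) * z e' (Suc j) - z e' j) / of_real (sn \<nu> (L e' / N))))"
    by (rule stiff_fluxes[OF assms(1-3)])
  also have "\<dots> = (\<Sum>e'\<in>UNIV. if e' = e then (\<Sum>j<N.
     (if j = k then (?c * z e j - z e (Suc j)) / ?s else 0)
     + (if j = k - 1 then (?c * z e (Suc j) - z e j) / ?s else 0)) else 0)"
    using k by (intro sum.cong refl) (auto simp: y_def intro!: sum.cong)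
  also have "\<dots> = (?c * z e k - z e (Suc k)) / ?s + (?c * z e k - z e (k - 1)) / ?s"
    using k less_imp_diff_less[OF k(2), of "Suc 0"] by (simp add: sum.distrib)
  finally have "(?c * z e k - z e (Suc k)) / ?s + (?c * z e k - z e (k - 1)) / ?s = 0"
    using zero by (simp add: y_def[abs_def])
  then have "((?c * z e k - z e (Suc k)) + (?c * z e k - z e (k - 1))) / ?s = 0"
    by (simp only: add_divide_distrib)
  moreover have "?s \<noteq> 0" using piece_coefficients(1)[OF assms(1)[of e] assms(2,3)] by simp
  ultimately have "(?c * z e k - z e (Suc k)) + (?c * z e k - z e (k - 1)) = 0"
    by simp
  then show ?thesis by (simp add: algebra_simps)
qed

lemma recurrence_solution:
  fixes z :: "nat \<Rightarrow> complex"
  assumes "sn \<nu> d \<noteq> 0" and rec: "\<And>k. 0 < k \<Longrightarrow> k < N \<Longrightarrow> z (k + 1) + z (k - 1) = 2 * of_real (cs \<nu> d) * z k"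
    and "j \<le> N"
  shows "z j = z 0 * of_real (cs \<nu> (j * d)) + (z 1 - of_real (cs \<nu> d) * z 0) / of_real (sn \<nu> d) * of_real (sn \<nu> (j * d))"
  using \<open>j \<le> N\<close>
proof (induction j rule: less_induct)
  case (less j)
  define b where "b = (z 1 - of_real (cs \<nu> d) * z 0) / of_real (sn \<nu> d)"
  consider "j = 0" | "j = 1" | k where "j = k + 1" "0 < k" by (metis Suc_eq_plus1 gr0I not0_implies_Suc One_nat_def)
  then show ?case
  proof cases
    case 3
    then have k: "k < N" using less.prems by simp
    have x: "real j * d = k * d + d" "real k * d = (real (k - 1) * d) + d" using 3 by (simp_all add: algebra_simps of_nat_diff)
    have one: "complex_of_real (cs \<nu> d) * of_real (cs \<nu> d) = 1 - of_real \<nu> * (of_real (sn \<nu> d) * of_real (sn \<nu> d))"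
      using cs_sn_pythagoras[of \<nu> d] unfolding power2_eq_square
      by (metis add_diff_cancel_right' of_real_1 of_real_add of_real_mult)
    define u where "u = real (k - 1) * d"
    have "z k = z 0 * of_real (cs \<nu> (u + d)) + b * of_real (sn \<nu> (u + d))"
      "z (k - 1) = z 0 * of_real (cs \<nu> u) + b * of_real (sn \<nu> u)"
      using less.IH[of k] less.IH[of "k - 1"] 3 k x(2) by (simp_all add: b_def u_def)
    then have "z j = 2 * of_real (cs \<nu> d) * (z 0 * of_real (cs \<nu> (u + d)) + b * of_real (sn \<nu> (u + d)))
        - (z 0 * of_real (cs \<nu> u) + b * of_real (sn \<nu> u))"
      using rec[OF 3(2) k] 3(1) by (simp add: algebra_simps)
    also have "\<dots> = z 0 * (of_real (cs \<nu> u) * (2 * (of_real (cs \<nu> d) * of_real (cs \<nu> d)) - 1) - 2 * of_real \<nu> * of_real (sn \<nu> u) * of_real (sn \<nu> d) * of_real (cs \<nu> d))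
        + b * (of_real (sn \<nu> u) * (2 * (of_real (cs \<nu> d) * of_real (cs \<nu> d)) - 1) + 2 * of_real (cs \<nu> u) * of_real (sn \<nu> d) * of_real (cs \<nu> d))"
      unfolding cs_add sn_add by (simp add: algebra_simps)
    also have "\<dots> = z 0 * (of_real (cs \<nu> u) * (of_real (cs \<nu> d) * of_real (cs \<nu> d) - of_real \<nu> * (of_real (sn \<nu> d) * of_real (sn \<nu> d))) - 2 * of_real \<nu> * of_real (sn \<nu> u) * of_real (sn \<nu> d) * of_real (cs \<nu> d))
        + b * (of_real (sn \<nu> u) * (of_real (cs \<nu> d) * of_real (cs \<nu> d) - of_real \<nu> * (of_real (sn \<nu> d) * of_real (sn \<nu> d))) + 2 * of_real (cs \<nu> u) * of_real (sn \<nu> d) * of_real (cs \<nu> d))"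
      unfolding one by (simp add: algebra_simps)
    also have "\<dots> = z 0 * of_real (cs \<nu> (u + d + d)) + b * of_real (sn \<nu> (u + d + d))"
      unfolding cs_add sn_add by (simp add: algebra_simps)
    finally show ?thesis using x by (simp add: b_def u_def)
  qed (use assms(1) in \<open>simp_all add: field_simps\<close>)
qed

lemma (in complex_space) radical_subspace:
  assumes "fin_dim V" "hermitian_on V Q" shows "subspace (radical V Q)"
proof -
  obtain B where B: "sylvester_basis V Q B" using sylvester_basis_exists[OF assms] ..
  show ?thesis unfolding radical_eq_span[OF B assms(2)] by (rule subspace_span)
qed

definition sample :: "('e \<Rightarrow> real) \<Rightarrow> nat \<Rightarrow> ('e \<Rightarrow> real \<Rightarrow> complex) \<Rightarrow> ('e \<Rightarrow> nat \<Rightarrow> complex)" where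
  "sample L N f = (\<lambda>e j. if j \<le> N then f e (j * (L e / N)) else 0)"

text \<open>
  The solution of the equation on each edge that takes the given values at the nodes \<open>0\<close> and \<open>1\<close>.
\<close>

definition interpolate :: "('e \<Rightarrow> real) \<Rightarrow> nat \<Rightarrow> real \<Rightarrow> ('e \<Rightarrow> nat \<Rightarrow> complex) \<Rightarrow> ('e \<Rightarrow> real \<Rightarrow> complex)" where
  "interpolate L N \<nu> z = (\<lambda>e x. if x \<in> {0..L e} then z e 0 * of_real (cs \<nu> x)
     + (z e 1 - of_real (cs \<nu> (L e / N)) * z e 0) / of_real (sn \<nu> (L e / N)) * of_real (sn \<nu> x) else 0)"

interpretation node_edge: complex_space_pair
  "node_scale :: complex \<Rightarrow> ('e \<Rightarrow> nat \<Rightarrow> complex) \<Rightarrow> _" "edge_scale :: complex \<Rightarrow> ('e \<Rightarrow> real \<Rightarrow> complex) \<Rightarrow> _"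
  by intro_locales

lemma interpolate_linear: "Vector_Spaces.linear node_scale edge_scale (interpolate L N \<nu>)"
  unfolding Vector_Spaces.linear_iff
proof (intro conjI allI)
  show "interpolate L N \<nu> (y + z) = interpolate L N \<nu> y + interpolate L N \<nu> z" for y z
    by (simp add: interpolate_def fun_eq_iff diff_divide_distrib add_divide_distrib algebra_simps)
  show "interpolate L N \<nu> (node_scale c z) = edge_scale c (interpolate L N \<nu> z)" for c z
    by (simp add: interpolate_def fun_eq_iff node_scale_def edge_scale_def diff_divide_distrib algebra_simps)
qed (intro_locales)

lemma end_values_sample: "N \<ge> 1 \<Longrightarrow> end_values N (sample L N f) = boundary_values L f"
  by (simp add: end_values_def sample_def boundary_values_def vec_eq_iff split: sum.split)

context vertex_conditions
begin

definition nodal :: "nat \<Rightarrow> ('e \<Rightarrow> nat \<Rightarrow> complex) set" where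
  "nodal N = {y. (\<forall>e j. N < j \<longrightarrow> y e j = 0) \<and> P\<^sub>D *v end_values N y = 0}"

definition nform :: "('e \<Rightarrow> real) \<Rightarrow> nat \<Rightarrow> real \<Rightarrow> real \<Rightarrow> ('e \<Rightarrow> nat \<Rightarrow> complex) \<Rightarrow> ('e \<Rightarrow> nat \<Rightarrow> complex) \<Rightarrow> complex" where
  "nform L N \<nu> \<epsilon> y z = stiff L N \<nu> y z + of_real \<epsilon> * coupling (end_values N y) (end_values N z)"

lemma nodal_fin_dim: "node.fin_dim (nodal N)"
  unfolding node.fin_dim_def
proof
  show "node.subspace (nodal N)"
    unfolding node.subspace_def
    by (auto simp: nodal_def end_values_add end_values_scale end_values_zero matrix_vector_right_distrib vec.scale)
      (auto simp: node_scale_def)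
  define u where "u = (\<lambda>(e::'e, j::nat) e' j'. if e' = e \<and> j' = j then 1 else 0 :: complex)"
  have "y \<in> node.span (u ` (UNIV \<times> {..N}))" if "y \<in> nodal N" for y
  proof -
    have "y = (\<Sum>p\<in>UNIV \<times> {..N}. node_scale (y (fst p) (snd p)) (u p))"
    proof (intro ext)
      fix e j
      have "(\<Sum>p\<in>UNIV \<times> {..N}. node_scale (y (fst p) (snd p)) (u p)) e j
         = (\<Sum>p\<in>UNIV \<times> {..N}. node_scale (y (fst p) (snd p)) (u p) e j)"
        by (induction rule: infinite_finite_induct) auto
      also have "\<dots> = (\<Sum>p\<in>UNIV \<times> {..N}. if p = (e, j) then y e j else 0)"
        by (intro sum.cong) (auto simp: node_scale_def u_def split: if_splits)
      also have "\<dots> = y e j" using that by (auto simp: nodal_def)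
      finally show "y e j = (\<Sum>p\<in>UNIV \<times> {..N}. node_scale (y (fst p) (snd p)) (u p)) e j" ..
    qed
    then show ?thesis by (metis (no_types, lifting) node.span_base node.span_scale node.span_sum image_eqI)
  qed
  then show "\<exists>B. finite B \<and> nodal N \<subseteq> node.span B"
    by (intro exI[of _ "u ` (UNIV \<times> {..N})"]) auto
qed

lemma nodal_subspace: "node.subspace (nodal N)"
  using nodal_fin_dim by (rule node.fin_dim_subspace)

lemma coupling_hermitian: "node.hermitian_on UNIV (\<lambda>y z. coupling (end_values N y) (end_values N z))"
  unfolding node.hermitian_on_def node.functional_on_def
  by (auto simp: end_values_add end_values_scale coupling_add_right coupling_scale_right intro: coupling_cnj)

lemma nform_hermitian: "node.hermitian_on V (nform L N \<nu> \<epsilon>)"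
proof -
  note s = stiff_hermitian[of L N \<nu>] and c = coupling_hermitian[of N]
  have "node.hermitian_on UNIV (nform L N \<nu> \<epsilon>)"
    unfolding node.hermitian_on_def node.functional_on_def nform_def
  proof (intro conjI ballI allI)
    fix x y z :: "'e \<Rightarrow> nat \<Rightarrow> complex" and a :: complex
    show "stiff L N \<nu> x (y + z) + of_real \<epsilon> * coupling (end_values N x) (end_values N (y + z))
      = stiff L N \<nu> x y + of_real \<epsilon> * coupling (end_values N x) (end_values N y) +
        (stiff L N \<nu> x z + of_real \<epsilon> * coupling (end_values N x) (end_values N z))"
      using node.hermitian_on_add_right[OF s, of x y z] node.hermitian_on_add_right[OF c, of x y z]
      by (simp add: algebra_simps)
    show "stiff L N \<nu> x (node_scale a y) + of_real \<epsilon> * coupling (end_values N x) (end_values N (node_scale a y))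
      = a * (stiff L N \<nu> x y + of_real \<epsilon> * coupling (end_values N x) (end_values N y))"
      using node.hermitian_on_scale_right[OF s, of x y a] node.hermitian_on_scale_right[OF c, of x y a]
      by (simp add: algebra_simps)
    show "stiff L N \<nu> y x + of_real \<epsilon> * coupling (end_values N y) (end_values N x)
      = cnj (stiff L N \<nu> x y + of_real \<epsilon> * coupling (end_values N x) (end_values N y))"
      unfolding node.hermitian_on_cnj[OF s UNIV_I UNIV_I, of y x] coupling_cnj[of "end_values N y" "end_values N x"] by simp
  qed
  then show ?thesis by (rule node.hermitian_on_subset) simp
qed

lemma eigenspace_sample:
  assumes L: "\<And>e. L e > 0" and N: "N \<ge> 1" and va: "valid L N \<nu>"
    and f: "f \<in> eigenspace (graph_laplacian L P\<^sub>D P\<^sub>N P\<^sub>R \<Lambda>) (of_real \<nu>)"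
  shows "sample L N f \<in> node.radical (nodal N) (nform L N \<nu> 1)"
    and "interpolate L N \<nu> (sample L N f) = f"
proof -
  define a b where "a e = f e 0" and "b e = edge_deriv (L e) (f e) 0" for e
  have S: "solves_ode (L e) (of_real \<nu>) (f e) (edge_deriv (L e) (f e))" for e
    using f unfolding eigenspace_iff[OF L] by blast
  have D: "P\<^sub>D *v boundary_values L f = 0"
    and nat: "\<And>G. P\<^sub>D *v G = 0 \<Longrightarrow> hinner G (boundary_derivs L f) = coupling G (boundary_values L f)"
    using f unfolding eigenspace_iff[OF L] by blast+
  have fe: "f e x = a e * of_real (cs \<nu> x) + b e * of_real (sn \<nu> x)" if "x \<in> {0..L e}" for e x
    using solves_ode_real(1)[OF S that] by (simp add: a_def b_def)
  have in_edge: "real j * (L e / N) \<in> {0..L e}" if "j \<le> N" for j e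
    using that L[of e] N by (auto simp: field_simps)
  have "boundary_derivs L f = inward_derivs L \<nu> a b"
    using solves_ode_real(2)[OF S, of "L _"] L
    by (auto simp: boundary_derivs_def inward_derivs_def vec_eq_iff a_def b_def less_imp_le split: sum.split)
  then have "stiff L N \<nu> y (sample L N f) = - hinner (end_values N y) (boundary_derivs L f)" for y
    using stiff_green[OF L N va, of "sample L N f" a b y] in_edge by (simp add: sample_def fe)
  then have "nform L N \<nu> 1 y (sample L N f) = 0" if "y \<in> nodal N" for y
    using nat[of "end_values N y"] that by (simp add: nform_def end_values_sample[OF N] nodal_def)
  then show "sample L N f \<in> node.radical (nodal N) (nform L N \<nu> 1)"
    using D by (auto simp: node.radical_def nodal_def end_values_sample[OF N]) (simp add: sample_def)
  show "interpolate L N \<nu> (sample L N f) = f"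
  proof (intro ext)
    fix e x
    show "interpolate L N \<nu> (sample L N f) e x = f e x"
    proof (cases "x \<in> {0..L e}")
      case True
      have "sample L N f e 0 = a e" by (simp add: sample_def a_def)
      moreover have "sample L N f e 1 = a e * of_real (cs \<nu> (L e / N)) + b e * of_real (sn \<nu> (L e / N))"
        using N in_edge[of 1 e] by (simp add: sample_def fe)
      ultimately show ?thesis
        using True piece_coefficients(1)[OF L N va, of e] by (simp add: interpolate_def fe)
    next
      case False
      then have "f e x = 0" using S unfolding solves_ode_def by blast
      then show ?thesis using False unfolding interpolate_def by (simp only: if_False)
    qed
  qed
qed

lemma radical_sample:
  assumes L: "\<And>e. L e > 0" and N: "N \<ge> 1" and va: "valid L N \<nu>"
    and z: "z \<in> node.radical (nodal N) (nform L N \<nu> 1)"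
  shows "interpolate L N \<nu> z \<in> eigenspace (graph_laplacian L P\<^sub>D P\<^sub>N P\<^sub>R \<Lambda>) (of_real \<nu>)"
    and "sample L N (interpolate L N \<nu> z) = z"
proof -
  have zV: "z \<in> nodal N" and rad: "\<And>y. y \<in> nodal N \<Longrightarrow> nform L N \<nu> 1 y z = 0"
    using z by (auto simp: node.radical_def)
  define a b where "a e = z e 0" and "b e = (z e 1 - of_real (cs \<nu> (L e / N)) * z e 0) / of_real (sn \<nu> (L e / N))" for e
  have rec: "z e (k + 1) + z e (k - 1) = 2 * of_real (cs \<nu> (L e / N)) * z e k" if k: "0 < k" "k < N" for e k
  proof (rule stiff_recurrence[OF L N va k])
    let ?y = "\<lambda>e' j. if e' = e \<and> j = k then 1 else 0 :: complex"
    have "end_values N ?y = 0" using k by (simp add: end_values_def vec_eq_iff split: sum.split)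
    moreover from this have "?y \<in> nodal N" using k by (auto simp: nodal_def)
    ultimately show "stiff L N \<nu> ?y z = 0" using rad[of ?y] by (simp add: nform_def coupling_def)
  qed
  have zj: "z e j = a e * of_real (cs \<nu> (j * (L e / N))) + b e * of_real (sn \<nu> (j * (L e / N)))" if "j \<le> N" for e j
    using recurrence_solution[OF _ rec that, of e] piece_coefficients(1)[OF L N va, of e] by (simp add: a_def b_def)
  define f where "f = interpolate L N \<nu> z"
  have f_eq: "f e = (\<lambda>x. if x \<in> {0..L e} then a e * of_real (cs \<nu> x) + b e * of_real (sn \<nu> x) else 0)" for e
    unfolding f_def interpolate_def a_def b_def ..
  define g where "g e x = b e * of_real (cs \<nu> x) - a e * of_real \<nu> * of_real (sn \<nu> x)" for e x
  have S: "solves_ode (L e) (of_real \<nu>) (f e) (g e)" for e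
    unfolding f_eq g_def[abs_def] by (rule solves_ode_cs_sn)
  have deriv: "edge_deriv (L e) (f e) x = g e x" if "x \<in> {0..L e}" for e x
    using solves_ode_second_deriv(2)[OF L S that] .
  have S': "solves_ode (L e) (of_real \<nu>) (f e) (edge_deriv (L e) (f e))" for e
    using eigenfunction_solves_ode[OF L solves_ode_second_deriv(1)[OF L S]] .
  have in_edge: "real j * (L e / N) \<in> {0..L e}" if "j \<le> N" for j e
    using that L[of e] N by (auto simp: field_simps)
  have sample: "sample L N f = z"
  proof (intro ext)
    fix e j
    show "sample L N f e j = z e j"
    proof (cases "j \<le> N")
      case True
      then show ?thesis using in_edge[OF True, of e] by (simp add: sample_def f_eq zj)
    next
      case False
      then show ?thesis using zV by (simp add: sample_def nodal_def)
    qed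
  qed
  then have bv: "boundary_values L f = end_values N z" using end_values_sample[OF N] by metis
  have bd: "boundary_derivs L f = inward_derivs L \<nu> a b"
    using deriv[of 0] deriv[of "L _"] L
    by (auto simp: boundary_derivs_def inward_derivs_def vec_eq_iff g_def less_imp_le split: sum.split)
  have "hinner G (boundary_derivs L f) = coupling G (boundary_values L f)" if G: "P\<^sub>D *v G = 0" for G
  proof -
    define y where "y e j = (if j = 0 then G $ Inl e else if j = N then G $ Inr e else 0)" for e j
    have yG: "end_values N y = G" using N by (simp add: end_values_def y_def vec_eq_iff split: sum.split)
    then have "y \<in> nodal N" using G N by (auto simp: nodal_def y_def)
    then have "nform L N \<nu> 1 y z = 0" by (rule rad)
    moreover have "stiff L N \<nu> y z = - hinner G (boundary_derivs L f)"
      unfolding bd yG[symmetric] by (rule stiff_green[OF L N va zj])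
    ultimately show ?thesis by (simp add: nform_def yG bv)
  qed
  then have "f \<in> eigenspace (graph_laplacian L P\<^sub>D P\<^sub>N P\<^sub>R \<Lambda>) (of_real \<nu>)"
    unfolding eigenspace_iff[OF L] using S' zV by (auto simp: bv nodal_def)
  with sample show "interpolate L N \<nu> z \<in> eigenspace (graph_laplacian L P\<^sub>D P\<^sub>N P\<^sub>R \<Lambda>) (of_real \<nu>)"
    "sample L N (interpolate L N \<nu> z) = z" by (simp_all add: f_def)
qed

text \<open>
  Interpolation maps the radical of the nodal form isomorphically onto the eigenspace; sampling is
  its inverse.
\<close>

lemma eigenspace_dim:
  assumes L: "\<And>e. L e > 0" and N: "N \<ge> 1" and va: "valid L N \<nu>"
  shows "edge_fun.dim (eigenspace (graph_laplacian L P\<^sub>D P\<^sub>N P\<^sub>R \<Lambda>) (of_real \<nu>))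
     = node.nullity (nodal N) (nform L N \<nu> 1)"
proof -
  let ?E = "eigenspace (graph_laplacian L P\<^sub>D P\<^sub>N P\<^sub>R \<Lambda>) (of_real \<nu>)"
  let ?R = "node.radical (nodal N) (nform L N \<nu> 1)"
  have "inj_on (interpolate L N \<nu>) ?R"
    by (rule inj_on_inverseI[of _ "sample L N"]) (rule radical_sample(2)[OF L N va])
  moreover have "interpolate L N \<nu> ` ?R = ?E"
  proof
    show "interpolate L N \<nu> ` ?R \<subseteq> ?E" using radical_sample(1)[OF L N va] by blast
    show "?E \<subseteq> interpolate L N \<nu> ` ?R"
    proof
      fix f assume f: "f \<in> ?E"
      show "f \<in> interpolate L N \<nu> ` ?R"
        using eigenspace_sample(2)[OF L N va f, symmetric] eigenspace_sample(1)[OF L N va f] by (rule image_eqI)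
    qed
  qed
  ultimately show ?thesis
    unfolding node.nullity_def
    using node_edge.dim_inj_image[OF interpolate_linear node.radical_subspace[OF nodal_fin_dim nform_hermitian]]
    by metis
qed

lemma nullity_rescale:
  assumes "\<epsilon> > 0"
  shows "node.nullity (nodal N) (nform (\<lambda>e. \<epsilon> * L e) N \<nu> 1) = node.nullity (nodal N) (nform L N (\<epsilon>\<^sup>2 * \<nu>) \<epsilon>)"
    and "valid (\<lambda>e. \<epsilon> * L e) N \<nu> \<longleftrightarrow> valid L N (\<epsilon>\<^sup>2 * \<nu>)"
proof -
  have arg: "piece_arg (\<lambda>e. \<epsilon> * L e) N \<nu> e = piece_arg L N (\<epsilon>\<^sup>2 * \<nu>) e" for e
    by (simp add: piece_arg_def power_divide power_mult_distrib mult_ac)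
  then show "valid (\<lambda>e. \<epsilon> * L e) N \<nu> \<longleftrightarrow> valid L N (\<epsilon>\<^sup>2 * \<nu>)" by (simp add: valid_def)
  have "stiff L N (\<epsilon>\<^sup>2 * \<nu>) y z = of_real \<epsilon> * stiff (\<lambda>e. \<epsilon> * L e) N \<nu> y z" for y z
    unfolding stiff_def arg sum_distrib_left using assms by (intro sum.cong refl) simp
  then have "nform L N (\<epsilon>\<^sup>2 * \<nu>) \<epsilon> y z = of_real \<epsilon> * nform (\<lambda>e. \<epsilon> * L e) N \<nu> 1 y z" for y z
    by (simp add: nform_def algebra_simps)
  then show "node.nullity (nodal N) (nform (\<lambda>e. \<epsilon> * L e) N \<nu> 1) = node.nullity (nodal N) (nform L N (\<epsilon>\<^sup>2 * \<nu>) \<epsilon>)"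
    using assms by (simp add: node.nullity_def node.radical_def)
qed

end

section \<open>The nodal index as a counting function\<close>

text \<open>
  The square of a norm on nodal values that matches the pieces, so that the parallelogram identity compares it with
  \<open>stiff\<close> term by term.
\<close>

definition mass :: "nat \<Rightarrow> ('e::finite \<Rightarrow> nat \<Rightarrow> complex) \<Rightarrow> real" where
  "mass N x = (\<Sum>e\<in>UNIV. \<Sum>j<N. (cmod (x e j))\<^sup>2 + (cmod (x e (Suc j)))\<^sup>2)"

definition valid_bound :: "('e::finite \<Rightarrow> real) \<Rightarrow> nat \<Rightarrow> real" where
  "valid_bound L N = Min (range (\<lambda>e. (pi * N / L e)\<^sup>2))"

lemma valid_iff:
  assumes "\<And>e. L e > 0" "N \<ge> 1"
  shows "valid L N \<nu> \<longleftrightarrow> \<nu> < valid_bound L N"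
proof -
  have "piece_arg L N \<nu> e < pi\<^sup>2 / 4 \<longleftrightarrow> \<nu> < (pi * N / L e)\<^sup>2" for e
  proof -
    have "0 < (L e / (2 * N))\<^sup>2" using assms(1)[of e] assms(2) by simp
    then have "piece_arg L N \<nu> e < pi\<^sup>2 / 4 \<longleftrightarrow> \<nu> < pi\<^sup>2 / 4 / (L e / (2 * N))\<^sup>2"
      unfolding piece_arg_def by (simp only: pos_less_divide_eq)
    also have "pi\<^sup>2 / 4 / (L e / (2 * N))\<^sup>2 = (pi * N / L e)\<^sup>2"
      using assms(1)[of e] assms(2) by (simp add: power2_eq_square field_simps)
    finally show ?thesis .
  qed
  then show ?thesis by (auto simp: valid_def valid_bound_def)
qed

lemma mass_nonneg: "mass N x \<ge> 0"
  by (simp add: mass_def sum_nonneg)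

lemma mass_eq_0:
  assumes "mass N x = 0" "N \<ge> 1" "j \<le> N"
  shows "x e j = 0"
proof -
  have "(\<Sum>j<N. (cmod (x e j))\<^sup>2 + (cmod (x e (Suc j)))\<^sup>2) = 0"
    using assms(1) unfolding mass_def by (subst (asm) sum_nonneg_eq_0_iff) (auto simp: sum_nonneg)
  then have z: "(cmod (x e i))\<^sup>2 + (cmod (x e (Suc i)))\<^sup>2 = 0" if "i < N" for i
    using that by (subst (asm) sum_nonneg_eq_0_iff) auto
  show ?thesis
  proof (cases "j < N")
    case True
    then show ?thesis using z[of j] by (simp add: sum_power2_eq_zero_iff)
  next
    case False
    then have "j = Suc (N - 1)" using assms by simp
    then show ?thesis using z[of "N - 1"] assms(2) by (simp add: sum_power2_eq_zero_iff)
  qed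
qed

lemma parallelogram: "(cmod (a - b))\<^sup>2 + (cmod (a + b))\<^sup>2 = 2 * ((cmod a)\<^sup>2 + (cmod b)\<^sup>2)"
  unfolding cmod_power2 by (simp add: power2_eq_square algebra_simps)

lemma stiff_lower_bound:
  fixes L :: "'e::finite \<Rightarrow> real"
  assumes L: "\<And>e. L e > 0"
    and c: "\<And>e. c * L e / 2 \<le> R e" "\<And>e. c * L e / 2 \<le> T e" "c \<ge> 0"
  shows "c * N * mass N x \<le> (\<Sum>e\<in>UNIV. \<Sum>j<N. N / L e *
     (R e * (cmod (x e j - x e (Suc j)))\<^sup>2 + T e * (cmod (x e j + x e (Suc j)))\<^sup>2))"
  unfolding mass_def sum_distrib_left
proof (intro sum_mono)
  fix e j
  let ?m = "(cmod (x e j - x e (Suc j)))\<^sup>2" and ?p = "(cmod (x e j + x e (Suc j)))\<^sup>2"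
  have "c * N * ((cmod (x e j))\<^sup>2 + (cmod (x e (Suc j)))\<^sup>2)
      = N / L e * (c * L e / 2 * (2 * ((cmod (x e j))\<^sup>2 + (cmod (x e (Suc j)))\<^sup>2)))"
    using L[of e] by simp
  also have "\<dots> = N / L e * (c * L e / 2 * ?m + c * L e / 2 * ?p)"
    unfolding parallelogram[symmetric] by (simp only: distrib_left)
  also have "\<dots> \<le> N / L e * (R e * ?m + T e * ?p)"
    using c L[of e] by (intro mult_left_mono add_mono mult_right_mono) auto
  finally show "c * N * ((cmod (x e j))\<^sup>2 + (cmod (x e (Suc j)))\<^sup>2) \<le> N / L e * (R e * ?m + T e * ?p)" .
qed

text \<open>
  The form decreases at a uniform positive rate on any interval that is bounded from below.
\<close>

lemma stiff_rate:
  fixes L :: "'e::finite \<Rightarrow> real"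
  assumes L: "\<And>e. L e > 0" and N: "N \<ge> 1"
  obtains c where "c > 0" "\<And>s t x. A \<le> s \<Longrightarrow> s \<le> t \<Longrightarrow> valid L N t \<Longrightarrow>
     c * (t - s) * mass N x \<le> Re (stiff L N s x x) - Re (stiff L N t x x)"
proof -
  define A' where "A' = Min (range (piece_arg L N A))"
  define l where "l = Min (range L)"
  have l: "l > 0" "\<And>e. l \<le> L e" using L by (auto simp: l_def)
  obtain c where c: "c > 0" "\<And>s t. A' \<le> s \<Longrightarrow> s \<le> t \<Longrightarrow> t < pi\<^sup>2 / 4 \<Longrightarrow> c * (t - s) \<le> rtan t - rtan s"
    "\<And>s t. A' \<le> s \<Longrightarrow> s \<le> t \<Longrightarrow> t < pi\<^sup>2 / 4 \<Longrightarrow> c * (t - s) \<le> rcot s - rcot t"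
    using rcot_rtan_rate[of A'] by blast
  define c' where "c' = c * l / (2 * N) / N"
  have c'0: "c' > 0" using c(1) l(1) N by (simp add: c'_def)
  show ?thesis
  proof (rule that)
    show "c' * N > 0" using c'0 N by simp
    fix s t x assume st: "A \<le> s" "s \<le> t" "valid L N t"
    have arg: "A' \<le> piece_arg L N s e" "piece_arg L N s e \<le> piece_arg L N t e" "piece_arg L N t e < pi\<^sup>2 / 4" for e
    proof -
      have "A' \<le> piece_arg L N A e" by (simp add: A'_def)
      also have "\<dots> \<le> piece_arg L N s e" using st by (simp add: piece_arg_def mult_right_mono)
      finally show "A' \<le> piece_arg L N s e" .
      show "piece_arg L N s e \<le> piece_arg L N t e" using st by (simp add: piece_arg_def mult_right_mono)
      show "piece_arg L N t e < pi\<^sup>2 / 4" using st by (simp add: valid_def)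
    qed
    have step: "c' * (t - s) * L e / 2 \<le> c * (piece_arg L N t e - piece_arg L N s e)" for e
    proof -
      have "c' * (t - s) * L e / 2 = (c * (t - s) * L e / (4 * N\<^sup>2)) * l"
        by (simp add: c'_def power2_eq_square)
      also have "\<dots> \<le> (c * (t - s) * L e / (4 * N\<^sup>2)) * L e"
        using l(2)[of e] c(1) st(2) L[of e] by (intro mult_left_mono) auto
      also have "\<dots> = c * (piece_arg L N t e - piece_arg L N s e)"
        unfolding piece_arg_def left_diff_distrib[symmetric] by (simp add: power2_eq_square)
      finally show ?thesis .
    qed
    have "c' * (t - s) * N * mass N x \<le> (\<Sum>e\<in>UNIV. \<Sum>j<N. N / L e *
     ((rcot (piece_arg L N s e) - rcot (piece_arg L N t e)) * (cmod (x e j - x e (Suc j)))\<^sup>2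
      + (rtan (piece_arg L N t e) - rtan (piece_arg L N s e)) * (cmod (x e j + x e (Suc j)))\<^sup>2))"
    proof (rule stiff_lower_bound[OF L])
      show "c' * (t - s) * L e / 2 \<le> rcot (piece_arg L N s e) - rcot (piece_arg L N t e)" for e
        by (rule order_trans[OF step c(3)[OF arg]])
      show "c' * (t - s) * L e / 2 \<le> rtan (piece_arg L N t e) - rtan (piece_arg L N s e)" for e
        by (rule order_trans[OF step c(2)[OF arg]])
      show "0 \<le> c' * (t - s)" using c'0 st(2) by simp
    qed
    also have "\<dots> = Re (stiff L N s x x) - Re (stiff L N t x x)"
      unfolding stiff_self Re_complex_of_real sum_subtractf[symmetric] by (intro sum.cong refl) (simp add: algebra_simps)
    finally show "c' * N * (t - s) * mass N x \<le> Re (stiff L N s x x) - Re (stiff L N t x x)"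
      by (simp add: mult_ac)
  qed
qed

lemma stiff_isCont:
  assumes "valid L N \<nu>"
  shows "((\<lambda>t. stiff L N t x y) \<longlongrightarrow> stiff L N \<nu> x y) (at \<nu>)"
proof -
  have arg: "((\<lambda>t. piece_arg L N t e) \<longlongrightarrow> piece_arg L N \<nu> e) (at \<nu>)" for e
    unfolding piece_arg_def by (intro tendsto_intros)
  have lt: "piece_arg L N \<nu> e < pi\<^sup>2 / 4" for e
    using assms by (simp add: valid_def)
  have "((\<lambda>t. rcot (piece_arg L N t e)) \<longlongrightarrow> rcot (piece_arg L N \<nu> e)) (at \<nu>)"
    "((\<lambda>t. rtan (piece_arg L N t e)) \<longlongrightarrow> rtan (piece_arg L N \<nu> e)) (at \<nu>)" for e
    by (rule isCont_tendsto_compose[OF isCont_rcot[OF lt] arg] isCont_tendsto_compose[OF isCont_rtan[OF lt] arg])+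
  then show ?thesis unfolding stiff_def by (intro tendsto_intros)
qed

locale quantum_graph = vertex_conditions P\<^sub>D P\<^sub>N P\<^sub>R \<Lambda>
  for P\<^sub>D P\<^sub>N P\<^sub>R \<Lambda> :: "complex ^ ('e::finite + 'e) ^ ('e + 'e)" +
  fixes len :: "'e \<Rightarrow> real"
  assumes len_pos: "len e > 0"
begin

lemma coupling_bound:
  assumes "N \<ge> 1"
  obtains K where "K > 0" "\<And>x. \<bar>Re (coupling (end_values N x) (end_values N x))\<bar> \<le> K * mass N x"
proof -
  define M where "M = P\<^sub>R ** \<Lambda> ** P\<^sub>R"
  define m where "m = Max (range (\<lambda>(i, j). cmod (M $ i $ j)))"
  have m: "cmod (M $ i $ j) \<le> m" for i j
    unfolding m_def by (rule Max_ge) (auto intro: image_eqI[of _ _ "(i, j)"])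
  have m0: "m \<ge> 0" using m order_trans[OF norm_ge_zero] by blast
  let ?K = "m * CARD('e + 'e)"
  have bound: "\<bar>Re (coupling (end_values N x) (end_values N x))\<bar> \<le> ?K * mass N x" for x
  proof -
    define G where "G = end_values N x"
    have "coupling G G = (\<Sum>i\<in>UNIV. \<Sum>j\<in>UNIV. cnj (G $ i) * G $ j * M $ i $ j)"
      unfolding coupling_def matrix_vector_mul_assoc M_def[symmetric]
      by (simp add: hinner_def matrix_vector_mult_def sum_distrib_left mult_ac matrix_mul_assoc M_def)
    then have "cmod (coupling G G) \<le> ?K * (\<Sum>i\<in>UNIV. (cmod (G $ i))\<^sup>2)"
      using bounded_perturbation[of UNIV "\<lambda>i j. M $ i $ j" m "\<lambda>i. G $ i"] m by simp
    also have "(\<Sum>i\<in>UNIV. (cmod (G $ i))\<^sup>2) \<le> mass N x"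
      unfolding sum_endpoints mass_def G_def end_values_def
    proof (simp, intro sum_mono)
      fix e
      have "(cmod (x e 0))\<^sup>2 \<le> (\<Sum>j<N. (cmod (x e j))\<^sup>2)"
        using assms by (intro member_le_sum) auto
      moreover have "(cmod (x e (Suc (N - 1))))\<^sup>2 \<le> (\<Sum>j<N. (cmod (x e (Suc j)))\<^sup>2)"
        using assms by (intro member_le_sum[where f = "\<lambda>j. (cmod (x e (Suc j)))\<^sup>2"]) auto
      ultimately show "(cmod (x e 0))\<^sup>2 + (cmod (x e N))\<^sup>2 \<le> (\<Sum>j<N. (cmod (x e j))\<^sup>2 + (cmod (x e (Suc j)))\<^sup>2)"
        using assms by (simp add: sum.distrib)
    qed
    finally have "cmod (coupling G G) \<le> ?K * mass N x" using m0 by (simp add: mult_left_mono)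
    then show ?thesis unfolding G_def using abs_Re_le_cmod order_trans by blast
  qed
  show ?thesis
  proof (rule that)
    show "?K + 1 > 0" using m0 by (simp add: add_nonneg_pos)
    show "\<bar>Re (coupling (end_values N x) (end_values N x))\<bar> \<le> (?K + 1) * mass N x" for x
      using bound[of x] mass_nonneg[of N x] by (simp add: algebra_simps)
  qed
qed

lemma nform_self: "Re (nform L N \<tau> \<epsilon> x x) = Re (stiff L N \<tau> x x) + \<epsilon> * Re (coupling (end_values N x) (end_values N x))"
  by (simp add: nform_def)

abbreviation nindex :: "nat \<Rightarrow> real \<Rightarrow> real \<Rightarrow> nat" where
  "nindex N \<epsilon> \<tau> \<equiv> node.index (nodal N) (nform len N \<tau> \<epsilon>)"

abbreviation nnullity :: "nat \<Rightarrow> real \<Rightarrow> real \<Rightarrow> nat" where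
  "nnullity N \<epsilon> \<tau> \<equiv> node.nullity (nodal N) (nform len N \<tau> \<epsilon>)"

lemma nodal_mass_pos:
  assumes "x \<in> nodal N" "x \<noteq> 0" "N \<ge> 1"
  shows "mass N x > 0"
proof (rule ccontr)
  assume "\<not> mass N x > 0"
  then have "mass N x = 0" using mass_nonneg[of N x] by simp
  then have "x e j = 0" for e j
    using mass_eq_0[OF _ assms(3)] assms(1) by (cases "j \<le> N") (auto simp: nodal_def)
  then show False using assms(2) by (simp add: fun_eq_iff)
qed

lemma nform_tendsto:
  assumes "valid len N \<tau>"
  shows "((\<lambda>t. nform len N t \<epsilon> x y) \<longlongrightarrow> nform len N \<tau> \<epsilon> x y) (at \<tau>)"
  unfolding nform_def by (intro tendsto_intros stiff_isCont assms)

lemma nindex_jumps_on: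
  assumes N: "N \<ge> 1"
  shows "jumps_on {..<valid_bound len N} (nindex N \<epsilon>) (nnullity N \<epsilon>)"
proof (rule node.index_jumps_on[OF nodal_fin_dim])
  note iff = valid_iff[of len N, OF len_pos N]
  have decr: "Re (nform len N t \<epsilon> x x) \<le> Re (nform len N s \<epsilon> x x)"
    "x \<in> nodal N \<Longrightarrow> x \<noteq> 0 \<Longrightarrow> Re (nform len N t \<epsilon> x x) < Re (nform len N s \<epsilon> x x)"
    if "s < t" "t \<in> {..<valid_bound len N}" for s t x
  proof -
    obtain c where c: "c > 0" "\<And>r t x. s \<le> r \<Longrightarrow> r \<le> t \<Longrightarrow> valid len N t \<Longrightarrow>
     c * (t - r) * mass N x \<le> Re (stiff len N r x x) - Re (stiff len N t x x)"
      using stiff_rate[of len N s, OF len_pos N] by metis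
    have le: "c * (t - s) * mass N x \<le> Re (nform len N s \<epsilon> x x) - Re (nform len N t \<epsilon> x x)"
      unfolding nform_self using c(2)[of s t x] that iff by simp
    have "0 \<le> c * (t - s) * mass N x" using c(1) that mass_nonneg[of N x] by simp
    then show "Re (nform len N t \<epsilon> x x) \<le> Re (nform len N s \<epsilon> x x)" using le by linarith
    assume "x \<in> nodal N" "x \<noteq> 0"
    then have "0 < c * (t - s) * mass N x" using c(1) that nodal_mass_pos[OF _ _ N] by simp
    then show "Re (nform len N t \<epsilon> x x) < Re (nform len N s \<epsilon> x x)" using le by linarith
  qed
  show "Re (nform len N t \<epsilon> x x) \<le> Re (nform len N s \<epsilon> x x)"
    if "t \<in> {..<valid_bound len N}" "s < t" for s t x by (rule decr(1)[OF that(2,1)])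
  show "Re (nform len N t \<epsilon> x x) < Re (nform len N s \<epsilon> x x)"
    if "t \<in> {..<valid_bound len N}" "s < t" "x \<in> node.radical (nodal N) (nform len N s \<epsilon>)" "x \<noteq> 0" for s t x
    using that by (intro decr(2)) (auto simp: node.radical_def)
  show "((\<lambda>s. nform len N s \<epsilon> x y) \<longlongrightarrow> nform len N t \<epsilon> x y) (at t)" if "t \<in> {..<valid_bound len N}" for t x y
    using that iff by (intro nform_tendsto) auto
qed (auto intro: nform_hermitian)

text \<open>
  For \<open>a\<close> close to \<open>-\<infinity>\<close> both coefficients of \<open>stiff\<close> are large and outweigh the bounded coupling.
\<close>

lemma nindex_eventually_zero:
  assumes N: "N \<ge> 1"
  obtains a where "a < 0" "nindex N \<epsilon> a = 0"
proof -
  obtain K where K: "K > 0" "\<And>x. \<bar>Re (coupling (end_values N x) (end_values N x))\<bar> \<le> K * mass N x"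
    using coupling_bound[OF N] by blast
  define l where "l = Max (range len)"
  have l: "\<And>e. len e \<le> l" by (simp add: l_def)
  define c where "c = \<bar>\<epsilon>\<bar> * K + 1"
  have c0: "c > 0" using K(1) by (simp add: c_def add_nonneg_pos)
  obtain A where A: "A < 0" "\<And>s. s \<le> A \<Longrightarrow> c * l / 2 \<le> rcot s \<and> rtan s \<le> - (c * l / 2)"
    using rcot_rtan_at_bot[of "c * l / 2"] by blast
  define l0 where "l0 = Min (range len)"
  have l0: "l0 > 0" "\<And>e. l0 \<le> len e" using len_pos by (auto simp: l0_def)
  define a where "a = A / (l0 / (2 * N))\<^sup>2"
  have a0: "a < 0" using A(1) l0 N by (simp add: a_def divide_neg_pos)
  have arg: "piece_arg len N a e \<le> A" for e
  proof -
    have "A = a * (l0 / (2 * N))\<^sup>2" using l0 N by (simp add: a_def)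
    moreover have "(l0 / (2 * N))\<^sup>2 \<le> (len e / (2 * N))\<^sup>2"
      using l0 N by (intro power_mono divide_right_mono) (auto intro: less_imp_le)
    ultimately show ?thesis using a0 by (simp add: piece_arg_def mult_left_mono_neg)
  qed
  have "Re (nform len N a \<epsilon> x x) \<ge> 0" if "x \<in> nodal N" for x
  proof -
    have "c * N * mass N x \<le> (\<Sum>e\<in>UNIV. \<Sum>j<N. N / len e *
     (rcot (piece_arg len N a e) * (cmod (x e j - x e (Suc j)))\<^sup>2
      + (- rtan (piece_arg len N a e)) * (cmod (x e j + x e (Suc j)))\<^sup>2))"
    proof (rule stiff_lower_bound[OF len_pos])
      have "c * len e / 2 \<le> c * l / 2" for e using l[of e] c0 by simp
      then show "c * len e / 2 \<le> rcot (piece_arg len N a e)" "c * len e / 2 \<le> - rtan (piece_arg len N a e)" for e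
        using A(2)[OF arg[of e]] by (smt (verit))+
    qed (use c0 in simp)
    also have "\<dots> = Re (stiff len N a x x)" unfolding stiff_self by simp
    finally have 1: "c * N * mass N x \<le> Re (stiff len N a x x)" .
    have "\<bar>\<epsilon>\<bar> * K * mass N x \<le> c * mass N x" using mass_nonneg[of N x] by (intro mult_right_mono) (simp_all add: c_def)
    also have "\<dots> \<le> c * N * mass N x" using mass_nonneg[of N x] c0 N by (intro mult_right_mono) auto
    finally have 2: "\<bar>\<epsilon>\<bar> * K * mass N x \<le> Re (stiff len N a x x)" using 1 by linarith
    have "\<bar>\<epsilon> * Re (coupling (end_values N x) (end_values N x))\<bar> \<le> \<bar>\<epsilon>\<bar> * (K * mass N x)"
      unfolding abs_mult by (intro mult_left_mono K(2)) simp
    then show ?thesis unfolding nform_self using 2 by (simp add: mult_ac)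
  qed
  then have "nindex N \<epsilon> a \<le> card ({} :: nat set)"
    by (intro node.index_le_functionals[where \<phi> = "\<lambda>_ _. 0", OF nodal_fin_dim nform_hermitian]) auto
  then show ?thesis using that[OF a0] by simp
qed

text \<open>
  Nodal values that live on the odd interior nodes of a longest edge do not interact, because each
  piece has exactly one such end.  A piece then contributes a multiple of \<open>rcot - rtan\<close>, which is
  negative at \<open>(\<pi>/3)\<^sup>2\<close>, a point that is still below the admissible bound \<open>\<pi>\<^sup>2 / 4\<close>.
\<close>

lemma nindex_unbounded:
  obtains N \<tau> where "N \<ge> 1" "valid len N \<tau>" "n \<le> nindex N \<epsilon> \<tau>"
proof -
  obtain e0 where e0: "\<And>e. len e \<le> len e0"
  proof -
    have "Max (range len) \<in> range len" by (rule Max_in) auto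
    then obtain e where "len e = Max (range len)" by (metis rangeE)
    then show ?thesis using that[of e] by simp
  qed
  define N where "N = 2 * Suc n"
  have N: "N \<ge> 1" by (simp add: N_def)
  (* on the longest edge e0 the dimensionless parameter is (pi/3)^2, on the others it is smaller *)
  define \<tau> where "\<tau> = (pi / 3)\<^sup>2 / (len e0 / (2 * N))\<^sup>2"
  have arg0: "piece_arg len N \<tau> e0 = (pi / 3)\<^sup>2"
    using len_pos[of e0] N by (simp add: piece_arg_def \<tau>_def)
  have va: "valid len N \<tau>" unfolding valid_def
  proof
    fix e
    have "piece_arg len N \<tau> e \<le> piece_arg len N \<tau> e0"
      unfolding piece_arg_def using e0[of e] len_pos[of e]
      by (intro mult_left_mono power_mono divide_right_mono) (auto simp: \<tau>_def less_imp_le)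
    also have "\<dots> < pi\<^sup>2 / 4" unfolding arg0 by (simp add: power_divide)
    finally show "piece_arg len N \<tau> e < pi\<^sup>2 / 4" .
  qed
  define u where "u m e j = (if e = e0 \<and> j = 2 * m + 1 then 1 else 0 :: complex)" for m j :: nat and e :: 'e
  define W where "W = {x :: 'e \<Rightarrow> nat \<Rightarrow> complex. \<forall>e j. x e j \<noteq> 0 \<longrightarrow> e = e0 \<and> odd j \<and> j < N}"
  have ends: "end_values N x = 0" if "x \<in> W" for x
  proof -
    have "x e 0 = 0" "x e N = 0" for e using that by (auto simp: W_def)
    then show ?thesis by (simp add: end_values_def vec_eq_iff split: sum.split)
  qed
  have WV: "W \<subseteq> nodal N"
    unfolding nodal_def using ends by (auto simp: W_def) (metis less_asym)
  have Wsub: "node.subspace W"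
    unfolding node.subspace_def W_def by (auto simp: node_scale_def) (metis add.right_neutral add.left_neutral)+
  have uW: "u m \<in> W" if "m < n" for m using that by (auto simp: W_def u_def N_def)
  have inj: "inj_on u {..<n}"
  proof (rule inj_onI)
    fix i k assume "u i = u k"
    then have "u i e0 (2 * i + 1) = u k e0 (2 * i + 1)" by simp
    then show "i = k" by (simp add: u_def split: if_splits)
  qed
  have ind: "node.independent (u ` {..<n})"
  proof (rule node.independent_if_scalars_zero)
    fix f x assume zero: "(\<Sum>v\<in>u ` {..<n}. node_scale (f v) v) = 0" and "x \<in> u ` {..<n}"
    then obtain m where m: "x = u m" "m < n" by auto
    have "(\<Sum>v\<in>u ` {..<n}. node_scale (f v) v) = (\<Sum>i<n. node_scale (f (u i)) (u i))"
      by (simp add: sum.reindex[OF inj])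
    then have "(\<Sum>i<n. node_scale (f (u i)) (u i)) e0 (2 * m + 1) = 0" using zero by simp
    moreover have "(\<Sum>i<n. node_scale (f (u i)) (u i)) e0 (2 * m + 1) = (\<Sum>i<n. node_scale (f (u i)) (u i) e0 (2 * m + 1))"
      by (induction n) auto
    moreover have "\<dots> = (\<Sum>i<n. if i = m then f (u m) else 0)"
      by (intro sum.cong) (auto simp: node_scale_def u_def)
    ultimately show "f x = 0" using m by simp
  qed simp
  have neg: "Re (nform len N \<tau> \<epsilon> x x) < 0" if x: "x \<in> W" "x \<noteq> 0" for x
  proof -
    let ?R = "rcot (piece_arg len N \<tau> e0)" and ?T = "rtan (piece_arg len N \<tau> e0)"
    have "Re (nform len N \<tau> \<epsilon> x x) = Re (stiff len N \<tau> x x)"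
      unfolding nform_self ends[OF x(1)] by (simp add: coupling_def)
    also have "\<dots> = (\<Sum>e\<in>UNIV. \<Sum>j<N. N / len e0 * (?R - ?T) * ((cmod (x e j))\<^sup>2 + (cmod (x e (Suc j)))\<^sup>2))"
      unfolding stiff_self Re_complex_of_real
    proof (intro sum.cong refl)
      fix e j
      show "N / len e * (rcot (piece_arg len N \<tau> e) * (cmod (x e j - x e (Suc j)))\<^sup>2
         - rtan (piece_arg len N \<tau> e) * (cmod (x e j + x e (Suc j)))\<^sup>2)
        = N / len e0 * (?R - ?T) * ((cmod (x e j))\<^sup>2 + (cmod (x e (Suc j)))\<^sup>2)"
      proof (cases "e = e0")
        case True
        have "odd i" if "x e i \<noteq> 0" for i using x(1) that by (auto simp: W_def)
        then have "x e j = 0 \<or> x e (Suc j) = 0" by (metis even_Suc)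
        then show ?thesis unfolding True by (auto simp: algebra_simps)
      next
        case False
        then have "x e j = 0" "x e (Suc j) = 0" using x(1) by (auto simp: W_def)
        then show ?thesis by simp
      qed
    qed
    also have "\<dots> = N / len e0 * (?R - ?T) * mass N x"
      by (simp add: mass_def sum_distrib_left)
    also have "\<dots> < 0"
      using rcot_less_rtan nodal_mass_pos[of x N] x WV N len_pos[of e0] unfolding arg0
      by (intro mult_neg_pos mult_pos_neg) auto
    finally show ?thesis .
  qed
  have "node.negative_family (nodal N) (nform len N \<tau> \<epsilon>) (u ` {..<n})"
    unfolding node.negative_family_def
  proof (intro conjI ballI impI)
    show "u ` {..<n} \<subseteq> nodal N" using uW WV by auto
    have "node.span (u ` {..<n}) \<subseteq> W" using uW Wsub by (intro node.span_minimal) auto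
    then show "Re (nform len N \<tau> \<epsilon> x x) < 0" if "x \<in> node.span (u ` {..<n})" "x \<noteq> 0" for x
      using neg that by auto
  qed (use ind in auto)
  then have "card (u ` {..<n}) \<le> nindex N \<epsilon> \<tau>" by (rule node.index_ge[OF nodal_fin_dim nform_hermitian])
  then have "n \<le> nindex N \<epsilon> \<tau>" by (simp add: card_image[OF inj])
  then show ?thesis using that N va by blast
qed

end

section \<open>Enumeration of the eigenvalues and the fast eigenvalues\<close>

context quantum_graph
begin

lemma valid_exists: "\<exists>N\<ge>1. valid len N \<tau>"
proof -
  define l where "l = Max (range len)"
  have l: "len e \<le> l" for e by (simp add: l_def)
  obtain N where N: "\<bar>\<tau>\<bar> * l\<^sup>2 \<le> real N" using real_arch_simple by blast
  define M where "M = Suc N"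
  have M: "\<bar>\<tau>\<bar> * l\<^sup>2 \<le> real M" "M \<ge> 1" using N by (simp_all add: M_def)
  have "piece_arg len M \<tau> e < pi\<^sup>2 / 4" for e
  proof -
    have "piece_arg len M \<tau> e \<le> \<bar>\<tau>\<bar> * (len e)\<^sup>2 / (4 * (real M)\<^sup>2)"
      unfolding piece_arg_def power_divide power_mult_distrib using abs_ge_self[of \<tau>]
      by (simp add: divide_right_mono mult_right_mono)
    also have "\<dots> \<le> \<bar>\<tau>\<bar> * l\<^sup>2 / (4 * (real M)\<^sup>2)"
      using l[of e] len_pos[of e] by (intro divide_right_mono mult_left_mono power_mono) auto
    also have "\<dots> \<le> real M / (4 * (real M)\<^sup>2)"
      using M by (intro divide_right_mono) auto
    also have "\<dots> \<le> 1 / 4" using M(2) by (simp add: power2_eq_square field_simps)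
    also have "1 / 4 < pi\<^sup>2 / 4"
      using power_strict_mono[of 1 pi 2] pi_gt3 by simp
    finally show ?thesis .
  qed
  then show ?thesis using M(2) by (auto simp: valid_def)
qed

lemma valid_antimono:
  assumes "valid len N t" "s \<le> t" shows "valid len N s"
proof -
  have "piece_arg len N s e \<le> piece_arg len N t e" for e
    using assms(2) by (simp add: piece_arg_def mult_right_mono)
  then show ?thesis using assms(1) unfolding valid_def by (meson le_less_trans)
qed

lemma valid_bound_pos: "N \<ge> 1 \<Longrightarrow> 0 < valid_bound len N"
  using valid_iff[of len N 0, OF len_pos] by (simp add: valid_def piece_arg_def)

text \<open>
  Multiplicity and counting function of the spectrum, both in the scaled parameter \<open>\<tau> = \<epsilon>\<^sup>2 \<lambda>\<close>.  Any
  admissible number of pieces gives the same count (\<open>eig_count_eq\<close>).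
\<close>

definition eig_mult :: "real \<Rightarrow> real \<Rightarrow> nat" where
  "eig_mult \<epsilon> \<tau> = edge_fun.dim (eigenspace (graph_laplacian (\<lambda>e. \<epsilon> * len e) P\<^sub>D P\<^sub>N P\<^sub>R \<Lambda>) (of_real (\<tau> / \<epsilon>\<^sup>2)))"

definition eig_count :: "real \<Rightarrow> real \<Rightarrow> nat" where
  "eig_count \<epsilon> \<tau> = nindex (SOME N. N \<ge> 1 \<and> valid len N \<tau>) \<epsilon> \<tau>"

definition lam :: "real \<Rightarrow> nat \<Rightarrow> real" where
  "lam \<epsilon> n = level UNIV (eig_count \<epsilon>) n / \<epsilon>\<^sup>2"

lemma eig_mult_eq:
  assumes "\<epsilon> > 0" "N \<ge> 1" "valid len N \<tau>"
  shows "eig_mult \<epsilon> \<tau> = nnullity N \<epsilon> \<tau>"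
proof -
  have t: "\<epsilon>\<^sup>2 * (\<tau> / \<epsilon>\<^sup>2) = \<tau>" using assms(1) by simp
  have "eig_mult \<epsilon> \<tau> = node.nullity (nodal N) (nform (\<lambda>e. \<epsilon> * len e) N (\<tau> / \<epsilon>\<^sup>2) 1)"
    unfolding eig_mult_def using assms len_pos nullity_rescale(2)[OF assms(1), of len N "\<tau> / \<epsilon>\<^sup>2"] t
    by (intro eigenspace_dim) auto
  also have "\<dots> = nnullity N \<epsilon> \<tau>" unfolding nullity_rescale(1)[OF assms(1)] t ..
  finally show ?thesis .
qed

text \<open>
  The right-hand side does not mention \<open>N\<close>.
\<close>

lemma nindex_eq_sum:
  assumes "\<epsilon> > 0" "N \<ge> 1" "valid len N \<tau>"
  shows "nindex N \<epsilon> \<tau> = sum (eig_mult \<epsilon>) {y. y < \<tau> \<and> eig_mult \<epsilon> y \<noteq> 0}"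
proof -
  obtain a where a: "a < 0" "nindex N \<epsilon> a = 0" using nindex_eventually_zero[OF assms(2)] by blast
  have iff: "valid len N t \<longleftrightarrow> t < valid_bound len N" for t by (rule valid_iff[OF len_pos assms(2)])
  have "nindex N \<epsilon> \<tau> = sum (nnullity N \<epsilon>) {y. y < \<tau> \<and> nnullity N \<epsilon> y \<noteq> 0}"
  proof (rule jumps_on_sum[OF nindex_jumps_on[OF assms(2)], THEN conjunct2])
    show "a \<in> {..<valid_bound len N}" using a(1) valid_bound_pos[OF assms(2)] by simp
    show "\<tau> \<in> {..<valid_bound len N}" using assms(3) iff by simp
  qed (use a(2) in auto)
  also have "\<dots> = sum (eig_mult \<epsilon>) {y. y < \<tau> \<and> eig_mult \<epsilon> y \<noteq> 0}"
    using eig_mult_eq[OF assms(1,2) valid_antimono[OF assms(3)]] by (intro sum.cong) auto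
  finally show ?thesis .
qed

lemma eig_count_eq:
  assumes "\<epsilon> > 0" "N \<ge> 1" "valid len N \<tau>"
  shows "eig_count \<epsilon> \<tau> = nindex N \<epsilon> \<tau>"
proof -
  have "(SOME N. N \<ge> 1 \<and> valid len N \<tau>) \<ge> 1 \<and> valid len (SOME N. N \<ge> 1 \<and> valid len N \<tau>) \<tau>"
    using valid_exists by (rule someI_ex[where P = "\<lambda>N. N \<ge> 1 \<and> valid len N \<tau>", simplified Bex_def])
  then show ?thesis using nindex_eq_sum[OF assms(1)] assms by (simp add: eig_count_def)
qed

lemma eig_count_jumps_on:
  assumes "\<epsilon> > 0"
  shows "jumps_on UNIV (eig_count \<epsilon>) (eig_mult \<epsilon>)"
  unfolding jumps_on_def
proof (intro conjI ballI)
  show "mono_on UNIV (eig_count \<epsilon>)"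
  proof (rule mono_onI)
    fix s t :: real assume "s \<le> t"
    obtain N where N: "N \<ge> 1" "valid len N t" using valid_exists by blast
    note v = valid_antimono[OF N(2) \<open>s \<le> t\<close>]
    have "mono_on {..<valid_bound len N} (nindex N \<epsilon>)"
      using nindex_jumps_on[OF N(1), of \<epsilon>] by (simp add: jumps_on_def)
    moreover have "s \<in> {..<valid_bound len N}" "t \<in> {..<valid_bound len N}"
      using v N(2) valid_iff[of len N, OF len_pos N(1)] by simp_all
    ultimately have "nindex N \<epsilon> s \<le> nindex N \<epsilon> t"
      using \<open>s \<le> t\<close> by (rule mono_onD)
    then show "eig_count \<epsilon> s \<le> eig_count \<epsilon> t" using eig_count_eq[OF assms N] eig_count_eq[OF assms N(1) v] by simp
  qed
  fix t :: real
  obtain N where N: "N \<ge> 1" "valid len N t" using valid_exists by blast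
  note iff = valid_iff[of len N, OF len_pos N(1)]
  have tb: "t < valid_bound len N" using N(2) iff by simp
  have ev: "\<forall>\<^sub>F s in at t within A. eig_count \<epsilon> s = nindex N \<epsilon> s" for A
  proof -
    have "\<forall>\<^sub>F s in nhds t. s \<in> {..<valid_bound len N}"
      using tb by (intro eventually_nhds_in_open) auto
    then have "\<forall>\<^sub>F s in at t within A. s \<in> {..<valid_bound len N}"
      by (auto simp: eventually_at_filter elim: eventually_mono)
    then show ?thesis by eventually_elim (use eig_count_eq[OF assms N(1)] iff in auto)
  qed
  have J: "\<forall>\<^sub>F s in at_left t. nindex N \<epsilon> s = nindex N \<epsilon> t"
    "\<forall>\<^sub>F s in at_right t. nindex N \<epsilon> s = nindex N \<epsilon> t + nnullity N \<epsilon> t"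
    using nindex_jumps_on[OF N(1), of \<epsilon>] tb by (auto simp: jumps_on_def)
  show "\<forall>\<^sub>F s in at_left t. eig_count \<epsilon> s = eig_count \<epsilon> t"
    using ev J(1) by eventually_elim (simp add: eig_count_eq[OF assms N])
  show "\<forall>\<^sub>F s in at_right t. eig_count \<epsilon> s = eig_count \<epsilon> t + eig_mult \<epsilon> t"
    using ev J(2) by eventually_elim (simp add: eig_count_eq[OF assms N] eig_mult_eq[OF assms N])
qed

lemma eig_count_zero:
  assumes "\<epsilon> > 0" obtains a where "eig_count \<epsilon> a = 0"
proof -
  obtain a where a: "a < 0" "nindex 1 \<epsilon> a = 0" using nindex_eventually_zero[of 1 \<epsilon>] by auto
  have "valid len 1 a" using valid_iff[of len 1 a, OF len_pos] valid_bound_pos[of 1] a(1) by simp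
  then show ?thesis using that[of a] eig_count_eq[OF assms, of 1 a] a(2) by simp
qed

lemma eig_count_unbounded:
  assumes "\<epsilon> > 0" shows "\<exists>t. n \<le> eig_count \<epsilon> t"
  using nindex_unbounded[of n \<epsilon>] eig_count_eq[OF assms] by metis

lemma lam_less_iff:
  assumes "\<epsilon> > 0" "1 \<le> n"
  shows "\<epsilon>\<^sup>2 * lam \<epsilon> n < t \<longleftrightarrow> n \<le> eig_count \<epsilon> t"
proof -
  obtain a where a: "eig_count \<epsilon> a = 0" using eig_count_zero[OF assms(1)] .
  obtain b where b: "n \<le> eig_count \<epsilon> b" using eig_count_unbounded[OF assms(1)] by blast
  have "\<epsilon>\<^sup>2 * lam \<epsilon> n = level UNIV (eig_count \<epsilon>) n" using assms(1) by (simp add: lam_def)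
  then show ?thesis using level_less_iff[OF eig_count_jumps_on[OF assms(1)], of a n b t] a assms(2) b by simp
qed

lemma lam_enumerates:
  assumes "\<epsilon> > 0"
  shows "enumerates_eigenvalues (graph_laplacian (\<lambda>e. \<epsilon> * len e) P\<^sub>D P\<^sub>N P\<^sub>R \<Lambda>) (lam \<epsilon>)"
  unfolding enumerates_eigenvalues_def
proof (intro conjI allI)
  obtain a where a: "eig_count \<epsilon> a = 0" using eig_count_zero[OF assms] .
  note E = level_enumerates[OF eig_count_jumps_on[OF assms] a eig_count_unbounded[OF assms]]
  have e2: "\<epsilon>\<^sup>2 > 0" using assms by simp
  show "mono_on {1..} (lam \<epsilon>)"
    using E(1) assms by (auto simp: mono_on_def lam_def divide_right_mono)
  fix z
  let ?S = "{n \<in> {1..}. complex_of_real (lam \<epsilon> n) = z}"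
  let ?H = "graph_laplacian (\<lambda>e. \<epsilon> * len e) P\<^sub>D P\<^sub>N P\<^sub>R \<Lambda>"
  have "finite ?S \<and> card ?S = edge_fun.dim (eigenspace ?H z)"
  proof (cases "Im z = 0")
    case True
    then have z: "z = of_real (Re z)" by (simp add: complex_eq_iff)
    define t where "t = \<epsilon>\<^sup>2 * Re z"
    have "?S = {n \<in> {1..}. level UNIV (eig_count \<epsilon>) n = t}"
    proof (intro Collect_cong conj_cong refl)
      fix n
      have "complex_of_real (lam \<epsilon> n) = z \<longleftrightarrow> lam \<epsilon> n = Re z" using True by (simp add: complex_eq_iff)
      also have "\<dots> \<longleftrightarrow> level UNIV (eig_count \<epsilon>) n = t" using e2 by (simp add: lam_def t_def divide_eq_eq mult.commute)
      finally show "complex_of_real (lam \<epsilon> n) = z \<longleftrightarrow> level UNIV (eig_count \<epsilon>) n = t" .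
    qed
    also have "\<dots> = {eig_count \<epsilon> t + 1..eig_count \<epsilon> t + eig_mult \<epsilon> t}" by (rule E(2))
    finally have S: "?S = {eig_count \<epsilon> t + 1..eig_count \<epsilon> t + eig_mult \<epsilon> t}" .
    have "eig_mult \<epsilon> t = edge_fun.dim (eigenspace ?H (of_real (Re z)))"
      using assms by (simp add: eig_mult_def t_def)
    then show ?thesis unfolding S using z by simp
  next
    case False
    then have "?S = {}" by auto
    moreover have "eigenspace ?H z \<subseteq> {0}"
      using assms len_pos by (intro eigenspace_nonreal False) simp
    then have "edge_fun.dim (eigenspace ?H z) = 0"
      using edge_fun.dim_le_card[of "eigenspace ?H z" "{}"] by simp
    ultimately show ?thesis by (simp only: card.empty finite.emptyI simp_thms)
  qed
  then show "finite ?S" "card ?S = edge_fun.dim (eigenspace ?H z)" by auto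
qed

definition edge_const :: "nat \<Rightarrow> complex ^ ('e + 'e) \<Rightarrow> ('e \<Rightarrow> nat \<Rightarrow> complex)" where
  "edge_const N F = (\<lambda>e j. if j \<le> N then F $ Inl e else 0)"

definition F0 :: "(complex ^ ('e + 'e)) set" where
  "F0 = edgewise_constant \<inter> {F. P\<^sub>D *v F = 0}"

lemma edge_const_linear: "Vector_Spaces.linear (*s) node_scale (edge_const N)"
  unfolding Vector_Spaces.linear_iff
  by (intro conjI allI) (auto simp: edge_const_def fun_eq_iff node_scale_def vec.vector_space_axioms node.vector_space_axioms)

lemma F0_subspace: "vec.subspace F0"
  unfolding vec.subspace_def F0_def edgewise_constant_def
  by (auto simp: matrix_vector_right_distrib vec.scale)

lemma end_values_edge_const: "F \<in> F0 \<Longrightarrow> end_values N (edge_const N F) = F"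
  by (auto simp: end_values_def edge_const_def F0_def edgewise_constant_def vec_eq_iff split: sum.split)

lemma edge_const_inj: "inj_on (edge_const N) F0"
  by (rule inj_on_inverseI[of _ "end_values N"]) (rule end_values_edge_const)

lemma edge_const_nodal: "F \<in> F0 \<Longrightarrow> edge_const N F \<in> nodal N"
  unfolding nodal_def using end_values_edge_const[of F N] by (auto simp: F0_def edge_const_def)

lemma stiff_0_self: "Re (stiff len N 0 x x) = (\<Sum>e\<in>UNIV. \<Sum>j<N. N / len e * (cmod (x e j - x e (Suc j)))\<^sup>2)"
  unfolding stiff_self by (simp add: piece_arg_def)

lemma stiff_0_nonneg: "0 \<le> Re (stiff len N 0 x x)"
  unfolding stiff_0_self using len_pos by (intro sum_nonneg mult_nonneg_nonneg) (auto intro: less_imp_le)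

lemma stiff_0_edge_const: "stiff len N 0 y (edge_const N F) = 0"
  unfolding stiff_def by (intro sum.neutral ballI) (simp add: piece_arg_def edge_const_def)

lemma stiff_0_eq_0:
  assumes x: "x \<in> nodal N" and z: "Re (stiff len N 0 x x) = 0"
  shows "x \<in> edge_const N ` F0"
proof -
  have nn: "0 \<le> N / len e * (cmod (x e j - x e (Suc j)))\<^sup>2" for e j
    using len_pos[of e] by simp
  have "(\<Sum>j<N. N / len e * (cmod (x e j - x e (Suc j)))\<^sup>2) = 0" for e
    using z nn unfolding stiff_0_self by (subst (asm) sum_nonneg_eq_0_iff) (auto intro!: sum_nonneg)
  then have "N / len e * (cmod (x e j - x e (Suc j)))\<^sup>2 = 0" if "j < N" for e j
    using that nn by (subst (asm) sum_nonneg_eq_0_iff) auto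
  then have step: "x e (Suc j) = x e j" if "j < N" for e j
    using that len_pos[of e] by (metis divide_eq_0_iff eq_iff_diff_eq_0 less_irrefl mult_eq_0_iff norm_eq_zero not_less_zero of_nat_eq_0_iff power_eq_0_iff)
  have const: "x e j = x e 0" if "j \<le> N" for e j
    using that by (induction j) (use step in auto)
  have "end_values N x \<in> F0"
    using x const[of N] by (simp add: F0_def edgewise_constant_def nodal_def) (simp add: end_values_def)
  moreover have "x = edge_const N (end_values N x)"
  proof (intro ext)
    fix e j
    show "x e j = edge_const N (end_values N x) e j"
      using x const[of j e] by (cases "j \<le> N") (simp_all add: edge_const_def end_values_def nodal_def)
  qed
  ultimately show ?thesis by (metis image_eqI)
qed

text \<open>
  At \<open>\<tau> = \<epsilon> = 0\<close> only the squares of differences of neighbouring nodal values remain, so the form is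
  nonnegative and its kernel consists of the edgewise constant vectors.
\<close>

lemma nullity_unperturbed:
  shows "nindex N 0 0 = 0" "nnullity N 0 0 = vec.dim F0"
proof -
  interpret p: complex_space_pair "(*s) :: complex \<Rightarrow> complex ^ ('e + 'e) \<Rightarrow> _" "node_scale :: complex \<Rightarrow> ('e \<Rightarrow> nat \<Rightarrow> complex) \<Rightarrow> _"
    by intro_locales
  have eq: "nform len N 0 0 = stiff len N 0" by (simp add: nform_def fun_eq_iff)
  have "nindex N 0 0 \<le> card ({} :: nat set)"
    by (rule node.index_le_functionals[where \<phi> = "\<lambda>_ _. 0", OF nodal_fin_dim nform_hermitian])
      (auto simp: eq stiff_0_nonneg)
  then show "nindex N 0 0 = 0" by simp
  have "node.radical (nodal N) (nform len N 0 0) = edge_const N ` F0"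
    unfolding eq node.radical_def
  proof (intro equalityI subsetI)
    fix x assume "x \<in> {x \<in> nodal N. \<forall>y\<in>nodal N. stiff len N 0 y x = 0}"
    then show "x \<in> edge_const N ` F0" by (intro stiff_0_eq_0) auto
  next
    fix x assume "x \<in> edge_const N ` F0"
    then show "x \<in> {x \<in> nodal N. \<forall>y\<in>nodal N. stiff len N 0 y x = 0}"
      using edge_const_nodal stiff_0_edge_const by auto
  qed
  then show "nnullity N 0 0 = vec.dim F0"
    using p.dim_inj_image[OF edge_const_linear F0_subspace edge_const_inj] by (simp add: node.nullity_def)
qed

text \<open>
  With \<open>k\<close> the quotient of the bound on the coupling and the rate of decrease, the nodal forms satisfy
  \<open>nform (s + k \<epsilon>) \<epsilon> \<le> nform s 0 \<le> nform (s - k \<epsilon>) \<epsilon>\<close>; so the counting functions, and with them the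
  eigenvalues, differ by a shift of at most \<open>k \<epsilon>\<close>.
\<close>

lemma fast_eigenvalues:
  assumes n: "vec.dim F0 < n"
  shows "\<exists>\<mu>>0. (\<lambda>\<epsilon>. lam \<epsilon> n - \<mu> / \<epsilon>\<^sup>2) \<in> O[at_right 0](\<lambda>\<epsilon>. 1 / \<epsilon>)"
proof -
  have n1: "1 \<le> n" using n by simp
  obtain N b where N: "N \<ge> 1" and b: "valid len N b" "n \<le> nindex N 0 b" using nindex_unbounded .
  define B where "B = valid_bound len N"
  have iff: "valid len N t \<longleftrightarrow> t < B" for t unfolding B_def by (rule valid_iff[OF len_pos N])
  have B0: "0 < B" using valid_bound_pos[OF N] by (simp add: B_def)
  define \<mu> where "\<mu> = level {..<B} (nindex N 0) n"
  note J = nindex_jumps_on[OF N, of 0, folded B_def]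
  have lev: "\<mu> < t \<longleftrightarrow> n \<le> nindex N 0 t" if "t < B" for t
    unfolding \<mu>_def
  proof (rule level_less_iff[OF J])
    show "nindex N 0 0 < n" using nullity_unperturbed(1)[of N] n1 by linarith
    show "b \<in> {..<B}" using b(1) iff by simp
  qed (use B0 b(2) that in auto)
  have \<mu>B: "\<mu> < B" using lev[of b] b iff by auto
  have "\<mu> > 0"
  proof -
    have "\<forall>\<^sub>F s in at_right 0. nindex N 0 s = nindex N 0 0 + nnullity N 0 0"
      using J B0 by (auto simp: jumps_on_def)
    moreover have "\<forall>\<^sub>F s in at_right 0. s \<in> {0<..<B}" using B0 by (rule eventually_at_right_real)
    ultimately have "\<forall>\<^sub>F s in at_right 0. nindex N 0 s = vec.dim F0 \<and> s \<in> {0<..<B}"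
      by eventually_elim (simp add: nullity_unperturbed)
    then obtain s where s: "nindex N 0 s = vec.dim F0" "s \<in> {0<..<B}"
      using eventually_happens'[of "at_right (0::real)"] by (auto simp: trivial_limit_at_right_real)
    then have "\<not> \<mu> < s" using lev[of s] n by simp
    then show ?thesis using s by simp
  qed
  obtain K where K: "K > 0" "\<And>x. \<bar>Re (coupling (end_values N x) (end_values N x))\<bar> \<le> K * mass N x"
    using coupling_bound[OF N] by blast
  obtain c where c: "c > 0" "\<And>s t x. \<mu> - 1 \<le> s \<Longrightarrow> s \<le> t \<Longrightarrow> valid len N t \<Longrightarrow>
     c * (t - s) * mass N x \<le> Re (stiff len N s x x) - Re (stiff len N t x x)"
    using stiff_rate[of len N "\<mu> - 1", OF len_pos N] by blast
  define k where "k = K / c"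
  have k0: "k > 0" using K c by (simp add: k_def)
  have coup: "\<bar>\<epsilon> * Re (coupling (end_values N x) (end_values N x))\<bar> \<le> c * (k * \<epsilon>) * mass N x" if "\<epsilon> > 0" for \<epsilon> x
  proof -
    have "\<bar>\<epsilon> * Re (coupling (end_values N x) (end_values N x))\<bar> \<le> \<epsilon> * (K * mass N x)"
      unfolding abs_mult using that by (intro mult_mono K(2)) auto
    also have "\<dots> = c * (k * \<epsilon>) * mass N x" using c(1) by (simp add: k_def)
    finally show ?thesis .
  qed
  (* the first entry keeps mu - k eps above mu - 1, the second keeps mu + (1 + k) eps below the bound B *)
  define e0 where "e0 = min (1 / k) ((B - \<mu>) / (1 + k))"
  have e0: "e0 > 0" using k0 \<mu>B by (simp add: e0_def)
  have close: "\<bar>\<epsilon>\<^sup>2 * lam \<epsilon> n - \<mu>\<bar> \<le> (1 + k) * \<epsilon>" if e: "0 < \<epsilon>" "\<epsilon> < e0" for \<epsilon>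
  proof -
    have ke: "k * \<epsilon> \<le> 1" "\<mu> + (1 + k) * \<epsilon> < B" "k * \<epsilon> > 0"
      using e k0 by (auto simp: e0_def field_simps)
    have ea: "\<mu> + \<epsilon> + k * \<epsilon> < B" using ke by (simp add: algebra_simps)
    have "nindex N \<epsilon> (\<mu> - k * \<epsilon>) \<le> nindex N 0 \<mu>"
    proof (rule node.index_mono[OF nodal_fin_dim nform_hermitian nform_hermitian])
      fix x
      have "c * (\<mu> - (\<mu> - k * \<epsilon>)) * mass N x \<le> Re (stiff len N (\<mu> - k * \<epsilon>) x x) - Re (stiff len N \<mu> x x)"
        using ke \<mu>B iff by (intro c(2)) auto
      then show "Re (nform len N \<mu> 0 x x) \<le> Re (nform len N (\<mu> - k * \<epsilon>) \<epsilon> x x)"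
        using coup[OF e(1), of x] unfolding nform_self by simp
    qed
    also have "nindex N 0 \<mu> < n" using lev[OF \<mu>B] by simp
    finally have "\<not> n \<le> eig_count \<epsilon> (\<mu> - k * \<epsilon>)"
      using eig_count_eq[OF e(1) N, of "\<mu> - k * \<epsilon>"] iff ke \<mu>B by simp
    then have 1: "\<mu> - k * \<epsilon> \<le> \<epsilon>\<^sup>2 * lam \<epsilon> n" using lam_less_iff[OF e(1) n1] by (meson not_less)
    (* the count reaches n only to the right of mu; the extra eps is harmless *)
    have "n \<le> nindex N 0 (\<mu> + \<epsilon>)" using lev[of "\<mu> + \<epsilon>"] e ea ke by simp
    also have "\<dots> \<le> nindex N \<epsilon> (\<mu> + \<epsilon> + k * \<epsilon>)"
    proof (rule node.index_mono[OF nodal_fin_dim nform_hermitian nform_hermitian])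
      fix x
      have "c * (\<mu> + \<epsilon> + k * \<epsilon> - (\<mu> + \<epsilon>)) * mass N x \<le> Re (stiff len N (\<mu> + \<epsilon>) x x) - Re (stiff len N (\<mu> + \<epsilon> + k * \<epsilon>) x x)"
        using ke ea iff e by (intro c(2)) auto
      then show "Re (nform len N (\<mu> + \<epsilon> + k * \<epsilon>) \<epsilon> x x) \<le> Re (nform len N (\<mu> + \<epsilon>) 0 x x)"
        using coup[OF e(1), of x] unfolding nform_self by simp
    qed
    finally have "n \<le> eig_count \<epsilon> (\<mu> + \<epsilon> + k * \<epsilon>)"
      using eig_count_eq[OF e(1) N, of "\<mu> + \<epsilon> + k * \<epsilon>"] iff ea by simp
    then have 2: "\<epsilon>\<^sup>2 * lam \<epsilon> n < \<mu> + \<epsilon> + k * \<epsilon>" using lam_less_iff[OF e(1) n1] by simp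
    show ?thesis using 1 2 e(1) by (simp add: abs_le_iff algebra_simps)
  qed
  have "(\<lambda>\<epsilon>. lam \<epsilon> n - \<mu> / \<epsilon>\<^sup>2) \<in> O[at_right 0](\<lambda>\<epsilon>. 1 / \<epsilon>)"
  proof (rule bigoI)
    have "\<forall>\<^sub>F \<epsilon> in at_right 0. \<epsilon> \<in> {0<..<e0}" using e0 by (rule eventually_at_right_real)
    then show "\<forall>\<^sub>F \<epsilon> in at_right 0. norm (lam \<epsilon> n - \<mu> / \<epsilon>\<^sup>2) \<le> (1 + k) * norm (1 / \<epsilon>)"
    proof eventually_elim
      case (elim \<epsilon>)
      then have e: "0 < \<epsilon>" "\<epsilon> < e0" by auto
      have "lam \<epsilon> n - \<mu> / \<epsilon>\<^sup>2 = (\<epsilon>\<^sup>2 * lam \<epsilon> n - \<mu>) / \<epsilon>\<^sup>2" using e by (simp add: field_simps)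
      then have "norm (lam \<epsilon> n - \<mu> / \<epsilon>\<^sup>2) = \<bar>\<epsilon>\<^sup>2 * lam \<epsilon> n - \<mu>\<bar> / \<epsilon>\<^sup>2" by simp
      also have "\<dots> \<le> (1 + k) * \<epsilon> / \<epsilon>\<^sup>2" using close[OF e] by (intro divide_right_mono) auto
      also have "\<dots> = (1 + k) * norm (1 / \<epsilon>)" using e by (simp add: power2_eq_square)
      finally show ?case .
    qed
  qed
  with \<open>\<mu> > 0\<close> show ?thesis by blast
qed

end

section \<open>Counting the eigenvalues of a Hermitian form\<close>

interpretation cvec: complex_space "(*s) :: complex \<Rightarrow> complex ^ 'n \<Rightarrow> _" ..

lemma hinner_hermitian: "cvec.hermitian_on V hinner"
  unfolding cvec.hermitian_on_def cvec.functional_on_def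
  using hinner_add_right hinner_scale_right hinner_cnj by blast

lemma hinner_self_pos: "F \<noteq> 0 \<Longrightarrow> Re (hinner F F) > 0"
proof -
  assume "F \<noteq> 0"
  then have "hinner F F \<noteq> 0" using hinner_self_eq_0 by blast
  then have "(\<Sum>i\<in>UNIV. (cmod (F $ i))\<^sup>2) \<noteq> 0" unfolding hinner_self of_real_eq_0_iff .
  moreover have "(\<Sum>i\<in>UNIV. (cmod (F $ i))\<^sup>2) \<ge> 0" by (simp add: sum_nonneg)
  ultimately show ?thesis unfolding hinner_self by simp
qed

lemma cvec_fin_dim: "vec.subspace V \<Longrightarrow> cvec.fin_dim V" for V :: "(complex ^ 'n) set"
  unfolding cvec.fin_dim_def using finite_cart_basis span_cart_basis by (metis subset_UNIV)

context
  fixes V :: "(complex ^ 'n) set" and q :: "complex ^ 'n \<Rightarrow> complex ^ 'n \<Rightarrow> complex"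
  assumes V: "vec.subspace V" and q: "cvec.hermitian_on V q"
begin

lemma orthonormal_basis:
  obtains B where "cvec.sylvester_basis V hinner B" "finite B" "B \<subseteq> V" "\<And>b. b \<in> B \<Longrightarrow> hinner b b = 1"
proof -
  obtain B where B: "cvec.sylvester_basis V hinner B"
    using cvec.sylvester_basis_exists[OF cvec_fin_dim[OF V] hinner_hermitian] ..
  have B': "finite B" "vec.independent B" "vec.span B = V" "\<And>b. b \<in> B \<Longrightarrow> hinner b b \<in> {-1, 0, 1}"
    using B by (auto simp: cvec.sylvester_basis_def)
  have "hinner b b = 1" if "b \<in> B" for b
  proof -
    have "b \<noteq> 0" using that B'(2) vec.dependent_zero by auto
    then have "Re (hinner b b) > 0" by (rule hinner_self_pos)
    then show ?thesis using B'(4)[OF that] by auto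
  qed
  then show ?thesis using that[OF B B'(1)] B'(3) vec.span_superset by blast
qed

text \<open>
  The representing vector exists by expansion in an orthonormal basis of \<open>V\<close>, so the definite description
  in the definition of the operator is meaningful.
\<close>

lemma form_operator_characterization:
  assumes "F \<in> V"
  shows "form_operator V q F = w \<longleftrightarrow> w \<in> V \<and> (\<forall>G\<in>V. hinner G w = q G F)"
proof -
  have unique: "w1 = w2" if "w1 \<in> V \<and> (\<forall>G\<in>V. hinner G w1 = q G F)" "w2 \<in> V \<and> (\<forall>G\<in>V. hinner G w2 = q G F)" for w1 w2
  proof -
    have "w1 - w2 \<in> V" using that V vec.subspace_diff by blast
    then have "hinner (w1 - w2) (w1 - w2) = 0" using that by (simp add: hinner_diff_right)
    then show ?thesis using hinner_self_eq_0 by fastforce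
  qed
  obtain B where B: "cvec.sylvester_basis V hinner B" "finite B" "B \<subseteq> V" "\<And>b. b \<in> B \<Longrightarrow> hinner b b = 1"
    using orthonormal_basis by blast
  have orth: "hinner b c = 0" if "b \<in> B" "c \<in> B" "b \<noteq> c" for b c
    using B(1) that by (auto simp: cvec.sylvester_basis_def)
  define r where "r = (\<Sum>b\<in>B. q b F *s b)"
  have rV: "r \<in> V" unfolding r_def using B(3) V by (auto intro!: vec.subspace_sum vec.subspace_scale)
  have "hinner G r = q G F" if G: "G \<in> V" for G
  proof -
    have "G \<in> vec.span B" using G B(1) by (simp add: cvec.sylvester_basis_def)
    then obtain u where u: "G = (\<Sum>b\<in>B. u b *s b)" using cvec.span_finite_coordinates[OF B(2)] by blast
    have "hinner G r = (\<Sum>b\<in>B. \<Sum>c\<in>B. cnj (u b) * q c F * hinner b c)"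
      unfolding u r_def by (rule cvec.hermitian_on_sum[OF hinner_hermitian V B(2) _ B(2)]) (use B(3) in auto)
    also have "\<dots> = (\<Sum>b\<in>B. \<Sum>c\<in>B. if c = b then cnj (u b) * q b F else 0)"
      using B(4) orth by (intro sum.cong) auto
    also have "\<dots> = (\<Sum>b\<in>B. cnj (u b) * q b F)" using B(2) by simp
    also have "\<dots> = (\<Sum>b\<in>B. \<Sum>c\<in>{F}. cnj (u b) * 1 * q b c)" by simp
    also have "\<dots> = q (\<Sum>b\<in>B. u b *s b) (\<Sum>c\<in>{F}. 1 *s c)"
      by (rule cvec.hermitian_on_sum[OF q V B(2), symmetric]) (use B(3) assms in auto)
    also have "\<dots> = q G F" by (simp add: u)
    finally show ?thesis .
  qed
  then have r: "r \<in> V \<and> (\<forall>G\<in>V. hinner G r = q G F)" using rV by blast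
  have "form_operator V q F = r"
    unfolding form_operator_def using r unique[OF _ r] by (rule the_equality)
  then show ?thesis using r unique[OF _ r] by blast
qed

definition pencil :: "real \<Rightarrow> complex ^ 'n \<Rightarrow> complex ^ 'n \<Rightarrow> complex" where
  "pencil x G F = q G F - of_real x * hinner G F"

lemma form_eigenspace_eq: "form_eigenspace V q x = cvec.radical V (pencil x)"
proof -
  have "form_operator V q F = of_real x *s F \<longleftrightarrow> (\<forall>G\<in>V. pencil x G F = 0)" if "F \<in> V" for F
    unfolding form_operator_characterization[OF that]
    using that V vec.subspace_scale by (auto simp: pencil_def hinner_scale_right)
  then show ?thesis by (auto simp: form_eigenspace_def cvec.radical_def)
qed

lemma pencil_hermitian: "cvec.hermitian_on V (pencil x)"
  unfolding cvec.hermitian_on_def cvec.functional_on_def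
proof (intro conjI ballI allI)
  note h = hinner_hermitian[of V]
  fix F G H :: "complex ^ 'n" and c assume V': "F \<in> V" "G \<in> V"
  show "pencil x F (c *s G) = c * pencil x F G"
    using cvec.hermitian_on_scale_right[OF q V'] by (simp add: pencil_def hinner_scale_right algebra_simps)
  show "pencil x G F = cnj (pencil x F G)"
    unfolding pencil_def cvec.hermitian_on_cnj[OF q V'] hinner_cnj[of G F] by simp
  assume "H \<in> V"
  show "pencil x F (G + H) = pencil x F G + pencil x F H"
    unfolding pencil_def hinner_add_right cvec.hermitian_on_add_right[OF q V' \<open>H \<in> V\<close>] by (simp add: algebra_simps)
qed

lemma pencil_jumps_on: "jumps_on UNIV (\<lambda>x. cvec.index V (pencil x)) (\<lambda>x. vec.dim (form_eigenspace V q x))"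
  unfolding form_eigenspace_eq cvec.nullity_def[symmetric]
proof (rule cvec.index_jumps_on[OF cvec_fin_dim[OF V]])
  show "cvec.hermitian_on V (pencil x)" for x by (rule pencil_hermitian)
  show "((\<lambda>s. pencil s F G) \<longlongrightarrow> pencil t F G) (at t)" for t F G
    unfolding pencil_def by (intro tendsto_intros)
  fix s t :: real and F :: "complex ^ 'n" assume st: "s < t"
  have pos: "Re (hinner F F) \<ge> 0" using hinner_self_pos[of F] by (cases "F = 0") auto
  then show "Re (pencil t F F) \<le> Re (pencil s F F)" using st by (simp add: pencil_def mult_right_mono)
  assume "F \<noteq> 0"
  then show "Re (pencil t F F) < Re (pencil s F F)"
    using st hinner_self_pos[of F] by (simp add: pencil_def)
qed auto

text \<open>
  The spectral theorem in counting form.  The index of \<open>q - x\<close> jumps by the dimension of the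
  eigenspace at each eigenvalue \<open>x\<close>, starts at \<open>0\<close> and ends at \<open>dim V\<close>.
\<close>

lemma form_eigenvalue_counts:
  shows "form_eigenvalue_count V q {..<0} = cvec.index V q"
    and "form_eigenvalue_count V q {0} = cvec.nullity V q"
    and "vec.dim V = form_eigenvalue_count V q {..<0} + form_eigenvalue_count V q {0} + form_eigenvalue_count V q {0<..}"
proof -
  define d where "d x = vec.dim (form_eigenspace V q x)" for x
  define c where "c x = cvec.index V (pencil x)" for x
  note fd = cvec_fin_dim[OF V]
  note J = pencil_jumps_on[folded c_def d_def]
  have "0 \<in> form_eigenspace V q x" for x
    unfolding form_eigenspace_eq using cvec.radical_subspace[OF fd pencil_hermitian] by (rule vec.subspace_0)
  then have nz: "form_eigenspace V q x \<noteq> {0} \<longleftrightarrow> d x \<noteq> 0" for x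
    unfolding d_def by auto
  have cnt: "form_eigenvalue_count V q X = sum d {x \<in> X. d x \<noteq> 0}" for X
    by (simp add: form_eigenvalue_count_def nz d_def)
  obtain K where K: "K \<ge> 0" "\<And>F. F \<in> V \<Longrightarrow> \<bar>Re (q F F)\<bar> \<le> K * Re (hinner F F)"
    using cvec.form_dominated[OF fd q hinner_hermitian hinner_self_pos] by blast
  have "c (- K) \<le> card ({} :: nat set)" unfolding c_def
  proof (rule cvec.index_le_functionals[where \<phi> = "\<lambda>_ _. 0", OF fd pencil_hermitian])
    fix F assume "F \<in> V"
    then show "0 \<le> Re (pencil (- K) F F)" using K(2)[of F] by (simp add: pencil_def)
  qed auto
  then have cK: "c (- K) = 0" by simp
  have S: "finite {y. y < x \<and> d y \<noteq> 0} \<and> c x = sum d {y. y < x \<and> d y \<noteq> 0}" for x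
    by (rule jumps_on_sum[OF J _ _ _ _ cK]) auto
  have top: "c x = vec.dim V" if "x > K" for x
  proof -
    obtain B where B: "finite B" "vec.independent B" "vec.span B = V" "card B = vec.dim V"
      using cvec.fin_dim_basis[OF fd] by blast
    have "cvec.negative_family V (pencil x) B" unfolding cvec.negative_family_def
    proof (intro conjI ballI impI)
      fix F assume F: "F \<in> vec.span B" "F \<noteq> 0"
      then have "\<bar>Re (q F F)\<bar> \<le> K * Re (hinner F F)" using K(2) B(3) by simp
      also have "\<dots> < x * Re (hinner F F)" using that hinner_self_pos[OF F(2)] by simp
      finally show "Re (pencil x F F) < 0" by (simp add: pencil_def)
    qed (use B vec.span_superset in auto)
    then have "vec.dim V \<le> c x" unfolding c_def B(4)[symmetric] by (rule cvec.index_ge[OF fd pencil_hermitian])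
    moreover obtain M where "cvec.negative_family V (pencil x) M" "card M = c x"
      unfolding c_def using cvec.index_negative_family[OF fd pencil_hermitian] by blast
    then have "c x \<le> vec.dim V" using cvec.fin_dim_independent(2)[OF fd, of M] by (auto simp: cvec.negative_family_def)
    ultimately show ?thesis by simp
  qed
  have big: "d x = 0" if "x > K" for x
    using jumps_on_jump_le[OF J, of x "x + 1"] top that by simp
  have p0: "pencil 0 = q" by (simp add: pencil_def fun_eq_iff)
  show neg: "form_eigenvalue_count V q {..<0} = cvec.index V q"
    using S[of 0] unfolding cnt by (simp add: c_def p0)
  have "sum d {x \<in> {0}. d x \<noteq> 0} = d 0"
  proof (cases "d 0 = 0")
    case False
    then have "{x \<in> {0}. d x \<noteq> 0} = {0}" by auto
    then show ?thesis by simp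
  qed (simp cong: conj_cong)
  then show zero: "form_eigenvalue_count V q {0} = cvec.nullity V q"
    unfolding cnt by (simp add: d_def form_eigenspace_eq p0 cvec.nullity_def)
  let ?A = "{x \<in> {..<0}. d x \<noteq> 0}" and ?Z = "{x \<in> {0}. d x \<noteq> 0}" and ?P = "{x \<in> {0<..}. d x \<noteq> 0}"
  have all: "{y. y < K + 1 \<and> d y \<noteq> 0} = ?A \<union> ?Z \<union> ?P" 
  proof (intro set_eqI)
    fix y
    have "y < K + 1" if "d y \<noteq> 0" using big[of y] that by (cases "y > K") auto
    then show "y \<in> {y. y < K + 1 \<and> d y \<noteq> 0} \<longleftrightarrow> y \<in> ?A \<union> ?Z \<union> ?P"
      by (cases y "0 :: real" rule: linorder_cases) auto
  qed
  then have fin: "finite ?A" "finite ?Z" "finite ?P" using S[of "K + 1"] by auto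
  have "vec.dim V = sum d (?A \<union> ?Z \<union> ?P)" using S[of "K + 1"] top[of "K + 1"] unfolding all by simp
  also have "\<dots> = sum d (?A \<union> ?Z) + sum d ?P" using fin by (intro sum.union_disjoint) auto
  also have "sum d (?A \<union> ?Z) = sum d ?A + sum d ?Z" using fin by (intro sum.union_disjoint) auto
  finally show "vec.dim V = form_eigenvalue_count V q {..<0} + form_eigenvalue_count V q {0} + form_eigenvalue_count V q {0<..}"
    unfolding cnt .
qed

end

section \<open>Slow eigenvalues\<close>

context quantum_graph
begin

text \<open>
  The coefficient of \<open>- \<tau>\<close> in \<open>stiff\<close> on edgewise constant vectors; for two such vectors it is the
  inner product of \<open>L\<^sub>2\<close>.
\<close>

definition constant_mass :: "nat \<Rightarrow> ('e \<Rightarrow> nat \<Rightarrow> complex) \<Rightarrow> ('e \<Rightarrow> nat \<Rightarrow> complex) \<Rightarrow> complex" where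
  "constant_mass N y z = (\<Sum>e\<in>UNIV. \<Sum>j<N. of_real (len e / (4 * N)) * (cnj (y e j + y e (Suc j)) * (z e j + z e (Suc j))))"

lemma constant_mass_hermitian: "node.hermitian_on V (constant_mass N)"
proof (rule node.hermitian_on_subset)
  show "node.hermitian_on UNIV (constant_mass N)"
    unfolding node.hermitian_on_def node.functional_on_def
  proof (intro conjI ballI allI)
    show "constant_mass N x (y + z) = constant_mass N x y + constant_mass N x z" for x y z
      unfolding constant_mass_def sum.distrib[symmetric] by (intro sum.cong refl) (simp add: algebra_simps)
    show "constant_mass N x (node_scale c y) = c * constant_mass N x y" for x c y
      unfolding constant_mass_def sum_distrib_left node_scale_def by (intro sum.cong refl) (simp add: algebra_simps)
    show "constant_mass N y x = cnj (constant_mass N x y)" for x y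
      unfolding constant_mass_def cnj_sum by (intro sum.cong refl) (simp add: algebra_simps)
  qed
qed simp

lemma constant_mass_pos:
  assumes N: "N \<ge> 1" and F: "F \<in> F0" "edge_const N F \<noteq> 0"
  shows "Re (constant_mass N (edge_const N F) (edge_const N F)) > 0"
proof -
  have "constant_mass N (edge_const N F) (edge_const N F) = (\<Sum>e\<in>UNIV. of_real (len e * (cmod (F $ Inl e))\<^sup>2))"
    unfolding constant_mass_def
  proof (intro sum.cong refl)
    fix e
    have "(\<Sum>j<N. complex_of_real (len e / (4 * N)) * (cnj (edge_const N F e j + edge_const N F e (Suc j)) * (edge_const N F e j + edge_const N F e (Suc j))))
       = (\<Sum>j<N. complex_of_real (len e / (4 * N)) * (4 * (F $ Inl e * cnj (F $ Inl e))))"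
      by (intro sum.cong refl) (simp add: edge_const_def algebra_simps)
    also have "\<dots> = of_real (len e * (cmod (F $ Inl e))\<^sup>2)"
      unfolding complex_norm_square[symmetric] of_real_mult using N by (simp add: field_simps)
    finally show "(\<Sum>j<N. complex_of_real (len e / (4 * N)) * (cnj (edge_const N F e j + edge_const N F e (Suc j)) * (edge_const N F e j + edge_const N F e (Suc j))))
       = of_real (len e * (cmod (F $ Inl e))\<^sup>2)" .
  qed
  then have eq: "Re (constant_mass N (edge_const N F) (edge_const N F)) = (\<Sum>e\<in>UNIV. len e * (cmod (F $ Inl e))\<^sup>2)"
    by (simp add: Re_sum)
  obtain e where "F $ Inl e \<noteq> 0" using F(2) by (auto simp: edge_const_def fun_eq_iff split: if_splits)
  then show ?thesis unfolding eq using len_pos[of e]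
    by (intro sum_pos2[of UNIV e]) (auto intro!: mult_nonneg_nonneg less_imp_le[OF len_pos])
qed

lemma stiff_slope:
  assumes N: "N \<ge> 1"
  shows "((\<lambda>\<tau>. stiff len N \<tau> (edge_const N F) x / of_real \<tau>) \<longlongrightarrow> - constant_mass N (edge_const N F) x) (at 0)"
proof -
  have lim: "((\<lambda>\<tau>. rtan (piece_arg len N \<tau> e) / \<tau>) \<longlongrightarrow> (len e / (2 * N))\<^sup>2) (at 0)" for e
  proof -
    define s where "s = (len e / (2 * N))\<^sup>2"
    have s: "s > 0" using len_pos[of e] N by (simp add: s_def)
    have "filterlim (\<lambda>\<tau>. \<tau> * s) (at 0) (at 0)"
      unfolding filterlim_at using s by (auto intro!: tendsto_eq_intros simp: eventually_at_filter)
    then have "((\<lambda>\<tau>. rtan (\<tau> * s) / (\<tau> * s)) \<longlongrightarrow> 1) (at 0)"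
      by (rule filterlim_compose[OF rtan_over_tendsto])
    then have "((\<lambda>\<tau>. s * (rtan (\<tau> * s) / (\<tau> * s))) \<longlongrightarrow> s * 1) (at 0)" by (rule tendsto_mult_left)
    then show ?thesis unfolding piece_arg_def s_def[symmetric] using s by simp
  qed
  define P where "P e j = cnj (edge_const N F e j + edge_const N F e (Suc j)) * (x e j + x e (Suc j))" for e j
  have "((\<lambda>\<tau>. \<Sum>e\<in>UNIV. \<Sum>j<N. of_real (N / len e) * (- (of_real (rtan (piece_arg len N \<tau> e) / \<tau>) * P e j))) \<longlongrightarrow>
     (\<Sum>e\<in>UNIV. \<Sum>j<N. of_real (N / len e) * (- (of_real ((len e / (2 * N))\<^sup>2) * P e j)))) (at 0)"
    by (intro tendsto_sum tendsto_mult tendsto_const tendsto_minus tendsto_of_real lim)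
  moreover have "(\<Sum>e\<in>UNIV. \<Sum>j<N. of_real (N / len e) * (- (of_real ((len e / (2 * N))\<^sup>2) * P e j))) = - constant_mass N (edge_const N F) x"
    unfolding constant_mass_def sum_negf[symmetric]
  proof (intro sum.cong refl)
    fix e j
    have "N / len e * (len e / (2 * N))\<^sup>2 = len e / (4 * N)" using len_pos[of e] N by (simp add: power2_eq_square)
    then have "complex_of_real (N / len e) * of_real ((len e / (2 * N))\<^sup>2) = of_real (len e / (4 * N))"
      unfolding of_real_mult[symmetric] by simp
    then show "of_real (N / len e) * (- (of_real ((len e / (2 * N))\<^sup>2) * P e j)) = - (of_real (len e / (4 * N)) * (cnj (edge_const N F e j + edge_const N F e (Suc j)) * (x e j + x e (Suc j))))"
      unfolding P_def[symmetric] by (metis mult.assoc mult_minus_right)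
  qed
  moreover have "stiff len N \<tau> (edge_const N F) x / of_real \<tau> = (\<Sum>e\<in>UNIV. \<Sum>j<N. of_real (N / len e) * (- (of_real (rtan (piece_arg len N \<tau> e) / \<tau>) * P e j)))" for \<tau>
    unfolding stiff_def sum_divide_distrib
  proof (intro sum.cong refl)
    fix e j assume "j \<in> {..<N}"
    then have "edge_const N F e j - edge_const N F e (Suc j) = 0" by (simp add: edge_const_def)
    then show "of_real (N / len e) * (of_real (rcot (piece_arg len N \<tau> e)) * (cnj (edge_const N F e j - edge_const N F e (Suc j)) * (x e j - x e (Suc j)))
      - of_real (rtan (piece_arg len N \<tau> e)) * (cnj (edge_const N F e j + edge_const N F e (Suc j)) * (x e j + x e (Suc j)))) / of_real \<tau>
      = of_real (N / len e) * (- (of_real (rtan (piece_arg len N \<tau> e) / \<tau>) * P e j))"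
      unfolding P_def by simp
  qed
  ultimately show ?thesis by simp
qed

lemma coupling_hermitian_F0: "cvec.hermitian_on V coupling"
  unfolding cvec.hermitian_on_def cvec.functional_on_def
  using coupling_add_right coupling_scale_right coupling_cnj by blast

text \<open>
  A Sylvester basis of \<open>q\<close> on \<open>\<F>\<^sub>0\<close>, extended to a basis of all nodal values, brings the nodal
  form into the abstract situation.
\<close>

lemma two_scale_instance:
  assumes N: "N \<ge> 1" and C: "cvec.sylvester_basis F0 coupling C"
  obtains Bw where "two_scale_forms node_scale (nodal N) (stiff len N)
    (\<lambda>y z. coupling (end_values N y) (end_values N z)) (constant_mass N)
    (edge_const N ` cvec.signature coupling C (-1)) (edge_const N ` cvec.signature coupling C 0)
    (edge_const N ` cvec.signature coupling C 1) Bw"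
proof -
  interpret p: complex_space_pair "(*s) :: complex \<Rightarrow> complex ^ ('e + 'e) \<Rightarrow> _" "node_scale :: complex \<Rightarrow> ('e \<Rightarrow> nat \<Rightarrow> complex) \<Rightarrow> _"
    by intro_locales
  have C': "finite C" "vec.independent C" "vec.span C = F0" "\<And>x y. x \<in> C \<Longrightarrow> y \<in> C \<Longrightarrow> x \<noteq> y \<Longrightarrow> coupling x y = 0"
    "\<And>x. x \<in> C \<Longrightarrow> coupling x x \<in> {-1, 0, 1}"
    using C by (auto simp: cvec.sylvester_basis_def)
  have CF: "C \<subseteq> F0" using C'(3) vec.span_superset by blast
  let ?S = "cvec.signature coupling C" and ?E = "edge_const N"
  have Csplit: "C = ?S (-1) \<union> ?S 0 \<union> ?S 1" using C'(5) by (auto simp: cvec.signature_def)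
  then have Ecup: "?E ` ?S (-1) \<union> ?E ` ?S 0 \<union> ?E ` ?S 1 = ?E ` C" by blast
  have EV: "?E ` C \<subseteq> nodal N" using CF edge_const_nodal by blast
  have Eind: "node.independent (?E ` C)"
    by (rule p.independent_inj_image(1)[OF edge_const_linear F0_subspace edge_const_inj CF C'(2)])
  obtain B where B: "?E ` C \<subseteq> B" "B \<subseteq> nodal N" "node.independent B" "nodal N \<subseteq> node.span B"
    using node.maximal_independent_subset_extend[OF EV Eind] by blast
  have finB: "finite B" using node.fin_dim_independent(1)[OF nodal_fin_dim B(2,3)] .
  have spanB: "node.span B = nodal N" using B(2,4) nodal_subspace by (intro subset_antisym node.span_minimal)
  have spanE: "node.span (?E ` C) = ?E ` F0"
    unfolding p.linear_span_image[OF edge_const_linear] C'(3) ..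
  have Einj: "inj_on ?E C" using edge_const_inj CF inj_on_subset by blast
  define Bw where "Bw = B - ?E ` C"
  have un: "?E ` C \<union> Bw = B" unfolding Bw_def using B(1) by blast
  have Ssub: "?S s \<subseteq> C" for s by (auto simp: cvec.signature_def)
  have Edisj: "?E ` ?S s \<inter> ?E ` ?S t = {}" if "s \<noteq> t" for s t
    using that inj_on_image_Int[OF Einj Ssub Ssub, of s t] by (auto simp: cvec.signature_def)
  have qE: "coupling (end_values N (?E x)) (end_values N (?E y)) = coupling x y" if "x \<in> C" "y \<in> C" for x y
    using end_values_edge_const CF that by (simp add: subset_iff)
  have "two_scale_forms node_scale (nodal N) (stiff len N)
    (\<lambda>y z. coupling (end_values N y) (end_values N z)) (constant_mass N) (?E ` ?S (-1)) (?E ` ?S 0) (?E ` ?S 1) Bw"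
  proof (intro two_scale_forms.intro two_scale_forms_axioms.intro, unfold Ecup un)
    show "complex_space (node_scale :: complex \<Rightarrow> ('e \<Rightarrow> nat \<Rightarrow> complex) \<Rightarrow> _)" by (rule node.complex_space_axioms)
    show "finite (?E ` ?S (-1))" "finite (?E ` ?S 0)" "finite (?E ` ?S 1)"
      using C'(1) Ssub finite_subset by blast+
    show "finite Bw" using finB by (simp add: Bw_def)
    show "?E ` ?S (-1) \<inter> ?E ` ?S 0 = {}" by (rule Edisj) simp
    show "(?E ` ?S (-1) \<union> ?E ` ?S 0) \<inter> ?E ` ?S 1 = {}"
      using Edisj[of "-1" 1] Edisj[of 0 1] by (simp add: Int_Un_distrib2)
    show "?E ` C \<inter> Bw = {}" by (auto simp: Bw_def)
    show "node.independent B" by (rule B(3))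
    show "node.span B = nodal N" by (rule spanB)
    show "node.hermitian_on (nodal N) (stiff len N \<tau>)" for \<tau>
      by (rule node.hermitian_on_subset[OF stiff_hermitian]) simp
    show "node.hermitian_on (nodal N) (\<lambda>y z. coupling (end_values N y) (end_values N z))"
      by (rule node.hermitian_on_subset[OF coupling_hermitian]) simp
    show "node.hermitian_on (nodal N) (constant_mass N)" by (rule constant_mass_hermitian)
    show "stiff len N 0 b x = 0" if b: "b \<in> ?E ` C" for b x
    proof -
      obtain F where "b = ?E F" using b by blast
      then have "stiff len N 0 x b = 0" by (simp add: stiff_0_edge_const)
      then show ?thesis using node.hermitian_on_cnj[OF stiff_hermitian UNIV_I UNIV_I, of len N 0 b x] by simp
    qed
    show "((\<lambda>\<tau>. stiff len N \<tau> x y) \<longlongrightarrow> stiff len N 0 x y) (at 0)" for x y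
      by (rule stiff_isCont) (simp add: valid_def piece_arg_def)
    show "((\<lambda>\<tau>. stiff len N \<tau> b x / of_real \<tau>) \<longlongrightarrow> - constant_mass N b x) (at 0)" if "b \<in> ?E ` C" for b x
      using that stiff_slope[OF N] by blast
    show "0 \<le> Re (stiff len N 0 x x)" for x by (rule stiff_0_nonneg)
    show "x \<in> node.span (?E ` C)" if "x \<in> nodal N" "Re (stiff len N 0 x x) = 0" for x
      unfolding spanE using that by (rule stiff_0_eq_0)
    show "0 < Re (constant_mass N x x)" if "x \<in> node.span (?E ` C)" "x \<noteq> 0" for x
      using that constant_mass_pos[OF N] unfolding spanE by blast
    show "coupling (end_values N b) (end_values N c) = 0" if bc: "b \<in> ?E ` C" "c \<in> ?E ` C" "b \<noteq> c" for b c
    proof -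
      obtain F G where FG: "F \<in> C" "G \<in> C" "b = ?E F" "c = ?E G" using bc(1,2) by blast
      then have "F \<noteq> G" using bc(3) by blast
      then show ?thesis using C'(4)[OF FG(1,2)] qE[OF FG(1,2)] FG(3,4) by simp
    qed
    show "coupling (end_values N b) (end_values N b) = -1" if b: "b \<in> ?E ` ?S (-1)" for b
    proof -
      obtain F where F: "F \<in> C" "b = ?E F" "coupling F F = -1" using b by (auto simp: cvec.signature_def)
      then show ?thesis using qE by simp
    qed
    show "coupling (end_values N b) (end_values N b) = 0" if b: "b \<in> ?E ` ?S 0" for b
    proof -
      obtain F where F: "F \<in> C" "b = ?E F" "coupling F F = 0" using b by (auto simp: cvec.signature_def)
      then show ?thesis using qE by simp
    qed
    show "coupling (end_values N b) (end_values N b) = 1" if b: "b \<in> ?E ` ?S 1" for b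
    proof -
      obtain F where F: "F \<in> C" "b = ?E F" "coupling F F = 1" using b by (auto simp: cvec.signature_def)
      then show ?thesis using qE by simp
    qed
  qed
  then show ?thesis by (rule that)
qed

lemma eventually_count:
  assumes N: "N \<ge> 1" and h: "(h \<longlongrightarrow> 0) (at_right 0)"
  shows "\<forall>\<^sub>F \<epsilon> in at_right 0. eig_count \<epsilon> (h \<epsilon>) = nindex N \<epsilon> (h \<epsilon>)"
proof -
  have "\<forall>\<^sub>F \<epsilon> in at_right 0. h \<epsilon> < valid_bound len N"
    using order_tendstoD(2)[OF h valid_bound_pos[OF N]] .
  moreover have "\<forall>\<^sub>F \<epsilon> in at_right 0. \<epsilon> > (0::real)" by (rule eventually_at_right_less)
  ultimately show ?thesis
    by eventually_elim (use eig_count_eq[OF _ N] valid_iff[of len N, OF len_pos N] in auto)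
qed

abbreviation "n_neg \<equiv> cvec.index F0 coupling"
abbreviation "n_zero \<equiv> cvec.nullity F0 coupling"

text \<open>
  In the scale \<open>\<tau> = t \<epsilon>\<close> the counting function of \<open>\<epsilon> \<lambda>\<^sub>n\<close> converges to that of \<open>slow_limit\<close>, and in the
  scale \<open>\<tau> = t \<epsilon>\<^sup>2\<close> the counting function of \<open>\<lambda>\<^sub>n\<close> converges to that of \<open>exotic_limit\<close>.
\<close>

lemma slow_eigenvalues:
  assumes n: "1 \<le> n" "n \<le> vec.dim F0"
  shows "\<exists>c. ((\<lambda>\<epsilon>. \<epsilon> * lam \<epsilon> n) \<longlongrightarrow> c) (at_right 0) \<and>
      (n \<le> n_neg \<longrightarrow> c < 0) \<and> (n_neg + n_zero < n \<longrightarrow> 0 < c)"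
    and "n_neg < n \<Longrightarrow> n \<le> n_neg + n_zero \<Longrightarrow> \<exists>c\<le>0. ((\<lambda>\<epsilon>. lam \<epsilon> n) \<longlongrightarrow> c) (at_right 0)"
proof -
  obtain C where C: "cvec.sylvester_basis F0 coupling C"
    using cvec.sylvester_basis_exists[OF cvec_fin_dim[OF F0_subspace] coupling_hermitian_F0] ..
  let ?S = "cvec.signature coupling C"
  (* tau tends to 0, so one piece per edge is enough *)
  define N :: nat where "N = 1"
  have N: "N \<ge> 1" by (simp add: N_def)
  let ?E = "edge_const N"
  obtain Bw where "two_scale_forms node_scale (nodal N) (stiff len N)
    (\<lambda>y z. coupling (end_values N y) (end_values N z)) (constant_mass N) (?E ` ?S (-1)) (?E ` ?S 0) (?E ` ?S 1) Bw"
    using two_scale_instance[OF N C] by blast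
  then interpret T: two_scale_forms node_scale "nodal N" "stiff len N"
    "\<lambda>y z. coupling (end_values N y) (end_values N z)" "constant_mass N" "?E ` ?S (-1)" "?E ` ?S 0" "?E ` ?S 1" Bw .
  have C': "finite C" "C \<subseteq> F0" "vec.independent C" "vec.span C = F0" "\<And>x. x \<in> C \<Longrightarrow> coupling x x \<in> {-1, 0, 1}"
    using C vec.span_superset by (auto simp: cvec.sylvester_basis_def)
  have inj: "inj_on ?E C" using edge_const_inj C'(2) inj_on_subset by blast
  have cardE: "card (?E ` ?S s) = card (?S s)" for s
    using inj by (intro card_image) (rule inj_on_subset, auto simp: cvec.signature_def)
  have neg: "card (?E ` ?S (-1)) = n_neg" and zero: "card (?E ` ?S 0) = n_zero"
    unfolding cardE by (simp_all add: cvec.index_eq_card[OF C coupling_hermitian_F0] cvec.nullity_eq_card[OF C coupling_hermitian_F0])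
  have Csplit: "?S (-1) \<union> ?S 0 \<union> ?S 1 = C" using C'(5) by (auto simp: cvec.signature_def)
  have all: "card (?E ` ?S (-1) \<union> ?E ` ?S 0 \<union> ?E ` ?S 1) = vec.dim F0"
    unfolding image_Un[symmetric] Csplit card_image[OF inj]
    using vec.dim_span_eq_card_independent[OF C'(3)] C'(4) by simp
  have form: "T.perturbed \<epsilon> \<tau> = nform len N \<tau> \<epsilon>" for \<epsilon> \<tau>
    by (simp add: T.perturbed_def nform_def fun_eq_iff)
  have pos: "\<forall>\<^sub>F \<epsilon> in at_right 0. \<epsilon> > (0::real)" by (rule eventually_at_right_less)
  have id0: "((\<lambda>\<epsilon>. \<epsilon>) \<longlongrightarrow> (0::real)) (at_right 0)" by (rule tendsto_ident_at)
  define j1 where "j1 c = node.index (nodal N) (T.slow_limit c)" for c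
  define z1 where "z1 c = node.nullity (nodal N) (T.slow_limit c)" for c
  have J1: "jumps_on UNIV j1 z1" unfolding j1_def[abs_def] z1_def[abs_def] by (rule T.slow_limit_jumps_on)
  obtain K where K: "K \<ge> 0" "j1 (- K) = 0" "vec.dim F0 \<le> j1 (K + 1)"
    using T.slow_limit_extreme unfolding all j1_def by blast
  have a1: "j1 (- K) < n" and b1: "n \<le> j1 (K + 1)" using K n by simp_all
  note lev1 = level_less_iff[OF J1, of "- K" n "K + 1", OF _ UNIV_I a1 UNIV_I b1 UNIV_I, simplified]
  define c where "c = level UNIV j1 n"
  have "((\<lambda>\<epsilon>. \<epsilon> * lam \<epsilon> n) \<longlongrightarrow> c) (at_right 0)"
    unfolding c_def
  proof (rule level_tendsto[OF J1 a1 b1, where C = "\<lambda>\<epsilon> t. eig_count \<epsilon> (t * \<epsilon>)"])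
    fix t
    show "\<forall>\<^sub>F \<epsilon> in at_right 0. \<epsilon> * lam \<epsilon> n < t \<longleftrightarrow> n \<le> eig_count \<epsilon> (t * \<epsilon>)"
      using pos
    proof eventually_elim
      case (elim \<epsilon>)
      have "\<epsilon> * lam \<epsilon> n < t \<longleftrightarrow> \<epsilon> * (\<epsilon> * lam \<epsilon> n) < \<epsilon> * t" using elim by simp
      also have "\<dots> \<longleftrightarrow> n \<le> eig_count \<epsilon> (t * \<epsilon>)"
        using lam_less_iff[OF elim n(1), of "t * \<epsilon>"] by (simp add: power2_eq_square mult_ac)
      finally show ?case .
    qed
    have "((\<lambda>\<epsilon>. t * \<epsilon>) \<longlongrightarrow> 0) (at_right 0)" by (rule tendsto_mult_right_zero[OF id0])
    from eventually_count[OF N this] T.index_squeezed_slow_limit[of t]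
    show "\<forall>\<^sub>F \<epsilon> in at_right 0. j1 t \<le> eig_count \<epsilon> (t * \<epsilon>) \<and> eig_count \<epsilon> (t * \<epsilon>) \<le> j1 t + z1 t"
      by eventually_elim (simp add: j1_def z1_def form)
  qed
  moreover have "c < 0" if "n \<le> n_neg"
    unfolding c_def lev1 using that T.slow_limit_index_neg unfolding neg j1_def by simp
  moreover have "0 < c" if big: "n_neg + n_zero < n"
  proof -
    have "\<forall>\<^sub>F s in at_right 0. j1 s = j1 0 + z1 0 \<and> s > 0"
      using J1 by (intro eventually_conj eventually_at_right_less) (auto simp: jumps_on_def)
    then obtain s where s: "j1 s = j1 0 + z1 0" "s > 0"
      using eventually_happens'[of "at_right (0::real)"] by (auto simp: trivial_limit_at_right_real)
    have "j1 0 + z1 0 \<le> n_neg + n_zero" using T.slow_limit_index_nullity unfolding neg zero j1_def z1_def .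
    then have "\<not> c < s" unfolding c_def lev1 using s big by simp
    then show ?thesis using s(2) by simp
  qed
  ultimately show "\<exists>c. ((\<lambda>\<epsilon>. \<epsilon> * lam \<epsilon> n) \<longlongrightarrow> c) (at_right 0) \<and>
      (n \<le> n_neg \<longrightarrow> c < 0) \<and> (n_neg + n_zero < n \<longrightarrow> 0 < c)" by blast
  show "\<exists>c\<le>0. ((\<lambda>\<epsilon>. lam \<epsilon> n) \<longlongrightarrow> c) (at_right 0)" if ex: "n_neg < n" "n \<le> n_neg + n_zero"
  proof -
    define j2 where "j2 c = node.index (nodal N) (T.exotic_limit c)" for c
    define z2 where "z2 c = node.nullity (nodal N) (T.exotic_limit c)" for c
    have J2: "jumps_on UNIV j2 z2" unfolding j2_def[abs_def] z2_def[abs_def] by (rule T.exotic_limit_jumps_on)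
    obtain a where "j2 a \<le> n_neg" using T.exotic_limit_index_lower unfolding neg j2_def by blast
    then have a2: "j2 a < n" using ex by simp
    have up: "n_neg + n_zero \<le> j2 s" if "s > 0" for s
      using T.exotic_limit_index_positive[OF that] unfolding neg zero j2_def .
    have b2: "n \<le> j2 1" using up[of 1] ex by simp
    note lev2 = level_less_iff[OF J2, of a n 1, OF _ UNIV_I a2 UNIV_I b2 UNIV_I, simplified]
    have "level UNIV j2 n \<le> 0"
    proof (rule dense_ge)
      fix s :: real assume "0 < s"
      then have "level UNIV j2 n < s" unfolding lev2 using up[of s] ex by simp
      then show "level UNIV j2 n \<le> s" by simp
    qed
    moreover have "((\<lambda>\<epsilon>. lam \<epsilon> n) \<longlongrightarrow> level UNIV j2 n) (at_right 0)"
    proof (rule level_tendsto[OF J2 a2 b2, where C = "\<lambda>\<epsilon> t. eig_count \<epsilon> (t * \<epsilon>\<^sup>2)"])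
      fix t
      show "\<forall>\<^sub>F \<epsilon> in at_right 0. lam \<epsilon> n < t \<longleftrightarrow> n \<le> eig_count \<epsilon> (t * \<epsilon>\<^sup>2)"
        using pos
      proof eventually_elim
        case (elim \<epsilon>)
        have "lam \<epsilon> n < t \<longleftrightarrow> \<epsilon>\<^sup>2 * lam \<epsilon> n < \<epsilon>\<^sup>2 * t" using elim by simp
        also have "\<dots> \<longleftrightarrow> n \<le> eig_count \<epsilon> (t * \<epsilon>\<^sup>2)"
          using lam_less_iff[OF elim n(1), of "t * \<epsilon>\<^sup>2"] by (simp add: mult_ac)
        finally show ?case .
      qed
      have "((\<lambda>\<epsilon>. t * \<epsilon>\<^sup>2) \<longlongrightarrow> t * 0\<^sup>2) (at_right 0)" by (intro tendsto_intros id0)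
      then have "((\<lambda>\<epsilon>. t * \<epsilon>\<^sup>2) \<longlongrightarrow> 0) (at_right 0)" by simp
      from eventually_count[OF N this] T.index_squeezed_exotic_limit[of t]
      show "\<forall>\<^sub>F \<epsilon> in at_right 0. j2 t \<le> eig_count \<epsilon> (t * \<epsilon>\<^sup>2) \<and> eig_count \<epsilon> (t * \<epsilon>\<^sup>2) \<le> j2 t + z2 t"
        by eventually_elim (simp add: j2_def z2_def form)
    qed
    ultimately show ?thesis by blast
  qed
qed

end

theorem theorem2p1:
  fixes len :: "'e::finite \<Rightarrow> real"
    and P\<^sub>D P\<^sub>N P\<^sub>R \<Lambda> :: "complex ^ ('e + 'e) ^ ('e + 'e)"
    and \<F>\<^sub>0 :: "(complex ^ ('e + 'e)) set"
    and q :: "complex ^ ('e + 'e) \<Rightarrow> complex ^ ('e + 'e) \<Rightarrow> complex"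
    and m\<^sub>0 nneg nzero npos :: nat
  assumes "\<And>e. len e > 0"
    and "orthogonal_projector P\<^sub>D" "orthogonal_projector P\<^sub>N" "orthogonal_projector P\<^sub>R"
    and "P\<^sub>D + P\<^sub>N + P\<^sub>R = mat 1"
    and "invertible_selfadjoint_on (range (\<lambda>F. P\<^sub>R *v F)) \<Lambda>"
    and "\<F>\<^sub>0 = edgewise_constant \<inter> {F. P\<^sub>D *v F = 0}"
    and "m\<^sub>0 = vec.dim \<F>\<^sub>0"
    and "q = (\<lambda>G F. hinner G (P\<^sub>R *v (\<Lambda> *v (P\<^sub>R *v F))))"
    and "nneg = form_eigenvalue_count \<F>\<^sub>0 q {..<0}"
    and "nzero = form_eigenvalue_count \<F>\<^sub>0 q {0}"
    and "npos = form_eigenvalue_count \<F>\<^sub>0 q {0<..}"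
  shows "\<exists>lam :: real \<Rightarrow> nat \<Rightarrow> real.
    (\<forall>\<epsilon>>0. enumerates_eigenvalues (graph_laplacian (\<lambda>e. \<epsilon> * len e) P\<^sub>D P\<^sub>N P\<^sub>R \<Lambda>) (lam \<epsilon>)) \<and>
    (\<forall>n>m\<^sub>0. \<exists>\<mu>>0. (\<lambda>\<epsilon>. lam \<epsilon> n - \<mu> / \<epsilon>\<^sup>2) \<in> O[at_right 0](\<lambda>\<epsilon>. 1 / \<epsilon>)) \<and>
    m\<^sub>0 = nneg + nzero + npos \<and>
    (\<forall>n\<in>{1..nneg}. \<exists>c<0. ((\<lambda>\<epsilon>. \<epsilon> * lam \<epsilon> n) \<longlongrightarrow> c) (at_right 0)) \<and>
    (\<forall>n\<in>{nneg + 1..nneg + nzero}. \<exists>c\<le>0. ((\<lambda>\<epsilon>. lam \<epsilon> n) \<longlongrightarrow> c) (at_right 0)) \<and>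
    (\<forall>n\<in>{nneg + nzero + 1..m\<^sub>0}. \<exists>c>0. ((\<lambda>\<epsilon>. \<epsilon> * lam \<epsilon> n) \<longlongrightarrow> c) (at_right 0))"
proof -
  interpret quantum_graph P\<^sub>D P\<^sub>N P\<^sub>R \<Lambda> len
    using assms(1-6) by unfold_locales
  have F: "\<F>\<^sub>0 = F0" using assms(7) by (simp add: F0_def)
  have q: "q = coupling" using assms(9) by (simp add: coupling_def fun_eq_iff)
  note counts = form_eigenvalue_counts[OF F0_subspace coupling_hermitian_F0]
  have m: "m\<^sub>0 = vec.dim F0" using assms(8) F by simp
  have nn: "nneg = n_neg" "nzero = n_zero" using assms(10,11) counts(1,2) F q by simp_all
  have total: "m\<^sub>0 = nneg + nzero + npos" using counts(3) assms(10-12) m F q by simp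
  show ?thesis
  proof (intro exI[of _ lam] conjI allI impI ballI)
    show "enumerates_eigenvalues (graph_laplacian (\<lambda>e. \<epsilon> * len e) P\<^sub>D P\<^sub>N P\<^sub>R \<Lambda>) (lam \<epsilon>)" if "\<epsilon> > 0" for \<epsilon>
      using that by (rule lam_enumerates)
    show "\<exists>\<mu>>0. (\<lambda>\<epsilon>. lam \<epsilon> n - \<mu> / \<epsilon>\<^sup>2) \<in> O[at_right 0](\<lambda>\<epsilon>. 1 / \<epsilon>)" if "m\<^sub>0 < n" for n
      using that unfolding m by (rule fast_eigenvalues)
    show "m\<^sub>0 = nneg + nzero + npos" by (rule total)
    show "\<exists>c<0. ((\<lambda>\<epsilon>. \<epsilon> * lam \<epsilon> n) \<longlongrightarrow> c) (at_right 0)" if "n \<in> {1..nneg}" for n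
    proof -
      have "1 \<le> n" "n \<le> vec.dim F0" "n \<le> n_neg" using that total unfolding m nn by auto
      then show ?thesis using slow_eigenvalues(1)[of n] by blast
    qed
    show "\<exists>c\<le>0. ((\<lambda>\<epsilon>. lam \<epsilon> n) \<longlongrightarrow> c) (at_right 0)" if "n \<in> {nneg + 1..nneg + nzero}" for n
    proof -
      have "1 \<le> n" "n \<le> vec.dim F0" "n_neg < n" "n \<le> n_neg + n_zero" using that total unfolding m nn by auto
      then show ?thesis by (rule slow_eigenvalues(2))
    qed
    show "\<exists>c>0. ((\<lambda>\<epsilon>. \<epsilon> * lam \<epsilon> n) \<longlongrightarrow> c) (at_right 0)" if "n \<in> {nneg + nzero + 1..m\<^sub>0}" for n
    proof -
      have "1 \<le> n" "n \<le> vec.dim F0" "n_neg + n_zero < n" using that unfolding m nn by auto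
      then show ?thesis using slow_eigenvalues(1)[of n] by blast
    qed
  qed
qed

end
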